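(* Let $p$ be a prime and $\Phi=(\phi_1,\dots,\phi_k)$ a system of linear forms $\phi_j\colon\mathbb{F}_p^d\to\mathbb{F}_p$, regarded as a linear datum with index set $[k]$. Let $i\in[k]$, and suppose $s=s(\Phi,i)<\infty$ and $s(\Phi)\le s+1$. Then $\Phi\vdash^M_\gamma\mathrm{gc}_s(\mathbb{F}_p)$ where $\gamma(\triangle)=(i,0)$ or $(i,1)$ and $M\ll k^3(\log k+\log\log(10L))$, where $L$ is such that $\phi_j(x)=\sum_\ell a_{j\ell}x_\ell$ with integers $|a_{j\ell}|\le L$ (absolute implied constant).
   Context: A system of linear forms $\Phi$ is regarded as the linear datum with $V=\mathbb{F}_p^d$, $W_j=\mathbb{F}_p$, maps $\phi_j$. In general a linear datum $(I,V,(W_i),(\phi_i))$ has a finite index set, finite-dimensional $\mathbb{F}_p$-spaces and linear maps $\phi_i\colon V\to W_i$. $s(\Phi,i)$ is the largest $t\ge0$ with $\phi_i^{\otimes t}\in\operatorname{span}(\phi_j^{\otimes t}:j\ne i)$ in $((\mathbb{F}_p^d)^* )^{\otimes t}$ ($\infty$ if no largest exists); $s(\Phi)=\max_i s(\Phi,i)$. $\mathrm{gc}_s(\mathbb{F}_p)$ is the datum with $V=\mathbb{F}_p^{s+1}$, indices $\triangle,1,\dots,s+1$, $W_\triangle=\mathbb{F}_p$, $W_r=\mathbb{F}_p^s$, $\phi_\triangle$ the sum of coordinates and $\phi_r$ omitting the $r$-th coordinate. Morphisms: with $W_*=\{0\}$, $\phi_*=0$, a morphism $\Psi\to\Phi$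 of shape $\alpha\colon I^\Phi\to I^\Psi\cup\{*\}$ is a linear $\theta\colon V^\Psi\to V^\Phi$ and linear $\sigma_j\colon W^\Psi_{\alpha(j)}\to W^\Phi_j$ with $\sigma_j\circ\phi^\Psi_{\alpha(j)}=\phi^\Phi_j\circ\theta$; it respects $j$ if $\alpha(j)\ne*$, is not the image of another index, $W^\Phi_j=W^\Psi_{\alpha(j)}$ and $\sigma_j=\mathrm{id}$. Self-joining $\Phi+_S\Phi$: indices $(L,i),(R,i)$ for $i\notin S$, space $\{(v_0,v_1):\phi_i(v_0)=\phi_i(v_1)\,\forall i\in S\}$, maps $\phi_i(v_0)$ and $\phi_i(v_1)$. For a partial $\gamma\colon I^\Psi\to I^\Phi\times\{0,1\}$, $\Phi\vdash^k_\gamma\Psi$ is defined recursively: (a) a morphism $\Theta\colon\Psi\to\Phi$ exists, $k=0$, $\gamma=\{\alpha^\Theta(i)\mapsto(i,0):\Theta\text{ respects }i\}$; (b) $\Psi=\Phi+_S\Phi$, $\gamma(L,i)=(i,0)$, $\gamma(R,i)=(i,1)$; (c) composition $\Phi\vdash^{k_1}_{\gamma_1}\Xi\vdash^{k_2}_{\gamma_2}\Psi$ with $k=k_1+k_2$ and $\gamma(j)=(i,a_1+a_2\bmod2)$ when $\gamma_2(j)=(\ell,a_2)$, $\gamma_1(\ell)=(i,a_1)$; (d) $\Phi\vdash^{k'}_{\gamma'}\Psi$ with $k'\le k$ and $\gamma\subseteq\gamma'$. *)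

theory Defs
  imports
    Complex_Main
    "HOL-Number_Theory.Residues"
    "HOL-Library.Extended_Nat"
    "HOL-Library.Nat_Bijection"
    "HOL-Library.Z2"
    "Jordan_Normal_Form.Missing_VectorSpace"
begin

text \<open>The prime is a value rather than a type, so that implied constants can be quantified
  before it.\<close>

abbreviation Fp :: "nat \<Rightarrow> int ring" where
  "Fp p \<equiv> residue_ring (int p)"

text \<open>Self-joining changes the index set and the spaces of a datum, so derivations need index and
  vector types that are closed under this operation. Indices are trees with tags \<open>Left\<close> and
  \<open>Right\<close>. Every vector is a function on \<open>nat\<close>: the coordinate space of dimension \<open>n\<close> consists of
  functions on \<open>{1..n}\<close>, and pairs of vectors are encoded by the bijection of \<open>nat + nat\<close>
  with \<open>nat\<close>. A space is an arbitrary vector space structure on a set of such functions, hence every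
  finite-dimensional space over the prime field occurs up to isomorphism.\<close>

datatype index = Num nat | Triangle | Left index | Right index

type_synonym vector = "nat \<Rightarrow> int"

type_synonym space = "(int, vector) module"

definition coord_space :: "nat \<Rightarrow> nat \<Rightarrow> space" where
  "coord_space p n = LinearCombinations.ring.func_space (Fp p) {1..n}"

definition scalar :: "int \<Rightarrow> vector" where
  "scalar x = (\<lambda>l\<in>{1}. x)"

definition pair :: "vector \<Rightarrow> vector \<Rightarrow> vector" where
  "pair v0 v1 = case_sum v0 v1 \<circ> sum_decode"

definition left :: "vector \<Rightarrow> vector" where
  "left v = v \<circ> sum_encode \<circ> Inl"

definition right :: "vector \<Rightarrow> vector" where
  "right v = v \<circ> sum_encode \<circ> Inr"

record datum =
  idx :: "index set"
  src :: space
  tgt :: "index \<Rightarrow> space"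
  dmap :: "index \<Rightarrow> vector \<Rightarrow> vector"

definition fd_space :: "nat \<Rightarrow> space \<Rightarrow> bool" where
  "fd_space p V \<longleftrightarrow> vectorspace (Fp p) V \<and> vectorspace.fin_dim (Fp p) V"

definition linear_datum :: "nat \<Rightarrow> datum \<Rightarrow> bool" where
  "linear_datum p \<Phi> \<longleftrightarrow>
     finite (idx \<Phi>) \<and> fd_space p (src \<Phi>) \<and>
     (\<forall>i\<in>idx \<Phi>. fd_space p (tgt \<Phi> i) \<and> linear_map (Fp p) (src \<Phi>) (tgt \<Phi> i) (dmap \<Phi> i))"

definition form_system :: "nat \<Rightarrow> nat \<Rightarrow> nat \<Rightarrow> (nat \<Rightarrow> vector \<Rightarrow> int) \<Rightarrow> datum" where
  "form_system p d k \<phi> =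
     \<lparr> idx = Num ` {1..k},
       src = coord_space p d,
       tgt = (\<lambda>_. coord_space p 1),
       dmap = (\<lambda>i v. case i of Num j \<Rightarrow> scalar (\<phi> j v) | _ \<Rightarrow> undefined) \<rparr>"

definition gc :: "nat \<Rightarrow> nat \<Rightarrow> datum" where
  "gc p s =
     \<lparr> idx = insert Triangle (Num ` {1..s+1}),
       src = coord_space p (s+1),
       tgt = (\<lambda>i. case i of Triangle \<Rightarrow> coord_space p 1 | _ \<Rightarrow> coord_space p s),
       dmap = (\<lambda>i v. case i of
           Triangle \<Rightarrow> scalar ((\<Sum>l=1..s+1. v l) mod int p)
         | Num r \<Rightarrow> (\<lambda>l\<in>{1..s}. if l < r then v l else v (l+1))
         | _ \<Rightarrow> undefined) \<rparr>"


text \<open>The \<open>t\<close>-th tensor power of the dual of the coordinate space is realised as the space of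
  \<open>t\<close>-linear forms, inside the space of all functions on \<open>t\<close>-tuples of vectors; the tensor power of
  a form \<open>f\<close> is then the product of the values of \<open>f\<close>.\<close>

definition tuples :: "nat \<Rightarrow> nat \<Rightarrow> nat \<Rightarrow> vector list set" where
  "tuples p d t = {xs. length xs = t \<and> set xs \<subseteq> carrier (coord_space p d)}"

definition tensor_power :: "nat \<Rightarrow> nat \<Rightarrow> nat \<Rightarrow> (vector \<Rightarrow> int) \<Rightarrow> vector list \<Rightarrow> int" where
  "tensor_power p d t f = (\<lambda>xs\<in>tuples p d t. prod_list (map f xs) mod int p)"

definition tensor_dependent ::
  "nat \<Rightarrow> nat \<Rightarrow> nat \<Rightarrow> (nat \<Rightarrow> vector \<Rightarrow> int) \<Rightarrow> nat \<Rightarrow> nat \<Rightarrow> bool" where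
  "tensor_dependent p d k \<phi> i t \<longleftrightarrow>
     tensor_power p d t (\<phi> i) \<in>
       LinearCombinations.module.span (Fp p)
         (LinearCombinations.ring.func_space (Fp p) (tuples p d t))
         ((\<lambda>j. tensor_power p d t (\<phi> j)) ` ({1..k} - {i}))"

definition complexity_at ::
  "nat \<Rightarrow> nat \<Rightarrow> nat \<Rightarrow> (nat \<Rightarrow> vector \<Rightarrow> int) \<Rightarrow> nat \<Rightarrow> enat" where
  "complexity_at p d k \<phi> i =
     (if \<exists>t. tensor_dependent p d k \<phi> i t \<and> (\<forall>u. tensor_dependent p d k \<phi> i u \<longrightarrow> u \<le> t)
      then enat (GREATEST t. tensor_dependent p d k \<phi> i t)
      else \<infinity>)"

definition complexity :: "nat \<Rightarrow> nat \<Rightarrow> nat \<Rightarrow> (nat \<Rightarrow> vector \<Rightarrow> int) \<Rightarrow> enat" where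
  "complexity p d k \<phi> = Max (complexity_at p d k \<phi> ` {1..k})"


text \<open>\<open>None\<close> plays the role of the extra index whose space is zero.\<close>

fun tgt_opt :: "nat \<Rightarrow> datum \<Rightarrow> index option \<Rightarrow> space" where
  "tgt_opt p \<Psi> None = coord_space p 0"
| "tgt_opt p \<Psi> (Some l) = tgt \<Psi> l"

fun dmap_opt :: "nat \<Rightarrow> datum \<Rightarrow> index option \<Rightarrow> vector \<Rightarrow> vector" where
  "dmap_opt p \<Psi> None = (\<lambda>_. \<zero>\<^bsub>coord_space p 0\<^esub>)"
| "dmap_opt p \<Psi> (Some l) = dmap \<Psi> l"

definition morphism ::
  "nat \<Rightarrow> datum \<Rightarrow> datum \<Rightarrow> (index \<Rightarrow> index option) \<Rightarrow> (vector \<Rightarrow> vector) \<Rightarrow>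
    (index \<Rightarrow> vector \<Rightarrow> vector) \<Rightarrow> bool" where
  "morphism p \<Psi> \<Phi> \<alpha> \<theta> \<sigma> \<longleftrightarrow>
     \<alpha> ` idx \<Phi> \<subseteq> insert None (Some ` idx \<Psi>) \<and>
     linear_map (Fp p) (src \<Psi>) (src \<Phi>) \<theta> \<and>
     (\<forall>j\<in>idx \<Phi>.
        linear_map (Fp p) (tgt_opt p \<Psi> (\<alpha> j)) (tgt \<Phi> j) (\<sigma> j) \<and>
        (\<forall>v\<in>carrier (src \<Psi>). \<sigma> j (dmap_opt p \<Psi> (\<alpha> j) v) = dmap \<Phi> j (\<theta> v)))"

definition respects_index ::
  "datum \<Rightarrow> datum \<Rightarrow> (index \<Rightarrow> index option) \<Rightarrow> (index \<Rightarrow> vector \<Rightarrow> vector) \<Rightarrow> index \<Rightarrow> bool" where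
  "respects_index \<Psi> \<Phi> \<alpha> \<sigma> j \<longleftrightarrow>
     j \<in> idx \<Phi> \<and>
     (\<exists>l. \<alpha> j = Some l \<and> (\<forall>j'\<in>idx \<Phi>. j' \<noteq> j \<longrightarrow> \<alpha> j' \<noteq> Some l) \<and>
          tgt \<Phi> j = tgt \<Psi> l \<and> (\<forall>w\<in>carrier (tgt \<Psi> l). \<sigma> j w = w))"

definition joined_space :: "datum \<Rightarrow> index set \<Rightarrow> space" where
  "joined_space \<Phi> S =
     \<lparr> carrier = {pair v0 v1 | v0 v1.
         v0 \<in> carrier (src \<Phi>) \<and> v1 \<in> carrier (src \<Phi>) \<and> (\<forall>i\<in>S. dmap \<Phi> i v0 = dmap \<Phi> i v1)},
       monoid.mult = undefined,
       one = undefined,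
       zero = pair \<zero>\<^bsub>src \<Phi>\<^esub> \<zero>\<^bsub>src \<Phi>\<^esub>,
       add = (\<lambda>v w. pair (left v \<oplus>\<^bsub>src \<Phi>\<^esub> left w) (right v \<oplus>\<^bsub>src \<Phi>\<^esub> right w)),
       smult = (\<lambda>c v. pair (c \<odot>\<^bsub>src \<Phi>\<^esub> left v) (c \<odot>\<^bsub>src \<Phi>\<^esub> right v)) \<rparr>"

definition self_join :: "datum \<Rightarrow> index set \<Rightarrow> datum" where
  "self_join \<Phi> S =
     \<lparr> idx = Left ` (idx \<Phi> - S) \<union> Right ` (idx \<Phi> - S),
       src = joined_space \<Phi> S,
       tgt = (\<lambda>i. case i of Left j \<Rightarrow> tgt \<Phi> j | Right j \<Rightarrow> tgt \<Phi> j | _ \<Rightarrow> undefined),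
       dmap = (\<lambda>i v. case i of
           Left j \<Rightarrow> dmap \<Phi> j (left v)
         | Right j \<Rightarrow> dmap \<Phi> j (right v)
         | _ \<Rightarrow> undefined) \<rparr>"

type_synonym index_map = "index \<rightharpoonup> index \<times> bit"

definition join_map :: "datum \<Rightarrow> index set \<Rightarrow> index_map" where
  "join_map \<Phi> S = (\<lambda>i. case i of
       Left j \<Rightarrow> if j \<in> idx \<Phi> - S then Some (j, 0) else None
     | Right j \<Rightarrow> if j \<in> idx \<Phi> - S then Some (j, 1) else None
     | _ \<Rightarrow> None)"

text \<open>Addition of the second components takes place in the type \<open>bit\<close>, that is, modulo \<open>2\<close>.\<close>

definition comp_map :: "index_map \<Rightarrow> index_map \<Rightarrow> index_map" where
  "comp_map \<gamma>1 \<gamma>2 = (\<lambda>j. case \<gamma>2 j of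
       None \<Rightarrow> None
     | Some (l, a2) \<Rightarrow> (case \<gamma>1 l of None \<Rightarrow> None | Some (i, a1) \<Rightarrow> Some (i, a1 + a2)))"

text \<open>\<open>derives p \<Phi> n \<gamma> \<Psi>\<close> is the relation \<open>\<Phi> \<turnstile> \<Psi>\<close> with superscript \<open>n\<close>, which counts
  self-joinings, and subscript \<open>\<gamma>\<close>.\<close>

inductive derives :: "nat \<Rightarrow> datum \<Rightarrow> nat \<Rightarrow> index_map \<Rightarrow> datum \<Rightarrow> bool" for p where
  morphism:
    "linear_datum p \<Phi> \<Longrightarrow> linear_datum p \<Psi> \<Longrightarrow> morphism p \<Psi> \<Phi> \<alpha> \<theta> \<sigma> \<Longrightarrow>
     (\<And>l i a. \<gamma> l = Some (i, a) \<longleftrightarrow> respects_index \<Psi> \<Phi> \<alpha> \<sigma> i \<and> \<alpha> i = Some l \<and> a = 0) \<Longrightarrow>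
     derives p \<Phi> 0 \<gamma> \<Psi>"
| self_join:
    "linear_datum p \<Phi> \<Longrightarrow> S \<subseteq> idx \<Phi> \<Longrightarrow> derives p \<Phi> 1 (join_map \<Phi> S) (self_join \<Phi> S)"
| compose:
    "derives p \<Phi> n1 \<gamma>1 \<Xi> \<Longrightarrow> derives p \<Xi> n2 \<gamma>2 \<Psi> \<Longrightarrow>
     derives p \<Phi> (n1 + n2) (comp_map \<gamma>1 \<gamma>2) \<Psi>"
| weaken:
    "derives p \<Phi> n' \<gamma>' \<Psi> \<Longrightarrow> n' \<le> n \<Longrightarrow> \<gamma> \<subseteq>\<^sub>m \<gamma>' \<Longrightarrow> derives p \<Phi> n \<gamma> \<Psi>"

end

theory Submission
  imports Defs
begin

text \<open>
  Before the final morphism all data have one-dimensional targets, so they are treated as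
  \<^emph>\<open>systems\<close>: positions together with the set of integer labellings which, modulo \<open>p\<close>, are the
  values of some vector. If \<open>s + 1\<close> labellings are non-zero at a position \<open>x\<close> and every other
  position is annihilated modulo \<open>p\<close> by one of them, they define a morphism from \<open>gc\<^sub>s\<close> respecting
  \<open>x\<close>. It remains to reach such a system by self-joinings.

  Self-joining along everything except one form attaches a copy of the whole system to that form.
  Attachments have a level \<open>T\<close>: any \<open>T\<close> values at the form extend to \<open>T\<close> labellings which
  annihilate every position of the attachment in some slot. With \<open>k\<close> slots, one slot can be
  spent on each other form, which gives level \<open>k\<close>. To pass from level \<open>T + 1\<close> to level \<open>T\<close> at the form \<open>j\<close>, use
  that the \<open>T\<close>-th tensor power of \<open>\<phi>\<^sub>j\<close> is not in the span of the others: some sum of at most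
  \<open>2\<^sup>k + 1\<close> products of \<open>T\<close> values vanishes at all other forms, and only its first term is
  non-zero at \<open>j\<close>. Cubes attached to the other forms work as reversible registers: along a chain of
  copies of the system they multiply the values of the slots by binary multiplication and add the
  products to a counter, which is zero modulo \<open>p\<close> at the end of the chain. A chain of \<open>2\<^sup>n\<close> copies
  costs \<open>n\<close> self-joinings, and \<open>n\<close> is of order \<open>k + log log L\<close>. There are at most \<open>k\<close> levels and
  \<open>k\<close> forms. The level stops at \<open>s + 2\<close> for the forms other than \<open>i\<close>, after which one more chain
  at \<open>i\<close> gives \<open>s + 1\<close> slots.
\<close>

subsection \<open>Systems and their derivations\<close>

text \<open>Independence of tensor powers yields a vanishing sum of products, whereas a controlled
  position requires, at every other position, one slot that vanishes. A single term of the sum need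
  not provide this. Hence every term gets a copy of the system of its own, only the first copy
  contains the distinguished position, and the copies communicate their products through registers.
  A chain is paid for by the logarithm of its length, so running times may be exponential in
  \<open>k\<close> and linear in \<open>log L\<close>, but not linear in \<open>L\<close>; therefore
  products are formed bit by bit. The coefficients of the relation depend on \<open>p\<close> and
  have no bound in terms of \<open>L\<close>; they are placed in slot 0, the only slot that is never
  a multiplier. Lowering the level to \<open>T\<close> at \<open>j\<close> needs an attachment at
  \<open>i\<close> too, and what can be produced there has level \<open>T + 1\<close>. Gadgets are
  built accordingly: they run with \<open>T\<close> slots, arise from a cube of dimension
  \<open>T + 1\<close>, and still have level \<open>T + 1\<close> as attachments. The levels stop
  where independence stops: it holds from \<open>s + 1\<close> slots on at \<open>i\<close>, but in
  general only from \<open>s + 2\<close> on at the other forms.\<close>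

record system =
  positions :: "index set"
  labels :: "(index \<Rightarrow> int) set"

text \<open>Agreement on \<open>S\<close> is equality of integers rather than congruence. Linear
  systems are closed under congruence, so nothing is lost, but values have to be made equal before a
  joining can be used.\<close>

definition double :: "system \<Rightarrow> index set \<Rightarrow> system" where
  "double X S = \<lparr> positions = Left ` (positions X - S) \<union> Right ` (positions X - S),
     labels = {l. \<exists>a\<in>labels X. \<exists>b\<in>labels X. (\<forall>x\<in>S. a x = b x) \<and>
       (\<forall>x\<in>positions X - S. l (Left x) = a x \<and> l (Right x) = b x)} \<rparr>"

text \<open>The counterpart of a morphism from \<open>Y\<close> to \<open>X\<close> of shape \<open>f\<close> which respects \<open>x\<close>: the map \<open>\<sigma>\<^sub>z\<close> is
  multiplication by \<open>c z\<close>, and \<open>c z = 0\<close> stands for \<open>z\<close> being sent to the extra index.\<close>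

definition specializes :: "system \<Rightarrow> index \<Rightarrow> system \<Rightarrow> index \<Rightarrow> bool" where
  "specializes X x Y y \<longleftrightarrow> x \<in> positions X \<and> y \<in> positions Y \<and>
     (\<exists>f c. f x = y \<and> c x = (1::int) \<and>
       (\<forall>z\<in>positions X - {x}. c z = 0 \<or> f z \<in> positions Y - {y}) \<and>
       (\<forall>b\<in>labels Y. (\<lambda>z. c z * b (f z)) \<in> labels X))"

text \<open>Specialization occurs only at the end, which is no restriction because specializations
  can be moved past joinings. The distinguished position always continues in the left copy.\<close>

inductive deriv :: "system \<Rightarrow> index \<Rightarrow> nat \<Rightarrow> system \<Rightarrow> index \<Rightarrow> bool" where
  specialize: "specializes X x Y y \<Longrightarrow> deriv X x 0 Y y"
| double: "S \<subseteq> positions X \<Longrightarrow> x \<in> positions X - S \<Longrightarrow>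
    deriv (double X S) (Left x) n Y y \<Longrightarrow> deriv X x (Suc n) Y y"

lemma positions_double [simp]:
  "positions (double X S) = Left ` (positions X - S) \<union> Right ` (positions X - S)"
  by (simp add: double_def)

lemma labels_doubleI:
  assumes "a \<in> labels X" "b \<in> labels X" "\<And>x. x \<in> S \<Longrightarrow> a x = b x"
    and "\<And>x. x \<in> positions X - S \<Longrightarrow> l (Left x) = a x"
    and "\<And>x. x \<in> positions X - S \<Longrightarrow> l (Right x) = b x"
  shows "l \<in> labels (double X S)"
  using assms by (auto simp: double_def)

lemma labels_doubleE:
  assumes "l \<in> labels (double X S)"
  obtains a b where "a \<in> labels X" "b \<in> labels X" "\<And>x. x \<in> S \<Longrightarrow> a x = b x"
    "\<And>x. x \<in> positions X - S \<Longrightarrow> l (Left x) = a x"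
    "\<And>x. x \<in> positions X - S \<Longrightarrow> l (Right x) = b x"
  using assms unfolding double_def by auto

lemma specializesI:
  assumes "x \<in> positions X" "y \<in> positions Y" "f x = y" "c x = 1"
    and "\<And>z. z \<in> positions X \<Longrightarrow> z \<noteq> x \<Longrightarrow> c z = 0 \<or> f z \<in> positions Y \<and> f z \<noteq> y"
    and "\<And>b. b \<in> labels Y \<Longrightarrow> (\<lambda>z. c z * b (f z)) \<in> labels X"
  shows "specializes X x Y y"
  unfolding specializes_def using assms by blast

lemma specializes_refl:
  assumes "x \<in> positions X" shows "specializes X x X x"
  by (rule specializesI[where f = id and c = "\<lambda>_. 1"]) (use assms in auto)

lemma specializes_trans:
  assumes "specializes X x Y y" "specializes Y y Z z"
  shows "specializes X x Z z"
proof -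
  obtain f c where f: "x \<in> positions X" "f x = y" "c x = 1"
    "\<And>u. u \<in> positions X - {x} \<Longrightarrow> c u = 0 \<or> f u \<in> positions Y - {y}"
    "\<And>b. b \<in> labels Y \<Longrightarrow> (\<lambda>u. c u * b (f u)) \<in> labels X"
    using assms(1) unfolding specializes_def by blast
  obtain g d where g: "z \<in> positions Z" "g y = z" "d y = 1"
    "\<And>u. u \<in> positions Y - {y} \<Longrightarrow> d u = 0 \<or> g u \<in> positions Z - {z}"
    "\<And>b. b \<in> labels Z \<Longrightarrow> (\<lambda>u. d u * b (g u)) \<in> labels Y"
    using assms(2) unfolding specializes_def by blast
  show ?thesis
  proof (rule specializesI[where f = "g \<circ> f" and c = "\<lambda>u. c u * d (f u)"])
    fix u assume "u \<in> positions X" "u \<noteq> x"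
    then show "c u * d (f u) = 0 \<or> (g \<circ> f) u \<in> positions Z \<and> (g \<circ> f) u \<noteq> z"
      using f(4)[of u] g(4)[of "f u"] by auto
  next
    fix b assume "b \<in> labels Z"
    then show "(\<lambda>u. c u * d (f u) * b ((g \<circ> f) u)) \<in> labels X"
      using f(5)[OF g(5)] by (simp add: mult.assoc)
  qed (use f g in auto)
qed

text \<open>Joining \<open>Y\<close> along \<open>S\<close> is imitated in \<open>X\<close> by
  joining along the preimage of \<open>S\<close>. This moves a specialization behind a joining and
  is what makes \<open>deriv\<close> transitive.\<close>

lemma specializes_double:
  assumes "specializes X x Y y" "S \<subseteq> positions Y" "y \<notin> S"
  obtains S' where "S' \<subseteq> positions X" "x \<in> positions X - S'"
    "specializes (double X S') (Left x) (double Y S) (Left y)"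
proof -
  obtain f c where f: "x \<in> positions X" "y \<in> positions Y" "f x = y" "c x = 1"
    "\<And>u. u \<in> positions X - {x} \<Longrightarrow> c u = 0 \<or> f u \<in> positions Y - {y}"
    "\<And>b. b \<in> labels Y \<Longrightarrow> (\<lambda>u. c u * b (f u)) \<in> labels X"
    using assms(1) unfolding specializes_def by blast
  \<comment> \<open>Positions with coefficient 0 stay out of \<open>S'\<close>: both of their copies
    are kept and again get coefficient 0.\<close>
  define S' where "S' = {u \<in> positions X. c u \<noteq> 0 \<and> f u \<in> S}"
  define f' where "f' u = (case u of Left v \<Rightarrow> Left (f v) | Right v \<Rightarrow> Right (f v) | _ \<Rightarrow> u)" for u
  define c' where "c' u = (case u of Left v \<Rightarrow> c v | Right v \<Rightarrow> c v | _ \<Rightarrow> 0)" for u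
  have x: "x \<in> positions X - S'" using f assms by (auto simp: S'_def)
  have *: "c v = 0 \<or> f v \<in> positions Y - S" if "v \<in> positions X - S'" for v
    using that f(1-5) assms(3) by (cases "v = x") (auto simp: S'_def)
  have "specializes (double X S') (Left x) (double Y S) (Left y)"
  proof (rule specializesI[where f = f' and c = c'])
    fix z assume z: "z \<in> positions (double X S')" "z \<noteq> Left x"
    then consider v where "z = Left v" "v \<in> positions X - S'" "v \<noteq> x"
      | v where "z = Right v" "v \<in> positions X - S'" by auto
    then show "c' z = 0 \<or> f' z \<in> positions (double Y S) \<and> f' z \<noteq> Left y"
    proof cases
      case 1 then show ?thesis using *[of v] f(5)[of v] by (auto simp: c'_def f'_def)
    next
      case 2 then show ?thesis using *[of v] by (auto simp: c'_def f'_def)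
    qed
  next
    fix b assume "b \<in> labels (double Y S)"
    then obtain b0 b1 where b: "b0 \<in> labels Y" "b1 \<in> labels Y" "\<And>x. x \<in> S \<Longrightarrow> b0 x = b1 x"
      "\<And>x. x \<in> positions Y - S \<Longrightarrow> b (Left x) = b0 x"
      "\<And>x. x \<in> positions Y - S \<Longrightarrow> b (Right x) = b1 x" by (rule labels_doubleE) blast
    show "(\<lambda>z. c' z * b (f' z)) \<in> labels (double X S')"
    proof (rule labels_doubleI[OF f(6)[OF b(1)] f(6)[OF b(2)]])
      fix v assume "v \<in> S'" then show "c v * b0 (f v) = c v * b1 (f v)"
        using b(3)[of "f v"] by (simp add: S'_def)
    next
      fix v assume "v \<in> positions X - S'"
      then show "c' (Left v) * b (f' (Left v)) = c v * b0 (f v)"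
        and "c' (Right v) * b (f' (Right v)) = c v * b1 (f v)"
        using *[of v] b(4,5)[of "f v"] by (auto simp: c'_def f'_def)
    qed
  qed (use f x assms in \<open>auto simp: f'_def c'_def\<close>)
  then show ?thesis using that[of S'] x by (auto simp: S'_def)
qed

lemma deriv_specialize_left:
  assumes "deriv Y y n Z z" "specializes X x Y y"
  shows "deriv X x n Z z"
  using assms
proof (induction arbitrary: X x rule: deriv.induct)
  case (specialize Y y Z z)
  then show ?case using specializes_trans deriv.specialize by blast
next
  case (double S Y y n Z z)
  obtain S' where S': "S' \<subseteq> positions X" "x \<in> positions X - S'"
    "specializes (double X S') (Left x) (double Y S) (Left y)"
    using specializes_double[OF double.prems double.hyps(1)] double.hyps(2) by blast
  show ?case by (rule deriv.double[OF S'(1,2) double.IH[OF S'(3)]])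
qed

lemma deriv_trans:
  assumes "deriv X x m Y y" "deriv Y y n Z z"
  shows "deriv X x (m + n) Z z"
  using assms
proof (induction rule: deriv.induct)
  case (specialize X x Y y)
  then show ?case using deriv_specialize_left by simp
next
  case (double S X x m Y y)
  then show ?case using deriv.double by (metis add_Suc)
qed

lemma deriv_refl: "x \<in> positions X \<Longrightarrow> deriv X x 0 X x"
  by (intro deriv.specialize specializes_refl)

lemma deriv_double:
  assumes "S \<subseteq> positions X" "x \<in> positions X - S"
  shows "deriv X x 1 (double X S) (Left x)"
  using deriv.double[OF assms deriv_refl] assms by auto

text \<open>The pairs in \<open>A\<close> prescribe the values of \<open>T\<close> labellings at some positions; at every other position one
  of the labellings has to vanish modulo \<open>p\<close>.\<close>

definition supports :: "int \<Rightarrow> nat \<Rightarrow> system \<Rightarrow> (index \<times> (nat \<Rightarrow> int)) set \<Rightarrow> bool" where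
  "supports p T X A \<longleftrightarrow> (\<exists>l. (\<forall>r<T. l r \<in> labels X) \<and> (\<forall>(z, c)\<in>A. \<forall>r<T. l r z = c r) \<and>
     (\<forall>z\<in>positions X - fst ` A. \<exists>r<T. p dvd l r z))"

text \<open>The two families are glued slot by slot. A joined position must be prescribed the same
  tuple in both, since unprescribed values merely vanish somewhere and need not agree.\<close>

lemma supports_double:
  assumes "supports p T X A" "supports p T X B"
    and S: "\<And>z. z \<in> S \<Longrightarrow> \<exists>c. (z, c) \<in> A \<and> (z, c) \<in> B"
  shows "supports p T (double X S)
    ((\<lambda>(z, c). (Left z, c)) ` {u \<in> A. fst u \<notin> S} \<union> (\<lambda>(z, c). (Right z, c)) ` {u \<in> B. fst u \<notin> S})"
proof -
  obtain l where l: "\<And>r. r < T \<Longrightarrow> l r \<in> labels X"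
    "\<And>z c r. (z, c) \<in> A \<Longrightarrow> r < T \<Longrightarrow> l r z = c r"
    "\<And>z. z \<in> positions X - fst ` A \<Longrightarrow> \<exists>r<T. p dvd l r z"
    using assms(1) unfolding supports_def by fast
  obtain m where m: "\<And>r. r < T \<Longrightarrow> m r \<in> labels X"
    "\<And>z c r. (z, c) \<in> B \<Longrightarrow> r < T \<Longrightarrow> m r z = c r"
    "\<And>z. z \<in> positions X - fst ` B \<Longrightarrow> \<exists>r<T. p dvd m r z"
    using assms(2) unfolding supports_def by fast
  define n where "n r z = (case z of Left x \<Rightarrow> l r x | Right x \<Rightarrow> m r x | _ \<Rightarrow> 0)" for r z
  have "n r \<in> labels (double X S)" if "r < T" for r
  proof (rule labels_doubleI[OF l(1)[OF that] m(1)[OF that]])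
    fix x assume "x \<in> S"
    then show "l r x = m r x" using S[of x] l(2) m(2) that by metis
  qed (auto simp: n_def)
  moreover have "\<exists>r<T. p dvd n r z" if "z \<in> positions (double X S) -
    fst ` ((\<lambda>(z, c). (Left z, c)) ` {u \<in> A. fst u \<notin> S} \<union> (\<lambda>(z, c). (Right z, c)) ` {u \<in> B. fst u \<notin> S})" for z
  proof -
    note zz = that
    obtain x where x: "x \<in> positions X - S" "z = Left x \<or> z = Right x" using zz by auto
    from x(2) show ?thesis
    proof
      assume z: "z = Left x"
      have "x \<notin> fst ` A"
      proof
        assume "x \<in> fst ` A"
        then obtain c where "(x, c) \<in> A" by force
        then have "(Left x, c) \<in> (\<lambda>(z, c). (Left z, c)) ` {u \<in> A. fst u \<notin> S}" using x(1) by force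
        then show False using zz z by force
      qed
      then show ?thesis using l(3) x(1) z by (auto simp: n_def)
    next
      assume z: "z = Right x"
      have "x \<notin> fst ` B"
      proof
        assume "x \<in> fst ` B"
        then obtain c where "(x, c) \<in> B" by force
        then have "(Right x, c) \<in> (\<lambda>(z, c). (Right z, c)) ` {u \<in> B. fst u \<notin> S}" using x(1) by force
        then show False using zz z by force
      qed
      then show ?thesis using m(3) x(1) z by (auto simp: n_def)
    qed
  qed
  ultimately show ?thesis unfolding supports_def
    by (intro exI[of _ n]) (use l(2) m(2) in \<open>auto simp: n_def\<close>)
qed

text \<open>A prescription may be forgotten once its tuple vanishes in some slot, because the
  position then meets the condition on unprescribed ones.\<close>

lemma supports_mono:
  assumes "supports p T X A" "B \<subseteq> A"
    and "\<And>z c. (z, c) \<in> A \<Longrightarrow> (z, c) \<notin> B \<Longrightarrow> z \<notin> fst ` B \<Longrightarrow> \<exists>r<T. p dvd c r"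
  shows "supports p T X B"
proof -
  obtain l where l: "\<And>r. r < T \<Longrightarrow> l r \<in> labels X"
    "\<And>z c r. (z, c) \<in> A \<Longrightarrow> r < T \<Longrightarrow> l r z = c r"
    "\<And>z. z \<in> positions X - fst ` A \<Longrightarrow> \<exists>r<T. p dvd l r z"
    using assms(1) unfolding supports_def by fast
  have "\<exists>r<T. p dvd l r z" if z: "z \<in> positions X - fst ` B" for z
  proof (cases "z \<in> fst ` A")
    case True
    then obtain c where c: "(z, c) \<in> A" by force
    then have "(z, c) \<notin> B" using z by force
    then show ?thesis using assms(3)[OF c] z l(2)[OF c] by auto
  qed (use l(3) z in auto)
  then show ?thesis unfolding supports_def using l(1,2) assms(2) by (intro exI[of _ l]) blast
qed

text \<open>The property that finally yields a morphism from \<open>gc\<close>: each slot gives one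
  coordinate of the source, hence \<open>s + 1\<close> slots are wanted.\<close>

definition controlled :: "int \<Rightarrow> nat \<Rightarrow> system \<Rightarrow> index \<Rightarrow> bool" where
  "controlled p T X x \<longleftrightarrow> x \<in> positions X \<and>
     (\<exists>c. supports p T X {(x, c)} \<and> (\<forall>r<T. \<not> p dvd c r))"

lemma controlled_specializes:
  assumes "specializes X x Y y" "controlled p T Y y" "T > 0"
  shows "controlled p T X x"
proof -
  obtain f c where f: "x \<in> positions X" "y \<in> positions Y" "f x = y" "c x = 1"
    "\<And>u. u \<in> positions X - {x} \<Longrightarrow> c u = 0 \<or> f u \<in> positions Y - {y}"
    "\<And>b. b \<in> labels Y \<Longrightarrow> (\<lambda>u. c u * b (f u)) \<in> labels X"
    using assms(1) unfolding specializes_def by blast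
  obtain l d where l: "\<And>r. r < T \<Longrightarrow> l r \<in> labels Y" "\<And>r. r < T \<Longrightarrow> l r y = d r"
    "\<forall>z\<in>positions Y - {y}. \<exists>r<T. p dvd l r z" "\<forall>r<T. \<not> p dvd d r"
    using assms(2) unfolding controlled_def supports_def by auto
  have "supports p T X {(x, d)}" unfolding supports_def
  proof (intro exI[of _ "\<lambda>r u. c u * l r (f u)"] conjI ballI allI impI)
    fix z assume "z \<in> positions X - fst ` {(x, d)}"
    then have "c z = 0 \<or> f z \<in> positions Y - {y}" using f(5) by auto
    then show "\<exists>r<T. p dvd c z * l r (f z)" using l(3) assms(3) by (metis dvd_mult dvd_0_right mult_zero_left)
  qed (use f l in auto)
  then show ?thesis using f(1) l(4) unfolding controlled_def by auto
qed

subsection \<open>Attaching systems to forms\<close>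

text \<open>The preimage of a subspace under reducing the values on \<open>I\<close> modulo
  \<open>p\<close>; values outside \<open>I\<close> are unconstrained.\<close>

definition mod_subspace :: "int \<Rightarrow> 'a set \<Rightarrow> ('a \<Rightarrow> int) set \<Rightarrow> bool" where
  "mod_subspace p I L \<longleftrightarrow> L \<noteq> {} \<and> (\<forall>a\<in>L. \<forall>b\<in>L. (\<lambda>z. a z + b z) \<in> L) \<and>
     (\<forall>a\<in>L. \<forall>c. (\<lambda>z. c * a z) \<in> L) \<and>
     (\<forall>a\<in>L. \<forall>b. (\<forall>z\<in>I. [a z = b z] (mod p)) \<longrightarrow> b \<in> L)"

lemma mod_subspace_add: "mod_subspace p I L \<Longrightarrow> a \<in> L \<Longrightarrow> b \<in> L \<Longrightarrow> (\<lambda>z. a z + b z) \<in> L"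
  and mod_subspace_scale: "mod_subspace p I L \<Longrightarrow> a \<in> L \<Longrightarrow> (\<lambda>z. c * a z) \<in> L"
  and mod_subspace_cong: "mod_subspace p I L \<Longrightarrow> a \<in> L \<Longrightarrow> (\<And>z. z \<in> I \<Longrightarrow> [a z = b z] (mod p)) \<Longrightarrow> b \<in> L"
  by (auto simp: mod_subspace_def)

abbreviation linear_system :: "int \<Rightarrow> system \<Rightarrow> bool" where
  "linear_system p X \<equiv> mod_subspace p (positions X) (labels X)"

lemma linear_system_double:
  assumes X: "linear_system p X"
  shows "linear_system p (double X S)"
  unfolding mod_subspace_def
proof (intro conjI ballI allI impI)
  obtain a where "a \<in> labels X" using X by (auto simp: mod_subspace_def)
  then have "(\<lambda>z. case z of Left x \<Rightarrow> a x | Right x \<Rightarrow> a x | _ \<Rightarrow> 0) \<in> labels (double X S)"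
    by (intro labels_doubleI[of a _ a]) auto
  then show "labels (double X S) \<noteq> {}" by blast
next
  fix l m assume l: "l \<in> labels (double X S)" and m: "m \<in> labels (double X S)"
  obtain a b where ab: "a \<in> labels X" "b \<in> labels X" "\<And>x. x \<in> S \<Longrightarrow> a x = b x"
    "\<And>x. x \<in> positions X - S \<Longrightarrow> l (Left x) = a x"
    "\<And>x. x \<in> positions X - S \<Longrightarrow> l (Right x) = b x" using l by (rule labels_doubleE) blast
  obtain a' b' where ab': "a' \<in> labels X" "b' \<in> labels X" "\<And>x. x \<in> S \<Longrightarrow> a' x = b' x"
    "\<And>x. x \<in> positions X - S \<Longrightarrow> m (Left x) = a' x"
    "\<And>x. x \<in> positions X - S \<Longrightarrow> m (Right x) = b' x" using m by (rule labels_doubleE) blast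
  show "(\<lambda>z. l z + m z) \<in> labels (double X S)"
    by (intro labels_doubleI[of "\<lambda>z. a z + a' z" _ "\<lambda>z. b z + b' z"] mod_subspace_add[OF X])
      (simp_all add: ab ab')
next
  fix l c assume "l \<in> labels (double X S)"
  then obtain a b where "a \<in> labels X" "b \<in> labels X" "\<And>x. x \<in> S \<Longrightarrow> a x = b x"
    "\<And>x. x \<in> positions X - S \<Longrightarrow> l (Left x) = a x"
    "\<And>x. x \<in> positions X - S \<Longrightarrow> l (Right x) = b x"
    by (rule labels_doubleE) blast
  then show "(\<lambda>z. c * l z) \<in> labels (double X S)"
    by (intro labels_doubleI[of "\<lambda>z. c * a z" _ "\<lambda>z. c * b z"] mod_subspace_scale[OF X]) simp_all
next
  fix l m assume l: "l \<in> labels (double X S)" and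
    lm: "\<forall>z\<in>positions (double X S). [l z = m z] (mod p)"
  obtain a b where ab: "a \<in> labels X" "b \<in> labels X" "\<And>x. x \<in> S \<Longrightarrow> a x = b x"
    "\<And>x. x \<in> positions X - S \<Longrightarrow> l (Left x) = a x"
    "\<And>x. x \<in> positions X - S \<Longrightarrow> l (Right x) = b x"
    using l by (rule labels_doubleE) blast
  have lm': "[a x = m (Left x)] (mod p)" "[b x = m (Right x)] (mod p)" if "x \<in> positions X" "x \<notin> S" for x
    using bspec[OF lm, of "Left x"] bspec[OF lm, of "Right x"] ab(4,5)[of x] that by auto
  \<comment> \<open>On \<open>S\<close> both halves take the values of \<open>a\<close>, so that
    they are equal there and not merely congruent.\<close>
  show "m \<in> labels (double X S)"
  proof (rule labels_doubleI[of "\<lambda>z. if z \<in> S then a z else m (Left z)" _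
      "\<lambda>z. if z \<in> S then a z else m (Right z)"])
    show "(\<lambda>z. if z \<in> S then a z else m (Left z)) \<in> labels X"
      by (rule mod_subspace_cong[OF X ab(1)]) (use lm' in auto)
    show "(\<lambda>z. if z \<in> S then a z else m (Right z)) \<in> labels X"
      by (rule mod_subspace_cong[OF X ab(2)]) (use lm' ab(3) in auto)
  qed auto
qed

text \<open>Encodes a disjoint union over all \<open>j\<close> by the two unary constructors:
  \<open>j\<close> times \<open>Right\<close> around one \<open>Left\<close>.\<close>

primrec tag :: "nat \<Rightarrow> index \<Rightarrow> index" where
  "tag 0 z = Left z"
| "tag (Suc j) z = Right (tag j z)"

fun untag :: "index \<Rightarrow> nat \<times> index" where
  "untag (Left z) = (0, z)"
| "untag (Right z) = (case untag z of (j, u) \<Rightarrow> (Suc j, u))"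
| "untag z = (0, z)"

lemma untag_tag [simp]: "untag (tag j z) = (j, z)"
  by (induction j) auto

lemma tag_eq_iff [simp]: "tag j z = tag j' z' \<longleftrightarrow> j = j' \<and> z = z'"
  by (metis untag_tag prod.inject)

type_synonym attachment = "system \<times> index"

text \<open>Scaling the labelling with value 1 at the port extends any integer at the port to the
  whole attachment.\<close>

definition attachable :: "int \<Rightarrow> attachment \<Rightarrow> bool" where
  "attachable p Y \<longleftrightarrow> linear_system p (fst Y) \<and> snd Y \<in> positions (fst Y) \<and>
     (\<exists>e\<in>labels (fst Y). e (snd Y) = 1)"

text \<open>An attachment is a system with a port. For each \<open>j \<in> K\<close> the system \<open>\<Sigma> j\<close> is glued along its port to the
  value at \<open>j\<close> of a labelling in \<open>B\<close>; the ports are not positions of the result.\<close>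

definition attach :: "nat set \<Rightarrow> (nat \<Rightarrow> int) set \<Rightarrow> (nat \<Rightarrow> attachment) \<Rightarrow> system" where
  "attach K B \<Sigma> =
     \<lparr> positions = {tag j z | j z. j \<in> K \<and> z \<in> positions (fst (\<Sigma> j)) - {snd (\<Sigma> j)}},
       labels = {l. \<exists>a\<in>B. \<exists>b. \<forall>j\<in>K. b j \<in> labels (fst (\<Sigma> j)) \<and> b j (snd (\<Sigma> j)) = a j \<and>
         (\<forall>z\<in>positions (fst (\<Sigma> j)) - {snd (\<Sigma> j)}. l (tag j z) = b j z)} \<rparr>"

text \<open>Two congruent values, one of them the port. As ports disappear, attaching it leaves the
  value at the form as an ordinary position \<open>Num 1\<close>; congruence instead of equality
  makes the labellings closed modulo \<open>p\<close>.\<close>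

definition raw :: "int \<Rightarrow> attachment" where
  "raw p = (\<lparr> positions = {Num 0, Num 1}, labels = {l. [l (Num 0) = l (Num 1)] (mod p)} \<rparr>, Num 0)"

lemma attachable_double:
  assumes "attachable p (Y, y)" "y \<notin> S"
  shows "attachable p (double Y S, Left y)"
proof -
  obtain e where e: "e \<in> labels Y" "e y = 1" using assms by (auto simp: attachable_def)
  then have "(\<lambda>z. case z of Left x \<Rightarrow> e x | Right x \<Rightarrow> e x | _ \<Rightarrow> 0) \<in> labels (double Y S)"
    by (intro labels_doubleI[of e _ e]) auto
  moreover have "linear_system p (double Y S)"
    using assms by (intro linear_system_double) (simp add: attachable_def)
  ultimately show ?thesis using assms e unfolding attachable_def
    by (intro conjI bexI[of _ "\<lambda>z. case z of Left x \<Rightarrow> e x | Right x \<Rightarrow> e x | _ \<Rightarrow> 0"]) simp_all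
qed

lemma attachable_raw: "attachable p (raw p)"
proof -
  have eqs: "positions (fst (raw p)) = {Num 0, Num 1}" "labels (fst (raw p)) = {l. [l (Num 0) = l (Num 1)] (mod p)}"
    by (simp_all add: raw_def)
  have "linear_system p (fst (raw p))" unfolding mod_subspace_def eqs
  proof (intro conjI ballI allI impI)
    have "(\<lambda>_. 1) \<in> {l. [l (Num 0) = l (Num 1)] (mod p)}" by simp
    then show "{l. [l (Num 0) = l (Num 1)] (mod p)} \<noteq> {}" by (metis empty_iff)
  next
    fix a b :: "index \<Rightarrow> int" assume a: "a \<in> {l. [l (Num 0) = l (Num 1)] (mod p)}"
      and ab: "\<forall>z\<in>{Num 0, Num 1}. [a z = b z] (mod p)"
    have "[a (Num 0) = b (Num 0)] (mod p)" "[a (Num 1) = b (Num 1)] (mod p)"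
      by (rule bspec[OF ab], blast)+
    moreover have "[a (Num 0) = a (Num 1)] (mod p)" using a by blast
    ultimately have "[b (Num 0) = b (Num 1)] (mod p)" by (meson cong_sym cong_trans)
    then show "b \<in> {l. [l (Num 0) = l (Num 1)] (mod p)}" by blast
  next
    fix a b :: "index \<Rightarrow> int"
    assume "a \<in> {l. [l (Num 0) = l (Num 1)] (mod p)}" "b \<in> {l. [l (Num 0) = l (Num 1)] (mod p)}"
    then show "(\<lambda>z. a z + b z) \<in> {l. [l (Num 0) = l (Num 1)] (mod p)}"
      using cong_add[of "a (Num 0)" "a (Num 1)" p "b (Num 0)" "b (Num 1)"] by simp
  next
    fix a :: "index \<Rightarrow> int" and c :: int
    assume "a \<in> {l. [l (Num 0) = l (Num 1)] (mod p)}"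
    then show "(\<lambda>z. c * a z) \<in> {l. [l (Num 0) = l (Num 1)] (mod p)}"
      using cong_scalar_left[of "a (Num 0)" "a (Num 1)" p c] by simp
  qed
  then show ?thesis unfolding attachable_def
    by (intro conjI bexI[of _ "\<lambda>_. 1"]) (simp_all add: raw_def)
qed

lemma tag_in_positions_attach [simp]:
  "tag j z \<in> positions (attach K B \<Sigma>) \<longleftrightarrow> j \<in> K \<and> z \<in> positions (fst (\<Sigma> j)) \<and> z \<noteq> snd (\<Sigma> j)"
  by (auto simp: attach_def)

lemma positions_attachE:
  assumes "u \<in> positions (attach K B \<Sigma>)"
  obtains j z where "u = tag j z" "j \<in> K" "z \<in> positions (fst (\<Sigma> j))" "z \<noteq> snd (\<Sigma> j)"
  using assms by (auto simp: attach_def)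

definition lift :: "nat set \<Rightarrow> (nat \<Rightarrow> attachment) \<Rightarrow> (nat \<Rightarrow> int) \<Rightarrow> (nat \<Rightarrow> index \<Rightarrow> int) \<Rightarrow> (index \<Rightarrow> int) \<Rightarrow> bool" where
  "lift K \<Sigma> a b l \<longleftrightarrow> (\<forall>j\<in>K. b j \<in> labels (fst (\<Sigma> j)) \<and> b j (snd (\<Sigma> j)) = a j \<and>
     (\<forall>z\<in>positions (fst (\<Sigma> j)) - {snd (\<Sigma> j)}. l (tag j z) = b j z))"

lemma labels_attach_iff: "l \<in> labels (attach K B \<Sigma>) \<longleftrightarrow> (\<exists>a\<in>B. \<exists>b. lift K \<Sigma> a b l)"
  by (simp add: attach_def lift_def)

lemma liftD:
  assumes "lift K \<Sigma> a b l"
  shows "\<And>j. j \<in> K \<Longrightarrow> b j \<in> labels (fst (\<Sigma> j))" "\<And>j. j \<in> K \<Longrightarrow> b j (snd (\<Sigma> j)) = a j"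
    "\<And>j z. j \<in> K \<Longrightarrow> z \<in> positions (fst (\<Sigma> j)) \<Longrightarrow> z \<noteq> snd (\<Sigma> j) \<Longrightarrow> l (tag j z) = b j z"
  using assms by (auto simp: lift_def)

lemma labels_attachI:
  assumes "a \<in> B" "\<And>j. j \<in> K \<Longrightarrow> b j \<in> labels (fst (\<Sigma> j))" "\<And>j. j \<in> K \<Longrightarrow> b j (snd (\<Sigma> j)) = a j"
    "\<And>j z. j \<in> K \<Longrightarrow> z \<in> positions (fst (\<Sigma> j)) \<Longrightarrow> z \<noteq> snd (\<Sigma> j) \<Longrightarrow> l (tag j z) = b j z"
  shows "l \<in> labels (attach K B \<Sigma>)"
  unfolding labels_attach_iff lift_def using assms by (intro bexI[of _ a] exI[of _ b]) auto

definition attachment_section :: "nat set \<Rightarrow> (nat \<Rightarrow> attachment) \<Rightarrow> (nat \<Rightarrow> index \<Rightarrow> int) \<Rightarrow> bool" where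
  "attachment_section K \<Sigma> e \<longleftrightarrow> (\<forall>j\<in>K. e j \<in> labels (fst (\<Sigma> j)) \<and> e j (snd (\<Sigma> j)) = 1)"

lemma ex_attachment_section:
  assumes "\<And>j. j \<in> K \<Longrightarrow> attachable p (\<Sigma> j)"
  shows "\<exists>e. attachment_section K \<Sigma> e"
  unfolding attachment_section_def by (rule bchoice) (use assms in \<open>auto simp: attachable_def\<close>)

lemma attachment_sectionD:
  assumes "attachment_section K \<Sigma> e"
  shows "\<And>j. j \<in> K \<Longrightarrow> e j \<in> labels (fst (\<Sigma> j))" "\<And>j. j \<in> K \<Longrightarrow> e j (snd (\<Sigma> j)) = 1"
  using assms by (auto simp: attachment_section_def)

lemma linear_system_attach:
  assumes B: "mod_subspace p K B" and \<Sigma>: "\<And>j. j \<in> K \<Longrightarrow> attachable p (\<Sigma> j)"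
  shows "linear_system p (attach K B \<Sigma>)"
  unfolding mod_subspace_def
proof (intro conjI ballI allI impI)
  have lin: "linear_system p (fst (\<Sigma> j))" if "j \<in> K" for j
    using \<Sigma>[OF that] by (simp add: attachable_def)
  obtain e where "attachment_section K \<Sigma> e"
    using ex_attachment_section[of K p \<Sigma>] \<Sigma> by blast
  note e = attachment_sectionD[OF this]
  obtain a where "a \<in> B" using B by (auto simp: mod_subspace_def)
  then have "(\<lambda>u. case untag u of (j, z) \<Rightarrow> a j * e j z) \<in> labels (attach K B \<Sigma>)"
    by (rule labels_attachI[of a _ _ "\<lambda>j z. a j * e j z"])
      (simp_all add: e mod_subspace_scale[OF lin])
  then show "labels (attach K B \<Sigma>) \<noteq> {}" by blast
  {
    fix l m assume l: "l \<in> labels (attach K B \<Sigma>)" and m: "m \<in> labels (attach K B \<Sigma>)"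
    obtain a b where "a \<in> B" "lift K \<Sigma> a b l"
      using l unfolding labels_attach_iff by blast
    note ab = this(1) liftD[OF this(2)]
    obtain a' b' where "a' \<in> B" "lift K \<Sigma> a' b' m"
      using m unfolding labels_attach_iff by blast
    note ab' = this(1) liftD[OF this(2)]
    show "(\<lambda>z. l z + m z) \<in> labels (attach K B \<Sigma>)"
      by (rule labels_attachI[OF mod_subspace_add[OF B ab(1) ab'(1)], of _ "\<lambda>j z. b j z + b' j z"])
        (simp_all add: ab ab' mod_subspace_add[OF lin])
  }
  {
    fix l c assume l: "l \<in> labels (attach K B \<Sigma>)"
    obtain a b where "a \<in> B" "lift K \<Sigma> a b l"
      using l unfolding labels_attach_iff by blast
    note ab = this(1) liftD[OF this(2)]
    show "(\<lambda>z. c * l z) \<in> labels (attach K B \<Sigma>)"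
      by (rule labels_attachI[OF mod_subspace_scale[OF B ab(1), of c], of _ "\<lambda>j z. c * b j z"])
        (simp_all add: ab mod_subspace_scale[OF lin])
  }
  fix l m assume l: "l \<in> labels (attach K B \<Sigma>)"
    and lm: "\<forall>z\<in>positions (attach K B \<Sigma>). [l z = m z] (mod p)"
  obtain a b where "a \<in> B" "lift K \<Sigma> a b l"
      using l unfolding labels_attach_iff by blast
    note ab = this(1) liftD[OF this(2)]
  have lm': "[b j z = m (tag j z)] (mod p)" if "j \<in> K" "z \<in> positions (fst (\<Sigma> j))" "z \<noteq> snd (\<Sigma> j)" for j z
    using bspec[OF lm, of "tag j z"] ab(4)[OF that] that by simp
  show "m \<in> labels (attach K B \<Sigma>)"
  proof (rule labels_attachI[OF ab(1), of _ "\<lambda>j z. if z = snd (\<Sigma> j) then b j z else m (tag j z)"])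
    fix j assume j: "j \<in> K"
    show "(\<lambda>z. if z = snd (\<Sigma> j) then b j z else m (tag j z)) \<in> labels (fst (\<Sigma> j))"
      by (rule mod_subspace_cong[OF lin[OF j] ab(2)[OF j]]) (use lm' j in auto)
  qed (use ab in auto)
qed

text \<open>The whole system, with the exposed value at \<open>j\<close> as its port, is again an
  attachment. This self-similarity drives the recursion; \<open>a\<close> provides the value 1 at
  the port.\<close>

lemma attachable_attach:
  assumes B: "mod_subspace p K B" and \<Sigma>: "\<And>j. j \<in> K \<Longrightarrow> attachable p (\<Sigma> j)"
    and "j \<in> K" "\<Sigma> j = raw p" "a \<in> B" "a j = 1"
  shows "attachable p (attach K B \<Sigma>, tag j (Num 1))"
proof -
  obtain e where "attachment_section K \<Sigma> e"
    using ex_attachment_section[of K p \<Sigma>] \<Sigma> by blast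
  note e = attachment_sectionD[OF this]
  have lin: "linear_system p (fst (\<Sigma> j))" if "j \<in> K" for j
    using \<Sigma>[OF that] by (simp add: attachable_def)
  have "(\<lambda>u. if u = tag j (Num 1) then 1 else case untag u of (j, z) \<Rightarrow> a j * e j z) \<in> labels (attach K B \<Sigma>)"
  proof (rule labels_attachI[OF assms(5), of _ "\<lambda>q z. if q = j then 1 else a q * e q z"])
    fix q assume "q \<in> K"
    then show "(\<lambda>z. if q = j then 1 else a q * e q z) \<in> labels (fst (\<Sigma> q))"
      using assms(4) mod_subspace_scale[OF lin e(1), of q "a q"] by (cases "q = j") (auto simp: raw_def)
  qed (use e assms in \<open>auto simp: raw_def\<close>)
  then show ?thesis using linear_system_attach[OF B \<Sigma>] assms unfolding attachable_def
    by (intro conjI bexI[of _ "\<lambda>u. if u = tag j (Num 1) then 1 else case untag u of (j, z) \<Rightarrow> a j * e j z"])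
      (simp_all add: raw_def)
qed

lemma deriv_attach:
  assumes "deriv Y y n Y' y'"
    and B: "mod_subspace p K B" and \<Sigma>: "\<And>q. q \<in> K \<Longrightarrow> attachable p (\<Sigma> q)"
    and Y: "attachable p (Y, y)" and a: "a \<in> B" "a j = 1" and j: "j \<in> K" and i: "i \<in> K" "i \<noteq> j"
    and u: "u \<in> positions (fst (\<Sigma> i))" "u \<noteq> snd (\<Sigma> i)"
  shows "deriv (attach K B (\<Sigma>(j := (Y, y)))) (tag i u) n (attach K B (\<Sigma>(j := (Y', y')))) (tag i u)"
  using assms(1) Y
proof (induction rule: deriv.induct)
  case (specialize X x Y y)
  then obtain f c where f: "x \<in> positions X" "y \<in> positions Y" "f x = y" "c x = 1"
    "\<And>u. u \<in> positions X - {x} \<Longrightarrow> c u = 0 \<or> f u \<in> positions Y - {y}"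
    "\<And>b. b \<in> labels Y \<Longrightarrow> (\<lambda>u. c u * b (f u)) \<in> labels X"
    unfolding specializes_def by blast
  define F where "F v = (case untag v of (q, z) \<Rightarrow> if q = j then tag j (f z) else v)" for v
  define C where "C v = (case untag v of (q, z) \<Rightarrow> if q = j then c z else 1)" for v
  have FC: "F (tag q z) = (if q = j then tag j (f z) else tag q z)" "C (tag q z) = (if q = j then c z else 1)" for q z
    by (simp_all add: F_def C_def)
  show ?case
  proof (rule deriv.specialize, rule specializesI[where f = F and c = C])
    fix v assume v: "v \<in> positions (attach K B (\<Sigma>(j := (X, x))))" "v \<noteq> tag i u"
    then obtain q z where q: "v = tag q z" "q \<in> K" "z \<in> positions (fst ((\<Sigma>(j := (X, x))) q))"
      "z \<noteq> snd ((\<Sigma>(j := (X, x))) q)" by (rule_tac positions_attachE)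
    show "C v = 0 \<or> F v \<in> positions (attach K B (\<Sigma>(j := (Y, y)))) \<and> F v \<noteq> tag i u"
      using q v f(5)[of z] i by (cases "q = j") (auto simp: FC)
  next
    fix l assume "l \<in> labels (attach K B (\<Sigma>(j := (Y, y))))"
    then obtain a b where "a \<in> B" "lift K (\<Sigma>(j := (Y, y))) a b l"
      unfolding labels_attach_iff by blast
    note ab = this(1) liftD[OF this(2)]
    show "(\<lambda>v. C v * l (F v)) \<in> labels (attach K B (\<Sigma>(j := (X, x))))"
    proof (rule labels_attachI[OF ab(1), of _ "\<lambda>q z. if q = j then c z * b j (f z) else b q z"])
      fix q assume q: "q \<in> K"
      show "(\<lambda>z. if q = j then c z * b j (f z) else b q z) \<in> labels (fst ((\<Sigma>(j := (X, x))) q))"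
        using ab(2)[OF q] f(6)[of "b j"] by (cases "q = j") auto
      show "(if q = j then c (snd ((\<Sigma>(j := (X, x))) q)) * b j (f (snd ((\<Sigma>(j := (X, x))) q)))
        else b q (snd ((\<Sigma>(j := (X, x))) q))) = a q"
        using ab(3)[OF q] f by auto
      fix z assume z: "z \<in> positions (fst ((\<Sigma>(j := (X, x))) q))" "z \<noteq> snd ((\<Sigma>(j := (X, x))) q)"
      show "C (tag q z) * l (F (tag q z)) = (if q = j then c z * b j (f z) else b q z)"
        using z q f(5)[of z] ab(4)[OF q, of "f z"] ab(4)[OF q, of z] by (auto simp: FC split: if_splits)
    qed
  qed (use f i j u in \<open>auto simp: FC\<close>)
next
  case (double S Y y n Y' y')
  obtain e where "attachment_section K \<Sigma> e"
    using ex_attachment_section[of K p \<Sigma>] \<Sigma> by blast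
  note e = attachment_sectionD[OF this]
  have lin: "linear_system p (fst (\<Sigma> j))" if "j \<in> K" for j
    using \<Sigma>[OF that] by (simp add: attachable_def)
  let ?X = "attach K B (\<Sigma>(j := (Y, y)))" and ?Z = "attach K B (\<Sigma>(j := (double Y S, Left y)))"
  let ?S = "tag j ` S"
  \<comment> \<open>Right copies outside the attachment at \<open>j\<close> are all read off from
    the single position \<open>Right y\<close>, the port of the right half, as multiples of the
    labelling \<open>a q * e q z\<close>, whose base value at \<open>j\<close> is 1.\<close>
  define f where "f v = (case v of Left w \<Rightarrow> (case untag w of (q, z) \<Rightarrow> if q = j then tag j (Left z) else w)
    | Right w \<Rightarrow> (case untag w of (q, z) \<Rightarrow> if q = j then tag j (Right z) else tag j (Right y)) | _ \<Rightarrow> v)" for v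
  define c where "c v = (case v of Right w \<Rightarrow> (case untag w of (q, z) \<Rightarrow> if q = j then 1 else a q * e q z)
    | _ \<Rightarrow> 1)" for v
  have S: "?S \<subseteq> positions ?X" using double.hyps j by auto
  have y: "tag i u \<in> positions ?X - ?S" using double.hyps i u by auto
  have "specializes (double ?X ?S) (Left (tag i u)) ?Z (tag i u)"
  proof (rule specializesI[where f = f and c = c])
    fix v assume v: "v \<in> positions (double ?X ?S)" "v \<noteq> Left (tag i u)"
    then consider w where "v = Left w" "w \<in> positions ?X - ?S" | w where "v = Right w" "w \<in> positions ?X - ?S"
      by auto
    then show "c v = 0 \<or> f v \<in> positions ?Z \<and> f v \<noteq> tag i u"
    proof cases
      case 1
      then obtain q z where "w = tag q z" "q \<in> K" "z \<in> positions (fst ((\<Sigma>(j := (Y, y))) q))"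
        "z \<noteq> snd ((\<Sigma>(j := (Y, y))) q)" by (auto elim: positions_attachE)
      then show ?thesis using 1 v i by (auto simp: f_def split: if_splits)
    next
      case 2
      then obtain q z where "w = tag q z" "q \<in> K" "z \<in> positions (fst ((\<Sigma>(j := (Y, y))) q))"
        "z \<noteq> snd ((\<Sigma>(j := (Y, y))) q)" by (auto elim: positions_attachE)
      then show ?thesis using 2 v i j double.hyps by (auto simp: f_def split: if_splits)
    qed
  next
    fix l assume "l \<in> labels ?Z"
    then obtain d b where "d \<in> B" "lift K (\<Sigma>(j := (double Y S, Left y))) d b l"
      unfolding labels_attach_iff by blast
    note ab = this(1) liftD[OF this(2)]
    have "b j \<in> labels (double Y S)" using ab(2)[OF j] by simp
    then obtain b0 b1 where b: "b0 \<in> labels Y" "b1 \<in> labels Y" "\<And>x. x \<in> S \<Longrightarrow> b0 x = b1 x"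
      "\<And>x. x \<in> positions Y - S \<Longrightarrow> b j (Left x) = b0 x"
      "\<And>x. x \<in> positions Y - S \<Longrightarrow> b j (Right x) = b1 x" by (rule labels_doubleE) blast
    have yS: "y \<in> positions Y - S" using double.hyps by simp
    define l0 where "l0 v = (case untag v of (q, z) \<Rightarrow> if q = j then b0 z else b q z)" for v
    define l1 where "l1 v = (case untag v of (q, z) \<Rightarrow> if q = j then b1 z else b1 y * (a q * e q z))" for v
    have l0: "l0 \<in> labels ?X"
    proof (rule labels_attachI[OF ab(1), of _ "\<lambda>q z. if q = j then b0 z else b q z"])
      fix q assume q: "q \<in> K"
      show "(\<lambda>z. if q = j then b0 z else b q z) \<in> labels (fst ((\<Sigma>(j := (Y, y))) q))"
        using ab(2)[OF q] b(1) by (cases "q = j") auto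
      show "(if q = j then b0 (snd ((\<Sigma>(j := (Y, y))) q)) else b q (snd ((\<Sigma>(j := (Y, y))) q))) = d q"
        using ab(3)[OF q] b(4)[OF yS] by auto
    qed (auto simp: l0_def)
    have aB: "(\<lambda>q. b1 y * a q) \<in> B" by (rule mod_subspace_scale[OF B a(1)])
    have l1: "l1 \<in> labels ?X"
    proof (rule labels_attachI[OF aB, of _
          "\<lambda>q z. if q = j then b1 z else b1 y * (a q * e q z)"])
      fix q assume q: "q \<in> K"
      show "(\<lambda>z. if q = j then b1 z else b1 y * (a q * e q z)) \<in> labels (fst ((\<Sigma>(j := (Y, y))) q))"
        using b(2) mod_subspace_scale[OF lin[OF q] mod_subspace_scale[OF lin[OF q] e(1)[OF q]]]
        by (cases "q = j") auto
      show "(if q = j then b1 (snd ((\<Sigma>(j := (Y, y))) q)) else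
          b1 y * (a q * e q (snd ((\<Sigma>(j := (Y, y))) q)))) = b1 y * a q"
        using e(2)[OF q] a by auto
    qed (auto simp: l1_def)
    show "(\<lambda>z. c z * l (f z)) \<in> labels (double ?X ?S)"
    proof (rule labels_doubleI[OF l0 l1])
      fix v assume "v \<in> ?S" then show "l0 v = l1 v" using b(3) by (auto simp: l0_def l1_def)
    next
      fix v assume v: "v \<in> positions ?X - ?S"
      then obtain q z where q: "v = tag q z" "q \<in> K" "z \<in> positions (fst ((\<Sigma>(j := (Y, y))) q))"
        "z \<noteq> snd ((\<Sigma>(j := (Y, y))) q)" by (auto elim: positions_attachE)
      have zS: "z \<in> positions Y - S" if "q = j" using q v that by auto
      show "c (Left v) * l (f (Left v)) = l0 v"
        using q v zS b(4) ab(4)[OF q(2), of "if q = j then Left z else z"]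
        by (cases "q = j") (auto simp: c_def f_def l0_def)
      show "c (Right v) * l (f (Right v)) = l1 v"
        using q v zS yS b(5) ab(4)[OF j, of "if q = j then Right z else Right y"]
        by (cases "q = j") (auto simp: c_def f_def l1_def)
    qed
  qed (use i j u y double.hyps in \<open>auto simp: f_def c_def\<close>)
  moreover have "deriv ?Z (tag i u) n (attach K B (\<Sigma>(j := (Y', y')))) (tag i u)"
    by (rule double.IH[OF attachable_double[OF double.prems]]) (use double.hyps in simp)
  ultimately show ?case using deriv.double[OF S y] deriv_specialize_left by blast
qed

text \<open>Joining along the attachment at \<open>j\<close> uses it up and leaves two copies of
  everything else, which may be labelled with a common value at \<open>j\<close>. Seen from the left
  copy, the right copy is an attachment at \<open>j\<close>.\<close>

lemma deriv_duplicate: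
  assumes B: "mod_subspace p K B" and \<Sigma>: "\<And>q. q \<in> K \<Longrightarrow> attachable p (\<Sigma> q)"
    and j: "j \<in> K" and i: "i \<in> K" "i \<noteq> j"
    and u: "u \<in> positions (fst (\<Sigma> i))" "u \<noteq> snd (\<Sigma> i)"
  shows "deriv (attach K B \<Sigma>) (tag i u) 1
    (attach K B (\<Sigma>(j := (attach K B (\<Sigma>(j := raw p)), tag j (Num 1))))) (tag i u)"
proof -
  obtain e where "attachment_section K \<Sigma> e"
    using ex_attachment_section[of K p \<Sigma>] \<Sigma> by blast
  note e = attachment_sectionD[OF this]
  have lin: "linear_system p (fst (\<Sigma> j))" if "j \<in> K" for j
    using \<Sigma>[OF that] by (simp add: attachable_def)
  let ?X = "attach K B \<Sigma>" and ?Y = "attach K B (\<Sigma>(j := raw p))"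
  let ?Z = "attach K B (\<Sigma>(j := (?Y, tag j (Num 1))))"
  let ?S = "tag j ` (positions (fst (\<Sigma> j)) - {snd (\<Sigma> j)})"
  define f where "f v = (case v of Left w \<Rightarrow> w | Right w \<Rightarrow> tag j w | _ \<Rightarrow> v)" for v
  have S: "?S \<subseteq> positions ?X" using j by auto
  have y: "tag i u \<in> positions ?X - ?S" using i u by auto
  have "specializes (double ?X ?S) (Left (tag i u)) ?Z (tag i u)"
  proof (rule specializesI[where f = f and c = "\<lambda>_. 1"])
    fix v assume v: "v \<in> positions (double ?X ?S)" "v \<noteq> Left (tag i u)"
    then consider w where "v = Left w" "w \<in> positions ?X - ?S" | w where "v = Right w" "w \<in> positions ?X - ?S"
      by auto
    then show "(1::int) = 0 \<or> f v \<in> positions ?Z \<and> f v \<noteq> tag i u"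
    proof cases
      case 1
      then obtain q z where "w = tag q z" "q \<in> K" "z \<in> positions (fst (\<Sigma> q))"
        "z \<noteq> snd (\<Sigma> q)" by (auto elim: positions_attachE)
      then show ?thesis using 1 v i by (auto simp: f_def)
    next
      case 2
      then obtain q z where "w = tag q z" "q \<in> K" "z \<in> positions (fst (\<Sigma> q))"
        "z \<noteq> snd (\<Sigma> q)" by (auto elim: positions_attachE)
      then show ?thesis using 2 v i j by (auto simp: f_def)
    qed
  next
    fix l assume "l \<in> labels ?Z"
    then obtain d b where "d \<in> B" "lift K (\<Sigma>(j := (?Y, tag j (Num 1)))) d b l"
      unfolding labels_attach_iff by blast
    note ab = this(1) liftD[OF this(2)]
    have "b j \<in> labels ?Y" using ab(2)[OF j] by simp
    then obtain d' b' where "d' \<in> B" "lift K (\<Sigma>(j := raw p)) d' b' (b j)"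
      unfolding labels_attach_iff by blast
    note b = this(1) liftD[OF this(2)]
    have "b j (tag j (Num 1)) = b' j (Num 1)" using b(4)[OF j, of "Num 1"] by (simp add: raw_def)
    then have "[d' j = d j] (mod p)" using b(2,3)[OF j] ab(3)[OF j] by (simp add: raw_def)
    \<comment> \<open>The ports agree only modulo \<open>p\<close>. The base labelling of the right
      copy is corrected to the exact value \<open>d j\<close>, so that both copies carry the same
      multiple of \<open>e j\<close> on the joined positions.\<close>
    then have d': "d'(j := d j) \<in> B" by (intro mod_subspace_cong[OF B b(1)]) auto
    define l0 where "l0 v = (case untag v of (q, z) \<Rightarrow> if q = j then d j * e j z else b q z)" for v
    define l1 where "l1 v = (case untag v of (q, z) \<Rightarrow> if q = j then d j * e j z else b' q z)" for v
    have ej: "(\<lambda>z. d j * e j z) \<in> labels (fst (\<Sigma> j))"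
      by (rule mod_subspace_scale[OF lin[OF j] e(1)[OF j]])
    have l0: "l0 \<in> labels ?X"
    proof (rule labels_attachI[OF ab(1), of _ "\<lambda>q z. if q = j then d j * e j z else b q z"])
      fix q assume q: "q \<in> K"
      show "(\<lambda>z. if q = j then d j * e j z else b q z) \<in> labels (fst (\<Sigma> q))"
        using ab(2)[OF q] ej by (cases "q = j") auto
      show "(if q = j then d j * e j (snd (\<Sigma> q)) else b q (snd (\<Sigma> q))) = d q"
        using ab(3)[OF q] e(2)[OF q] by auto
    qed (auto simp: l0_def)
    have l1: "l1 \<in> labels ?X"
    proof (rule labels_attachI[OF d', of _ "\<lambda>q z. if q = j then d j * e j z else b' q z"])
      fix q assume q: "q \<in> K"
      show "(\<lambda>z. if q = j then d j * e j z else b' q z) \<in> labels (fst (\<Sigma> q))"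
        using b(2)[OF q] ej by (cases "q = j") auto
      show "(if q = j then d j * e j (snd (\<Sigma> q)) else b' q (snd (\<Sigma> q))) = (d'(j := d j)) q"
        using b(3)[OF q] e(2)[OF q] by auto
    qed (auto simp: l1_def)
    show "(\<lambda>z. 1 * l (f z)) \<in> labels (double ?X ?S)"
    proof (rule labels_doubleI[OF l0 l1])
      fix v assume "v \<in> ?S" then show "l0 v = l1 v" by (auto simp: l0_def l1_def)
    next
      fix v assume v: "v \<in> positions ?X - ?S"
      then obtain q z where q: "v = tag q z" "q \<in> K" "z \<in> positions (fst (\<Sigma> q))"
        "z \<noteq> snd (\<Sigma> q)" by (auto elim: positions_attachE)
      have qj: "q \<noteq> j" using q v by auto
      show "1 * l (f (Left v)) = l0 v"
        using q qj ab(4)[OF q(2), of z] by (auto simp: f_def l0_def)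
      show "1 * l (f (Right v)) = l1 v"
        using q qj ab(4)[OF j, of v] b(4)[OF q(2), of z] by (auto simp: f_def l1_def)
    qed
  qed (use i u y in \<open>auto simp: f_def\<close>)
  then have "deriv (double ?X ?S) (Left (tag i u)) 0 ?Z (tag i u)" by (rule deriv.specialize)
  from deriv.double[OF S y this] show ?thesis by simp
qed

lemma supports_attach:
  assumes S: "\<And>j. j \<in> K \<Longrightarrow> supports p T (fst (\<Sigma> j)) (insert (snd (\<Sigma> j), \<lambda>r. w r j) (A j))"
    and w: "\<And>r. r < T \<Longrightarrow> w r \<in> B"
    and A: "\<And>j z c. j \<in> K \<Longrightarrow> (z, c) \<in> A j \<Longrightarrow> z \<in> positions (fst (\<Sigma> j)) - {snd (\<Sigma> j)}"
  shows "supports p T (attach K B \<Sigma>) (\<Union>j\<in>K. (\<lambda>(z, c). (tag j z, c)) ` A j)"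
proof -
  define good where "good j l \<longleftrightarrow> (\<forall>r<T. l r \<in> labels (fst (\<Sigma> j))) \<and> (\<forall>r<T. l r (snd (\<Sigma> j)) = w r j) \<and>
     (\<forall>(z, c)\<in>A j. \<forall>r<T. l r z = c r) \<and>
     (\<forall>z\<in>positions (fst (\<Sigma> j)). z \<noteq> snd (\<Sigma> j) \<longrightarrow> z \<notin> fst ` A j \<longrightarrow> (\<exists>r<T. p dvd l r z))" for j l
  have "\<exists>l. good j l" if j: "j \<in> K" for j
  proof -
    obtain l where "(\<forall>r<T. l r \<in> labels (fst (\<Sigma> j))) \<and>
      (\<forall>(z, c)\<in>insert (snd (\<Sigma> j), \<lambda>r. w r j) (A j). \<forall>r<T. l r z = c r) \<and>
      (\<forall>z\<in>positions (fst (\<Sigma> j)) - fst ` (insert (snd (\<Sigma> j), \<lambda>r. w r j) (A j)). \<exists>r<T. p dvd l r z)"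
      using S[OF j] unfolding supports_def by blast
    then have "good j l" unfolding good_def by simp
    then show "\<exists>l. good j l" by (rule exI[of "good j" l])
  qed
  then obtain l where gl: "\<And>j. j \<in> K \<Longrightarrow> good j (l j)" by metis
  have l: "\<And>j r. j \<in> K \<Longrightarrow> r < T \<Longrightarrow> l j r \<in> labels (fst (\<Sigma> j))"
    "\<And>j r. j \<in> K \<Longrightarrow> r < T \<Longrightarrow> l j r (snd (\<Sigma> j)) = w r j"
    "\<And>j r z c. j \<in> K \<Longrightarrow> r < T \<Longrightarrow> (z, c) \<in> A j \<Longrightarrow> l j r z = c r"
    "\<And>j z. j \<in> K \<Longrightarrow> z \<in> positions (fst (\<Sigma> j)) \<Longrightarrow> z \<noteq> snd (\<Sigma> j) \<Longrightarrow> z \<notin> fst ` A j \<Longrightarrow> \<exists>r<T. p dvd l j r z"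
    using gl unfolding good_def by blast+
  show ?thesis unfolding supports_def
  proof (intro exI[of _ "\<lambda>r v. case untag v of (j, z) \<Rightarrow> l j r z"] conjI allI impI ballI)
    fix r assume "r < T"
    then show "(\<lambda>v. case untag v of (j, z) \<Rightarrow> l j r z) \<in> labels (attach K B \<Sigma>)"
      by (intro labels_attachI[OF w, of _ _ "\<lambda>j. l j r"]) (auto intro: l)
  next
    fix v assume v: "v \<in> positions (attach K B \<Sigma>) - fst ` (\<Union>j\<in>K. (\<lambda>(z, c). (tag j z, c)) ` A j)"
    then obtain q z where q: "v = tag q z" "q \<in> K" "z \<in> positions (fst (\<Sigma> q))"
        "z \<noteq> snd (\<Sigma> q)" by (auto elim: positions_attachE)
    moreover have "z \<notin> fst ` A q" using v q by force
    ultimately show "\<exists>r<T. p dvd (case untag v of (j, z) \<Rightarrow> l j r z)" using l(4) by simp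
  qed (use l(3) in auto)
qed

subsection \<open>Cubes\<close>

primrec top_corner :: "nat \<Rightarrow> index" where
  "top_corner 0 = Num 0"
| "top_corner (Suc m) = Left (top_corner m)"

primrec corners :: "nat \<Rightarrow> index set" where
  "corners 0 = {Num 0}"
| "corners (Suc m) = Left ` corners m \<union> Right ` corners m"

text \<open>The corner values of an affine cube with vertex \<open>x\<close> and edges
  \<open>h\<close>: a tag \<open>Right\<close> adds the edge belonging to its layer.\<close>

primrec cube_label :: "nat \<Rightarrow> int \<Rightarrow> (nat \<Rightarrow> int) \<Rightarrow> index \<Rightarrow> int" where
  "cube_label 0 x h w = x"
| "cube_label (Suc m) x h w =
    (case w of Left v \<Rightarrow> cube_label m x h v | Right v \<Rightarrow> cube_label m (x + h m) h v | _ \<Rightarrow> 0)"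

definition cube :: "int \<Rightarrow> nat \<Rightarrow> system" where
  "cube p m = \<lparr> positions = corners m,
     labels = {b. \<exists>x h. \<forall>w\<in>corners m. [b w = cube_label m x h w] (mod p)} \<rparr>"

lemma top_corner_in_corners [simp]: "top_corner m \<in> corners m"
  by (induction m) auto

lemma positions_cube [simp]: "positions (cube p m) = corners m"
  by (simp add: cube_def)

lemma labels_cubeI: "(\<And>w. w \<in> corners m \<Longrightarrow> [b w = cube_label m x h w] (mod p)) \<Longrightarrow> b \<in> labels (cube p m)"
  by (auto simp: cube_def)

lemma labels_cubeD: "b \<in> labels (cube p m) \<Longrightarrow> \<exists>x h. \<forall>w\<in>corners m. [b w = cube_label m x h w] (mod p)"
  by (simp add: cube_def)

lemma cube_label_in_labels [simp]: "cube_label m x h \<in> labels (cube p m)"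
  by (rule labels_cubeI) (rule cong_refl)

lemma cube_label_eq_sum:
  assumes "w \<in> corners m"
  shows "\<exists>B. B \<subseteq> {..<m} \<and> (w \<noteq> top_corner m \<longrightarrow> B \<noteq> {}) \<and> (w = top_corner m \<longrightarrow> B = {}) \<and>
    (\<forall>x h. cube_label m x h w = x + (\<Sum>i\<in>B. h i))"
  using assms
proof (induction m arbitrary: w)
  case (Suc m)
  then obtain v where v: "v \<in> corners m" "w = Left v \<or> w = Right v" by auto
  obtain B where B: "B \<subseteq> {..<m}" "v \<noteq> top_corner m \<longrightarrow> B \<noteq> {}" "v = top_corner m \<longrightarrow> B = {}"
    "\<And>x h. cube_label m x h v = x + (\<Sum>i\<in>B. h i)" using Suc.IH[OF v(1)] by blast
  show ?case
  proof (cases "w = Left v")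
    case True
    then show ?thesis using B by (intro exI[of _ B]) auto
  next
    case False
    then have "w = Right v" using v by simp
    moreover have "m \<notin> B" "finite B" using B(1) finite_subset by auto
    ultimately show ?thesis using B by (intro exI[of _ "insert m B"]) auto
  qed
qed auto

lemma cube_label_top [simp]: "cube_label m x h (top_corner m) = x"
  by (induction m) auto

lemma linear_system_cube: "linear_system p (cube p m)"
  unfolding mod_subspace_def
proof (intro conjI ballI allI impI)
  have "cube_label m 0 (\<lambda>_. 0) \<in> labels (cube p m)" by simp
  then show "labels (cube p m) \<noteq> {}" by (metis empty_iff)
next
  fix a b assume ab: "a \<in> labels (cube p m)" "b \<in> labels (cube p m)"
  obtain x h where "\<forall>w\<in>corners m. [a w = cube_label m x h w] (mod p)" using labels_cubeD[OF ab(1)] by metis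
  note a = bspec[OF this]
  obtain y k where "\<forall>w\<in>corners m. [b w = cube_label m y k w] (mod p)" using labels_cubeD[OF ab(2)] by metis
  note b = bspec[OF this]
  have "[a w + b w = cube_label m (x + y) (\<lambda>i. h i + k i) w] (mod p)" if w: "w \<in> corners m" for w
  proof -
    obtain B where B: "\<And>x h. cube_label m x h w = x + (\<Sum>i\<in>B. h i)" using cube_label_eq_sum[OF w] by blast
    have "cube_label m (x + y) (\<lambda>i. h i + k i) w = cube_label m x h w + cube_label m y k w"
      by (simp add: B sum.distrib)
    then show ?thesis using cong_add[OF a[OF w] b[OF w]] by simp
  qed
  then show "(\<lambda>z. a z + b z) \<in> labels (cube p m)" by (rule labels_cubeI)
next
  fix a c assume "a \<in> labels (cube p m)"
  then obtain x h where "\<forall>w\<in>corners m. [a w = cube_label m x h w] (mod p)" using labels_cubeD by metis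
  note a = bspec[OF this]
  have "[c * a w = cube_label m (c * x) (\<lambda>i. c * h i) w] (mod p)" if w: "w \<in> corners m" for w
  proof -
    obtain B where B: "\<And>x h. cube_label m x h w = x + (\<Sum>i\<in>B. h i)" using cube_label_eq_sum[OF w] by blast
    have "cube_label m (c * x) (\<lambda>i. c * h i) w = c * cube_label m x h w"
      by (simp add: B sum_distrib_left distrib_left)
    then show ?thesis using cong_scalar_left[OF a[OF w], of c] by simp
  qed
  then show "(\<lambda>z. c * a z) \<in> labels (cube p m)" by (rule labels_cubeI)
next
  fix a b assume "a \<in> labels (cube p m)" and ab: "\<forall>z\<in>positions (cube p m). [a z = b z] (mod p)"
  then obtain x h where "\<forall>w\<in>corners m. [a w = cube_label m x h w] (mod p)" using labels_cubeD by metis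
  note a = bspec[OF this]
  have "[b w = cube_label m x h w] (mod p)" if "w \<in> corners m" for w
    using a[OF that] bspec[OF ab, of w] that by (metis cong_sym cong_trans positions_cube)
  then show "b \<in> labels (cube p m)" by (rule labels_cubeI)
qed

lemma attachable_cube: "attachable p (cube p m, top_corner m)"
  unfolding attachable_def using linear_system_cube
  by (intro conjI bexI[of _ "cube_label m 1 (\<lambda>_. 0)"]) simp_all

definition low :: "int \<Rightarrow> nat \<Rightarrow> attachment \<Rightarrow> bool" where
  "low p T Y \<longleftrightarrow> (\<forall>c. supports p T (fst Y) {(snd Y, c)})"

text \<open>Slot \<open>r\<close> uses only the edge in direction \<open>r\<close>, of length
  \<open>- c r\<close>. A corner other than the top one involves some direction \<open>i\<close>,
  and slot \<open>i\<close> cancels there.\<close>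

lemma low_cube: "low p T (cube p T, top_corner T)"
  unfolding low_def supports_def
proof (intro allI)
  fix c :: "nat \<Rightarrow> int"
  let ?l = "\<lambda>r. cube_label T (c r) (\<lambda>i. if i = r then - c r else 0)"
  have "\<exists>r<T. p dvd ?l r w" if w: "w \<in> corners T" "w \<noteq> top_corner T" for w
  proof -
    obtain B where B: "B \<subseteq> {..<T}" "B \<noteq> {}" "\<And>x h. cube_label T x h w = x + (\<Sum>i\<in>B. h i)"
      using cube_label_eq_sum[OF w(1)] w(2) by blast
    then obtain i where i: "i \<in> B" by blast
    have "finite B" using B(1) finite_subset by blast
    then have "?l i w = 0" using i by (simp add: B(3))
    then show ?thesis using i B(1) by (intro exI[of _ i]) auto
  qed
  then show "\<exists>l. (\<forall>r<T. l r \<in> labels (fst (cube p T, top_corner T))) \<and>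
      (\<forall>(z, c)\<in>{(snd (cube p T, top_corner T), c)}. \<forall>r<T. l r z = c r) \<and>
      (\<forall>z\<in>positions (fst (cube p T, top_corner T)) - fst ` {(snd (cube p T, top_corner T), c)}. \<exists>r<T. p dvd l r z)"
    by (intro exI[of _ ?l]) auto
qed

text \<open>The additional slots are filled with multiples of the labelling that is 1 at the port;
  the first \<open>T\<close> slots already annihilate everything else.\<close>

lemma low_mono:
  assumes "low p T Y" "T \<le> T'" "attachable p Y"
  shows "low p T' Y"
  unfolding low_def
proof
  fix c :: "nat \<Rightarrow> int"
  obtain l where l: "\<And>r. r < T \<Longrightarrow> l r \<in> labels (fst Y)" "\<And>r. r < T \<Longrightarrow> l r (snd Y) = c r"
    "\<forall>z\<in>positions (fst Y) - {snd Y}. \<exists>r<T. p dvd l r z"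
    using assms(1) unfolding low_def supports_def by (auto dest!: spec[of _ c])
  obtain e where e: "e \<in> labels (fst Y)" "e (snd Y) = 1" and lin: "linear_system p (fst Y)"
    using assms(3) by (auto simp: attachable_def)
  let ?l = "\<lambda>r. if r < T then l r else (\<lambda>z. c r * e z)"
  have "\<forall>z\<in>positions (fst Y) - {snd Y}. \<exists>r<T'. p dvd ?l r z"
  proof
    fix z assume "z \<in> positions (fst Y) - {snd Y}"
    then obtain r where "r < T" "p dvd l r z" using l(3) by blast
    then show "\<exists>r<T'. p dvd ?l r z" using assms(2) by (intro exI[of _ r]) auto
  qed
  moreover have "?l r \<in> labels (fst Y)" for r
    using l(1) mod_subspace_scale[OF lin e(1)] by auto
  ultimately show "supports p T' (fst Y) {(snd Y, c)}" unfolding supports_def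
    using l(2) e(2) by (intro exI[of _ ?l]) auto
qed

lemma controlled_attachment:
  assumes "low p T Y" "attachable p Y" "prime p"
  shows "controlled p T (fst Y) (snd Y)"
proof -
  have "\<not> p dvd 1" using assms(3) by (auto dest: prime_gt_1_int)
  then show ?thesis using assms(1,2) unfolding controlled_def low_def attachable_def
    by (intro conjI exI[of _ "\<lambda>_. 1"]) simp_all
qed

section \<open>Cubes derived from controlled positions\<close>

fun strip :: "index \<Rightarrow> index" where
  "strip (Left z) = z"
| "strip (Right z) = z"
| "strip z = z"

text \<open>Non-target positions annihilated in slot \<open>m\<close> are the set joined along at step \<open>m\<close>, so that adding a
  multiple of the \<open>m\<close>-th labelling on the right half is compatible with the joining.\<close>

primrec tower :: "system \<Rightarrow> index \<Rightarrow> (index \<Rightarrow> nat) \<Rightarrow> nat \<Rightarrow> system" where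
  "tower X x d 0 = X"
| "tower X x d (Suc m) = double (tower X x d m)
     {y \<in> positions (tower X x d m). (strip ^^ m) y \<noteq> x \<and> d ((strip ^^ m) y) = m}"

primrec tower_label :: "(nat \<Rightarrow> index \<Rightarrow> int) \<Rightarrow> nat \<Rightarrow> (index \<Rightarrow> int) \<Rightarrow> (nat \<Rightarrow> int) \<Rightarrow> index \<Rightarrow> int" where
  "tower_label l 0 a h y = a y"
| "tower_label l (Suc m) a h y = (case y of Left v \<Rightarrow> tower_label l m a h v
     | Right v \<Rightarrow> tower_label l m (\<lambda>z. a z + h m * l m z) h v | _ \<Rightarrow> 0)"

primrec rebase :: "nat \<Rightarrow> index \<Rightarrow> index" where
  "rebase 0 y = Num 0"
| "rebase (Suc m) y = (case y of Left v \<Rightarrow> Left (rebase m v) | Right v \<Rightarrow> Right (rebase m v) | _ \<Rightarrow> y)"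

lemma strip_pow_Suc [simp]:
  "(strip ^^ Suc m) (Left v) = (strip ^^ m) v" "(strip ^^ Suc m) (Right v) = (strip ^^ m) v"
  by (simp_all add: funpow_Suc_right del: funpow.simps)

lemma tower_positions:
  "y \<in> positions (tower X x d m) \<Longrightarrow>
    (strip ^^ m) y \<in> positions X \<and> ((strip ^^ m) y = x \<or> m \<le> d ((strip ^^ m) y)) \<and> rebase m y \<in> corners m"
proof (induction m arbitrary: y)
  case (Suc m)
  then obtain v where v: "v \<in> positions (tower X x d m)" "y = Left v \<or> y = Right v"
    "(strip ^^ m) v = x \<or> d ((strip ^^ m) v) \<noteq> m" by auto
  then show ?case using Suc.IH[OF v(1)] by (auto simp del: funpow.simps)
qed auto

lemma tower_label_cong:
  "a ((strip ^^ m) y) = a' ((strip ^^ m) y) \<Longrightarrow> tower_label l m a h y = tower_label l m a' h y"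
proof (induction m arbitrary: a a' y)
  case (Suc m)
  show ?case
  proof (cases y)
    case (Left v)
    then show ?thesis using Suc.prems Suc.IH[of a v a'] by (simp del: funpow.simps)
  next
    case (Right v)
    then show ?thesis using Suc.prems
        Suc.IH[of "\<lambda>z. a z + h m * l m z" v "\<lambda>z. a' z + h m * l m z"] by (simp del: funpow.simps)
  qed auto
qed auto

text \<open>The right half of step \<open>m\<close> differs from the left half by
  \<open>h m * l m\<close>, and the positions joined in this step are those where \<open>l m\<close>
  is exactly 0.\<close>

lemma tower_label_in_labels:
  assumes X: "linear_system p X" and l: "\<And>r. r < T \<Longrightarrow> l r \<in> labels X"
    and d: "\<And>z. z \<in> positions X \<Longrightarrow> z \<noteq> x \<Longrightarrow> l (d z) z = 0"
  shows "m \<le> T \<Longrightarrow> a \<in> labels X \<Longrightarrow> tower_label l m a h \<in> labels (tower X x d m)"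
proof (induction m arbitrary: a)
  case (Suc m)
  let ?b = "\<lambda>z. a z + h m * l m z"
  have b: "?b \<in> labels X"
    using Suc.prems l[of m] by (intro mod_subspace_add[OF X] mod_subspace_scale[OF X]) auto
  show ?case unfolding tower.simps
  proof (rule labels_doubleI[OF Suc.IH Suc.IH[OF _ b]])
    fix y assume y: "y \<in> {y \<in> positions (tower X x d m). (strip ^^ m) y \<noteq> x \<and> d ((strip ^^ m) y) = m}"
    then have "l m ((strip ^^ m) y) = 0" using tower_positions[of y X x d m] d[of "(strip ^^ m) y"] by auto
    then show "tower_label l m a h y = tower_label l m ?b h y"
      by (intro tower_label_cong) simp
  qed (use Suc.prems in auto)
next
  case 0
  have "tower_label l 0 a h = a" by (rule ext) simp
  then show ?case using 0 by simp
qed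

lemma deriv_tower:
  assumes x: "x \<in> positions X" and "deriv (tower X x d m) ((Left ^^ m) x) n Y y"
  shows "deriv X x (m + n) Y y"
  using assms(2)
proof (induction m arbitrary: n)
  case (Suc m)
  have top: "(Left ^^ m) x \<in> positions (tower X x d m) \<and> (strip ^^ m) ((Left ^^ m) x) = x" for m
  proof (induction m)
    case (Suc m)
    then show ?case using strip_pow_Suc(1)[of m "(Left ^^ m) x"] by (auto simp del: strip_pow_Suc)
  qed (use x in auto)
  have "deriv (tower X x d m) ((Left ^^ m) x) (Suc n) Y y"
    by (rule deriv.double[OF _ _ Suc.prems[unfolded tower.simps funpow.simps comp_def]])
      (use top[of m] in auto)
  then show ?case using Suc.IH by fastforce
qed auto

lemma tower_label_rebase:
  assumes "\<And>r. l r x = 1"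
  shows "(strip ^^ m) y = x \<Longrightarrow> y \<in> positions (tower X x d m) \<Longrightarrow>
    tower_label l m a h y = cube_label m (a x) h (rebase m y)"
proof (induction m arbitrary: a y)
  case (Suc m)
  then obtain v where v: "v \<in> positions (tower X x d m)" "y = Left v \<or> y = Right v" by auto
  then have x: "(strip ^^ m) v = x" using Suc.prems(1) strip_pow_Suc by metis
  from v(2) show ?case
  proof
    assume "y = Left v" then show ?thesis using Suc.IH[OF x v(1), of a] by simp
  next
    assume "y = Right v"
    then show ?thesis using Suc.IH[OF x v(1), of "\<lambda>z. a z + h m * l m z"] assms by simp
  qed
qed simp

lemma rebase_eq_top:
  "(strip ^^ m) y = x \<Longrightarrow> y \<in> positions (tower X x d m) \<Longrightarrow> rebase m y = top_corner m \<Longrightarrow> y = (Left ^^ m) x"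
proof (induction m arbitrary: y)
  case (Suc m)
  then obtain v where v: "v \<in> positions (tower X x d m)" "y = Left v \<or> y = Right v" by auto
  then have x: "(strip ^^ m) v = x" using Suc.prems(1) strip_pow_Suc by metis
  from v(2) show ?case
  proof
    assume "y = Left v" then show ?thesis using Suc.IH[OF x v(1)] Suc.prems(3) by simp
  next
    assume "y = Right v" then show ?thesis using Suc.prems(3) by simp
  qed
qed simp

lemma rebase_top: "rebase m ((Left ^^ m) x) = top_corner m"
  by (induction m) auto

lemma top_in_tower: "x \<in> positions X \<Longrightarrow> (Left ^^ m) x \<in> positions (tower X x d m) \<and> (strip ^^ m) ((Left ^^ m) x) = x"
proof (induction m)
  case (Suc m)
  then show ?case using strip_pow_Suc(1)[of m "(Left ^^ m) x"] by (auto simp del: strip_pow_Suc)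
qed auto

lemma linear_system_tower: "linear_system p X \<Longrightarrow> linear_system p (tower X x d m)"
proof (induction m)
  case (Suc m)
  then show ?case unfolding tower.simps by (intro linear_system_double)
qed simp

lemma ex_inverse_mod:
  assumes "prime (p::int)" "\<not> p dvd c"
  shows "\<exists>u. [u * c = 1] (mod p)"
proof -
  have "coprime p c" using assms by (intro prime_imp_coprime)
  then have "coprime c p" by (simp add: coprime_commute)
  then show ?thesis using cong_solve_coprime_int[of c p] by (metis mult.commute)
qed

text \<open>Every position other than \<open>x\<close> is joined away in the step of a slot that
  annihilates it. After \<open>T\<close> steps only copies of \<open>x\<close> remain, arranged as
  corners, and every cube labelling is realised on them.\<close>

lemma deriv_cube:
  assumes "controlled p T X x" and X: "linear_system p X" and p: "prime p" and T: "T > 0"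
  shows "deriv X x T (cube p T) (top_corner T)"
proof -
  obtain l0 c where l0: "x \<in> positions X" "\<And>r. r < T \<Longrightarrow> l0 r \<in> labels X" "\<And>r. r < T \<Longrightarrow> l0 r x = c r"
    "\<forall>z\<in>positions X - {x}. \<exists>r<T. p dvd l0 r z" "\<forall>r<T. \<not> p dvd c r"
    using assms(1) unfolding controlled_def supports_def by auto
  have "\<forall>r. \<exists>u. r < T \<longrightarrow> [u * c r = 1] (mod p)" using ex_inverse_mod[OF p] l0(5) by blast
  then obtain u where u: "\<And>r. r < T \<Longrightarrow> [u r * c r = 1] (mod p)" by metis
  \<comment> \<open>Rescaled to the value 1 at \<open>x\<close>, and with multiples of
    \<open>p\<close> replaced by 0 because joining requires equal integers.\<close>
  define l where "l r z = (if z = x then 1 else if p dvd l0 r z then 0 else u r * l0 r z)" for r z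
  define d where "d z = (SOME r. r < T \<and> p dvd l0 r z)" for z
  have d: "d z < T \<and> p dvd l0 (d z) z" if "z \<in> positions X - {x}" for z
    unfolding d_def using someI_ex[of "\<lambda>r. r < T \<and> p dvd l0 r z"] l0(4) that by blast
  have l: "l r \<in> labels X" if "r < T" for r
  proof (rule mod_subspace_cong[OF X mod_subspace_scale[OF X l0(2)[OF that], of "u r"]])
    fix z
    show "[u r * l0 r z = l r z] (mod p)"
    proof (cases "z = x")
      case True then show ?thesis using u[OF that] l0(3)[OF that] by (simp add: l_def)
    next
      case False then show ?thesis by (auto simp: l_def cong_0_iff)
    qed
  qed
  have ld: "l (d z) z = 0" if "z \<in> positions X" "z \<noteq> x" for z
    using d[of z] that by (simp add: l_def)
  have lx: "l r x = 1" for r by (simp add: l_def)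
  let ?Y = "tower X x d T"
  have str: "(strip ^^ T) y = x" if "y \<in> positions ?Y" for y
    using tower_positions[OF that] d[of "(strip ^^ T) y"] by fastforce
  have "specializes ?Y ((Left ^^ T) x) (cube p T) (top_corner T)"
  proof (rule specializesI[where f = "rebase T" and c = "\<lambda>_. 1"])
    fix z assume z: "z \<in> positions ?Y" "z \<noteq> (Left ^^ T) x"
    then show "(1::int) = 0 \<or> rebase T z \<in> positions (cube p T) \<and> rebase T z \<noteq> top_corner T"
      using tower_positions[OF z(1)] rebase_eq_top[OF str[OF z(1)] z(1)] by auto
  next
    fix b assume "b \<in> labels (cube p T)"
    then obtain x0 h where "\<forall>w\<in>corners T. [b w = cube_label T x0 h w] (mod p)" using labels_cubeD by metis
    note b = bspec[OF this]
    have x0: "(\<lambda>z. x0 * l 0 z) \<in> labels X" using mod_subspace_scale[OF X l[of 0]] T by simp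
    show "(\<lambda>z. 1 * b (rebase T z)) \<in> labels ?Y"
    proof (rule mod_subspace_cong[OF linear_system_tower[OF X] tower_label_in_labels[OF X l ld order.refl x0]])
      fix y assume y: "y \<in> positions ?Y"
      have "tower_label l T (\<lambda>z. x0 * l 0 z) h y = cube_label T x0 h (rebase T y)"
        using tower_label_rebase[where l = l, OF lx str[OF y] y, of "\<lambda>z. x0 * l 0 z" h] by (simp add: lx)
      then show "[tower_label l T (\<lambda>z. x0 * l 0 z) h y = 1 * b (rebase T y)] (mod p)"
        using cong_sym[OF b[of "rebase T y"]] tower_positions[OF y] by simp
    qed
  qed (use top_in_tower[OF l0(1)] rebase_top in auto)
  then have "deriv ?Y ((Left ^^ T) x) 0 (cube p T) (top_corner T)" by (rule deriv.specialize)
  from deriv_tower[OF l0(1) this] show ?thesis by simp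
qed

subsection \<open>The register gadget\<close>

text \<open>The three values that a cube with two extra dimensions can carry at a corner \<open>P\<close> and its two
  neighbours \<open>A\<close> and \<open>W\<close> in these dimensions: in one slot the fourth corner of the square vanishes
  after subtraction, and the remaining slots annihilate the parallel squares.\<close>

definition splits :: "nat \<Rightarrow> (nat \<Rightarrow> int) \<Rightarrow> (nat \<Rightarrow> int) \<Rightarrow> (nat \<Rightarrow> int) \<Rightarrow> bool" where
  "splits T P A W \<longleftrightarrow> (\<exists>r<T. P r = A r + W r \<and>
     (\<exists>c. \<forall>Y\<in>{P, A, W}. Y r = 0 \<or> (\<forall>q<T. q \<noteq> r \<longrightarrow> Y q = c q)))"

abbreviation (input) cP :: "nat \<Rightarrow> index" where "cP m \<equiv> Left (Left (top_corner m))"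
abbreviation (input) cA :: "nat \<Rightarrow> index" where "cA m \<equiv> Right (Left (top_corner m))"
abbreviation (input) cW :: "nat \<Rightarrow> index" where "cW m \<equiv> Left (Right (top_corner m))"

text \<open>Two of the \<open>m + 2\<close> directions span the square of \<open>P\<close>,
  \<open>A\<close> and \<open>W\<close>. The other \<open>m\<close> are matched with the slots
  different from the splitting slot, so \<open>m + 1\<close> slots suffice.\<close>

lemma supports_cube:
  assumes T: "T = Suc m" and "splits T P A W"
  shows "supports p T (cube p (Suc (Suc m))) {(cP m, P), (cA m, A), (cW m, W)}"
proof -
  obtain s c where s: "s < T" "P s = A s + W s"
    "\<forall>Y\<in>{P, A, W}. Y s = 0 \<or> (\<forall>q<T. q \<noteq> s \<longrightarrow> Y q = c q)"
    using assms(2) unfolding splits_def by blast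
  \<comment> \<open>\<open>f\<close> maps the remaining directions onto the slots other than
    \<open>s\<close>. An edge \<open>- c r\<close> in direction \<open>i\<close>, with
    \<open>r = f i\<close>, cancels in slot \<open>r\<close> any tuple that agrees with
    \<open>c\<close> there, as in \<open>low_cube\<close>.\<close>
  define f where "f i = (if i < s then i else Suc i)" for i
  define h where "h r i = (if i = Suc m then A r - P r else if i = m then W r - P r
    else if f i = r then - c r else 0)" for r i
  have f: "f i < T" "f i \<noteq> s" if "i < m" for i using that s T by (auto simp: f_def)
  have inj: "inj_on f B" for B by (auto simp: f_def inj_on_def split: if_splits)
  have good: "\<exists>r<T. cube_label m (Y r) (h r) v = 0"
    if v: "v \<in> corners m" and Y: "Y s = 0 \<or> (v \<noteq> top_corner m \<and> (\<forall>q<T. q \<noteq> s \<longrightarrow> Y q = c q))" for Y v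
  proof -
    obtain B where B: "B \<subseteq> {..<m}" "v \<noteq> top_corner m \<longrightarrow> B \<noteq> {}"
      "\<And>x h. cube_label m x h v = x + (\<Sum>i\<in>B. h i)" using cube_label_eq_sum[OF v] by blast
    have fin: "finite B" using B(1) finite_subset by blast
    have h: "h r i = (if f i = r then - c r else 0)" if "i \<in> B" for r i using that B(1) by (auto simp: h_def)
    show ?thesis
    proof (cases "Y s = 0")
      case True
      have "f i \<noteq> s" if "i \<in> B" for i using f(2)[of i] that B(1) by auto
      then have "(\<Sum>i\<in>B. h s i) = 0" using h by (intro sum.neutral) auto
      then show ?thesis using True s(1) by (intro exI[of _ s]) (simp add: B(3))
    next
      case False
      then obtain i where i: "i \<in> B" using Y B(2) by auto
      have "(\<Sum>k\<in>B. h (f i) k) = (\<Sum>k\<in>B. if k = i then - c (f i) else 0)"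
        using h inj[of B] i by (intro sum.cong) (auto simp: inj_on_def)
      also have "\<dots> = - c (f i)" using fin i by simp
      finally have "cube_label m (Y (f i)) (h (f i)) v = Y (f i) - c (f i)" by (simp add: B(3))
      moreover have "f i < T" "f i \<noteq> s" using f[of i] i B(1) by auto
      ultimately show ?thesis using False Y by (intro exI[of _ "f i"]) auto
    qed
  qed
  let ?l = "\<lambda>r. cube_label (Suc (Suc m)) (P r) (h r)"
  have lab: "?l r (Left (Left v)) = cube_label m (P r) (h r) v"
    "?l r (Right (Left v)) = cube_label m (A r) (h r) v"
    "?l r (Left (Right v)) = cube_label m (W r) (h r) v"
    "?l r (Right (Right v)) = cube_label m (A r + W r - P r) (h r) v" for r v
    by (simp_all add: h_def add_diff_eq)
  have "\<exists>r<T. p dvd ?l r z" if z: "z \<in> corners (Suc (Suc m))" "z \<notin> {cP m, cA m, cW m}" for z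
  proof -
    obtain v where v: "v \<in> corners m"
      "z = Left (Left v) \<or> z = Right (Left v) \<or> z = Left (Right v) \<or> z = Right (Right v)"
      using z(1) by auto
    then consider "z = Left (Left v)" "v \<noteq> top_corner m" | "z = Right (Left v)" "v \<noteq> top_corner m"
      | "z = Left (Right v)" "v \<noteq> top_corner m" | "z = Right (Right v)" using z(2) by auto
    then have "\<exists>r<T. ?l r z = 0"
    proof cases
      case 1 then show ?thesis using good[OF v(1), of P] bspec[OF s(3), of P] by (simp only: lab) blast
    next
      case 2 then show ?thesis using good[OF v(1), of A] bspec[OF s(3), of A] by (simp only: lab) blast
    next
      case 3 then show ?thesis using good[OF v(1), of W] bspec[OF s(3), of W] by (simp only: lab) blast
    next
      case 4 then show ?thesis using good[OF v(1), of "\<lambda>r. A r + W r - P r"] s(2) by (simp only: lab) simp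
    qed
    then show ?thesis by (metis dvd_0_right)
  qed
  then show ?thesis unfolding supports_def
    by (intro exI[of _ ?l]) (auto simp: h_def simp del: corners.simps cube_label.simps(2) simp add: lab)
qed

definition hinge :: "int \<Rightarrow> nat \<Rightarrow> system" where
  "hinge p m = double (cube p (Suc (Suc m))) {cW m}"

text \<open>The two squares may split in different slots of the shared tuple \<open>W\<close>. This
  is the source of arithmetic: removing 1 from one slot of a register can add the content of another
  slot to a second register.\<close>

definition meets :: "nat \<Rightarrow> (nat \<Rightarrow> int) \<Rightarrow> (nat \<Rightarrow> int) \<Rightarrow> (nat \<Rightarrow> int) \<Rightarrow> (nat \<Rightarrow> int) \<Rightarrow> bool" where
  "meets T hP hA lP lA \<longleftrightarrow> (\<exists>W. splits T hP hA W \<and> splits T lP lA W)"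

lemma supports_doubleI:
  assumes "supports p T X A" "supports p T X B"
    and "\<And>z. z \<in> S \<Longrightarrow> \<exists>c. (z, c) \<in> A \<and> (z, c) \<in> B"
    and "C = (\<lambda>(z, c). (Left z, c)) ` {u \<in> A. fst u \<notin> S} \<union> (\<lambda>(z, c). (Right z, c)) ` {u \<in> B. fst u \<notin> S}"
  shows "supports p T (double X S) C"
  using supports_double[OF assms(1-3)] assms(4) by simp

lemma keep_insert:
  "{u \<in> insert a A. fst u \<notin> S} = (if fst a \<in> S then {u \<in> A. fst u \<notin> S} else insert a {u \<in> A. fst u \<notin> S})"
  "{u \<in> {}. fst u \<notin> S} = {}"
  by auto

lemma supports_hinge:
  assumes "T = Suc m" "meets T hP hA lP lA"
  shows "supports p T (hinge p m)
    {(Left (cP m), lP), (Left (cA m), lA), (Right (cP m), hP), (Right (cA m), hA)}"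
proof -
  obtain W where W: "splits T hP hA W" "splits T lP lA W" using assms(2) by (auto simp: meets_def)
  show ?thesis unfolding hinge_def
    by (rule supports_doubleI[OF supports_cube[OF assms(1) W(2)] supports_cube[OF assms(1) W(1)]]) (auto simp: keep_insert)
qed

definition double_hinge :: "int \<Rightarrow> nat \<Rightarrow> system" where
  "double_hinge p m = double (hinge p m) {Right (cP m)}"

lemma supports_double_hinge:
  assumes "T = Suc m" "meets T hP hA lP lA" "meets T hP hA' lP' lA'"
  shows "supports p T (double_hinge p m)
    {(Left (Left (cP m)), lP), (Left (Left (cA m)), lA), (Left (Right (cA m)), hA),
     (Right (Left (cP m)), lP'), (Right (Left (cA m)), lA'), (Right (Right (cA m)), hA')}"
  unfolding double_hinge_def
  by (rule supports_doubleI[OF supports_hinge[OF assms(1,2)] supports_hinge[OF assms(1,3)]]) (auto simp: keep_insert)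

text \<open>Four hinges in a row. The tuples \<open>h1\<close>, \<open>h2\<close>, \<open>h3\<close>
  of \<open>gadget_step\<close> sit at the corners shared by consecutive hinges: wire 0 passes
  through them and exchanges in turn with the port and with wires 1, 2 and 3.\<close>

definition gadget :: "int \<Rightarrow> nat \<Rightarrow> system" where
  "gadget p m = double (double_hinge p m) {Right (Right (cA m))}"

definition port :: "nat \<Rightarrow> index" where
  "port m = Left (Left (Left (cP m)))"

definition wire_start :: "nat \<Rightarrow> nat \<Rightarrow> index" where
  "wire_start m i = (if i = 0 then Left (Left (Right (cA m))) else if i = 1 then Left (Right (Left (cA m)))
     else if i = 2 then Right (Right (Left (cP m))) else Right (Left (Left (cA m))))"

definition wire_end :: "nat \<Rightarrow> nat \<Rightarrow> index" where
  "wire_end m i = (if i = 0 then Right (Left (Right (cA m))) else if i = 1 then Left (Right (Left (cP m)))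
     else if i = 2 then Right (Right (Left (cA m))) else Right (Left (Left (cP m))))"

text \<open>Each of the four wires leads from its start to its end; \<open>\<sigma>\<close> and \<open>\<sigma>'\<close> are the values at the starts and
  the ends, and \<open>c\<close> is the value at the port.\<close>

definition gadget_step :: "nat \<Rightarrow> (nat \<Rightarrow> nat \<Rightarrow> int) \<Rightarrow> (nat \<Rightarrow> int) \<Rightarrow> (nat \<Rightarrow> nat \<Rightarrow> int) \<Rightarrow> bool" where
  "gadget_step T \<sigma> c \<sigma>' \<longleftrightarrow> (\<exists>h1 h2 h3. meets T h1 (\<sigma> 0) c (\<lambda>_. 0) \<and> meets T h1 h2 (\<sigma>' 1) (\<sigma> 1) \<and>
     meets T h3 h2 (\<sigma> 2) (\<sigma>' 2) \<and> meets T h3 (\<sigma>' 0) (\<sigma>' 3) (\<sigma> 3))"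

lemma supports_gadget:
  assumes T: "T = Suc m" and "gadget_step T \<sigma> c \<sigma>'"
  shows "supports p T (gadget p m) (insert (port m, c)
    ((\<lambda>i. (wire_start m i, \<sigma> i)) ` {..<4} \<union> (\<lambda>i. (wire_end m i, \<sigma>' i)) ` {..<4}))"
proof -
  obtain h1 h2 h3 where h: "meets T h1 (\<sigma> 0) c (\<lambda>_. 0)" "meets T h1 h2 (\<sigma>' 1) (\<sigma> 1)"
     "meets T h3 h2 (\<sigma> 2) (\<sigma>' 2)" "meets T h3 (\<sigma>' 0) (\<sigma>' 3) (\<sigma> 3)"
    using assms(2) unfolding gadget_step_def by blast
  have four: "{..<4} = {0, 1, 2, 3::nat}" by auto
  have ws: "wire_start m 0 = Left (Left (Right (cA m)))" "wire_start m (Suc 0) = Left (Right (Left (cA m)))"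
    "wire_start m 2 = Right (Right (Left (cP m)))" "wire_start m 3 = Right (Left (Left (cA m)))"
    "wire_end m 0 = Right (Left (Right (cA m)))" "wire_end m (Suc 0) = Left (Right (Left (cP m)))"
    "wire_end m 2 = Right (Right (Left (cA m)))" "wire_end m 3 = Right (Left (Left (cP m)))"
    by (simp_all add: wire_start_def wire_end_def)
  have "supports p T (gadget p m) {(Left (Left (Left (cP m))), c), (Left (Left (Left (cA m))), \<lambda>_. 0),
    (Left (Left (Right (cA m))), \<sigma> 0), (Left (Right (Left (cP m))), \<sigma>' 1), (Left (Right (Left (cA m))), \<sigma> 1),
    (Right (Left (Left (cP m))), \<sigma>' 3), (Right (Left (Left (cA m))), \<sigma> 3), (Right (Left (Right (cA m))), \<sigma>' 0),
    (Right (Right (Left (cP m))), \<sigma> 2), (Right (Right (Left (cA m))), \<sigma>' 2)}"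
    unfolding gadget_def
    by (rule supports_doubleI[OF supports_double_hinge[OF T h(1,2)] supports_double_hinge[OF T h(4,3)]],
        blast, simp only: keep_insert, simp add: insert_commute)
  \<comment> \<open>The one tuple forgotten is the zero tuple at the low corner next to the
    port.\<close>
  then show ?thesis
    by (rule supports_mono) (use T in \<open>auto simp: four ws port_def\<close>)
qed

text \<open>A constant labelling need not split, but it is harmless when its tuple vanishes in a
  slot. It fills the parts of a gadget away from the port.\<close>

lemma supports_const_cube:
  assumes "\<exists>r<T. p dvd n r" "D = Suc (Suc m)"
  shows "supports p T (cube p D) {(cP m, n), (cA m, n), (cW m, n)}"
proof -
  have "cube_label D (n r) (\<lambda>_. 0) w = n r" if "w \<in> corners D" for r w
    using cube_label_eq_sum[OF that] by auto
  moreover have "cP m \<in> corners D" "cA m \<in> corners D" "cW m \<in> corners D" using assms(2) by auto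
  ultimately show ?thesis unfolding supports_def using assms(1)
    by (intro exI[of _ "\<lambda>r. cube_label D (n r) (\<lambda>_. 0)"]) (simp add: Ball_def)
qed

lemma supports_name:
  assumes "supports p T X A" "z \<in> positions X" "z \<notin> fst ` A"
  shows "\<exists>n. supports p T X (insert (z, n) A) \<and> (\<exists>r<T. p dvd n r)"
proof -
  obtain l where l: "\<forall>r<T. l r \<in> labels X" "\<forall>(z, c)\<in>A. \<forall>r<T. l r z = c r"
     "\<forall>z\<in>positions X - fst ` A. \<exists>r<T. p dvd l r z" using assms(1) unfolding supports_def by blast
  have "supports p T X (insert (z, \<lambda>r. l r z) A)"
    unfolding supports_def using l by (intro exI[of _ l]) auto
  moreover have "\<exists>r<T. p dvd l r z" using l(3) assms by blast
  ultimately show ?thesis by blast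
qed

text \<open>With one slot more than the wires use, the cube at the port is labelled as in
  \<open>low_cube\<close>. Its tuple \<open>n\<close> at the glued corner vanishes in a slot and is
  continued constantly through the rest.\<close>

lemma low_gadget: "low p (Suc (Suc m)) (gadget p m, port m)"
  unfolding low_def fst_conv snd_conv
proof
  fix c :: "nat \<Rightarrow> int"
  let ?T = "Suc (Suc m)"
  have "supports p ?T (cube p ?T) {(cP m, c)}" using low_cube[of p ?T] by (simp add: low_def)
  then obtain n where n: "supports p ?T (cube p ?T) (insert (cW m, n) {(cP m, c)})" "\<exists>r<?T. p dvd n r"
    using supports_name[of p ?T "cube p ?T" "{(cP m, c)}" "cW m"] by auto
  note K = supports_const_cube[OF n(2) refl]
  have h1: "supports p ?T (hinge p m) {(Left (cP m), c), (Right (cP m), n), (Right (cA m), n)}"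
    unfolding hinge_def by (rule supports_doubleI[OF n(1) K]) (auto simp: keep_insert)
  have h2: "supports p ?T (hinge p m) {(Left (cP m), n), (Left (cA m), n), (Right (cP m), n), (Right (cA m), n)}"
    unfolding hinge_def by (rule supports_doubleI[OF K K]) (auto simp: keep_insert)
  have g1: "supports p ?T (double_hinge p m) {(Left (Left (cP m)), c), (Left (Right (cA m)), n),
     (Right (Left (cP m)), n), (Right (Left (cA m)), n), (Right (Right (cA m)), n)}"
    unfolding double_hinge_def by (rule supports_doubleI[OF h1 h2]) (auto simp: keep_insert)
  have g2: "supports p ?T (double_hinge p m) {(Left (Left (cP m)), n), (Left (Left (cA m)), n), (Left (Right (cA m)), n),
     (Right (Left (cP m)), n), (Right (Left (cA m)), n), (Right (Right (cA m)), n)}"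
    unfolding double_hinge_def by (rule supports_doubleI[OF h2 h2]) (auto simp: keep_insert)
  show "supports p ?T (gadget p m) {(port m, c)}"
    unfolding gadget_def
    by (rule supports_mono[OF supports_double[OF g1 g2]]) (use n(2) in \<open>auto simp: port_def\<close>)
qed

lemma attachable_gadget: "attachable p (gadget p m, port m)"
proof -
  have "attachable p (cube p (Suc (Suc m)), cP m)" using attachable_cube[of p "Suc (Suc m)"] by simp
  then show ?thesis unfolding gadget_def double_hinge_def hinge_def port_def
    by (intro attachable_double) auto
qed

lemma deriv_gadget: "deriv (cube p (Suc (Suc m))) (top_corner (Suc (Suc m))) 3 (gadget p m) (port m)"
proof -
  have 1: "deriv (cube p (Suc (Suc m))) (cP m) 1 (hinge p m) (Left (cP m))"
    unfolding hinge_def by (rule deriv_double) auto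
  have 2: "deriv (hinge p m) (Left (cP m)) 1 (double_hinge p m) (Left (Left (cP m)))"
    unfolding double_hinge_def by (rule deriv_double) (auto simp: hinge_def)
  have 3: "deriv (double_hinge p m) (Left (Left (cP m))) 1 (gadget p m) (port m)"
    unfolding gadget_def port_def by (rule deriv_double) (auto simp: double_hinge_def hinge_def)
  show ?thesis using deriv_trans[OF deriv_trans[OF 1 2] 3] by (simp add: eval_nat_numeral)
qed

lemma wire_positions:
  shows "wire_start m i \<in> positions (gadget p m)" "wire_start m i \<noteq> port m"
    "wire_end m i \<in> positions (gadget p m)" "wire_end m i \<noteq> port m"
proof -
  have L: "Left z \<in> positions (double X S)" and R: "Right z \<in> positions (double X S)"
    if "z \<in> positions X" "z \<notin> S" for X S z using that by auto
  have c: "cP m \<in> positions (cube p (Suc (Suc m)))" "cA m \<in> positions (cube p (Suc (Suc m)))" by auto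
  have h: "Left (cP m) \<in> positions (hinge p m)" "Left (cA m) \<in> positions (hinge p m)"
    "Right (cA m) \<in> positions (hinge p m)"
    unfolding hinge_def by (intro L R c; simp)+
  have h2: "Left (Right (cA m)) \<in> positions (double_hinge p m)" "Left (Left (cA m)) \<in> positions (double_hinge p m)"
    "Left (Left (cP m)) \<in> positions (double_hinge p m)" "Right (Left (cA m)) \<in> positions (double_hinge p m)"
    "Right (Left (cP m)) \<in> positions (double_hinge p m)"
    unfolding double_hinge_def by (intro L R h; simp)+
  show "wire_start m i \<in> positions (gadget p m)" unfolding gadget_def wire_start_def
    by (simp del: positions_double add: L R h2)
  show "wire_end m i \<in> positions (gadget p m)" unfolding gadget_def wire_end_def
    by (simp del: positions_double add: L R h2)
qed (simp_all add: wire_start_def wire_end_def port_def)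

lemma wires_inj:
  assumes "i < 4" "k < 4"
  shows "wire_start m i = wire_start m k \<longleftrightarrow> i = k" "wire_end m i = wire_end m k \<longleftrightarrow> i = k"
    "wire_start m i \<noteq> wire_end m k"
  using assms by (simp_all add: wire_start_def wire_end_def)

subsection \<open>Multiplication in the registers\<close>

text \<open>The four wires carry the current tuple \<open>x\<close>, a duplicate \<open>d\<close> used for doubling, the accumulator \<open>f\<close> of
  a product and the counter \<open>e\<close>.\<close>

definition quad :: "'a \<Rightarrow> 'a \<Rightarrow> 'a \<Rightarrow> 'a \<Rightarrow> nat \<Rightarrow> 'a" where
  "quad x d f e i = (if i = 0 then x else if i = 1 then d else if i = 2 then f else e)"

lemma quad_simps [simp]: "quad x d f e 0 = x" "quad x d f e (Suc 0) = d" "quad x d f e 2 = f" "quad x d f e 3 = e"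
  by (simp_all add: quad_def)

abbreviation zero_label :: "nat \<Rightarrow> int" where "zero_label \<equiv> \<lambda>_. 0"

text \<open>One step into a common successor and one step back out of it, as when two consecutive
  copies of a chain are traversed; hence the symmetry.\<close>

definition moves :: "nat \<Rightarrow> ((nat \<Rightarrow> nat \<Rightarrow> int) \<times> (nat \<Rightarrow> nat \<Rightarrow> int)) set" where
  "moves T = {(\<sigma>, \<sigma>'). \<exists>\<mu>. gadget_step T \<sigma> zero_label \<mu> \<and> gadget_step T \<sigma>' zero_label \<mu>}"

lemma moves_sym: "(\<sigma>, \<sigma>') \<in> moves T \<Longrightarrow> (\<sigma>', \<sigma>) \<in> moves T"
  by (auto simp: moves_def)

lemma splits_slot:
  assumes "r < T" "P r = A r + W r" "\<And>q. q < T \<Longrightarrow> q \<noteq> r \<Longrightarrow> A q = P q \<and> W q = P q"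
  shows "splits T P A W"
  unfolding splits_def using assms by (intro exI[of _ r] conjI exI[of _ P]) auto

text \<open>If slot \<open>r\<close> is zero in all three tuples, the other slots are unrestricted.
  Thus tuples with a vanishing slot can be created and erased at will.\<close>

lemma splits_zero:
  assumes "r < T" "P r = 0" "A r = 0" "W r = 0"
  shows "splits T P A W"
  unfolding splits_def using assms by (intro exI[of _ r]) auto

lemma splits_same:
  assumes "T > 0" shows "splits T c c zero_label"
  unfolding splits_def using assms by (intro exI[of _ 0] conjI exI[of _ c]) auto

lemma splits_all:
  assumes "T > 0" shows "splits T c zero_label c"
  unfolding splits_def using assms by (intro exI[of _ 0] conjI exI[of _ c]) auto

lemma meets_same: "T > 0 \<Longrightarrow> meets T h h y y"
  unfolding meets_def using splits_same by blast

lemma meetsI: "splits T hP hA W \<Longrightarrow> splits T lP lA W \<Longrightarrow> meets T hP hA lP lA"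
  unfolding meets_def by blast

lemma gadget_step_refl: "T > 0 \<Longrightarrow> gadget_step T \<sigma> zero_label \<sigma>"
  unfolding gadget_step_def using meets_same by blast

lemma moves_refl: "T > 0 \<Longrightarrow> (\<sigma>, \<sigma>) \<in> moves T"
  unfolding moves_def using gadget_step_refl by blast

lemma gadget_step_load:
  assumes "T > 0"
  shows "gadget_step T (quad zero_label d f e) c (quad c d f e)"
  unfolding gadget_step_def
  by (rule exI[of _ c], rule exI[of _ c], rule exI[of _ c])
    (simp add: meets_same[OF assms] meetsI[OF splits_all[OF assms] splits_all[OF assms]])

lemma move_d:
  assumes "T > 0" "splits T x x' W" "splits T d' d W"
  shows "(quad x d f e, quad x' d' f e) \<in> moves T"
proof -
  have "gadget_step T (quad x d f e) zero_label (quad x' d' f e)"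
    unfolding gadget_step_def
    by (rule exI[of _ x], rule exI[of _ x'], rule exI[of _ x'])
      (simp add: meets_same[OF assms(1)] meetsI[OF assms(2,3)])
  then show ?thesis unfolding moves_def using gadget_step_refl[OF assms(1)] by blast
qed

text \<open>Wire 2 starts at a corner \<open>P\<close> and ends at a corner \<open>A\<close>,
  opposite to wires 1 and 3, so here the gadget is traversed from the primed state to the unprimed
  one.\<close>

lemma move_f:
  assumes "T > 0" "splits T x x' W" "splits T f' f W"
  shows "(quad x d f e, quad x' d f' e) \<in> moves T"
proof -
  have "gadget_step T (quad x' d f' e) zero_label (quad x d f e)"
    unfolding gadget_step_def
    by (rule exI[of _ x'], rule exI[of _ x'], rule exI[of _ x])
      (simp add: meets_same[OF assms(1)] meetsI[OF assms(2,3)])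
  then show ?thesis unfolding moves_def using gadget_step_refl[OF assms(1)] by blast
qed

lemma move_e:
  assumes "T > 0" "splits T x x' W" "splits T e' e W"
  shows "(quad x d f e, quad x' d f e') \<in> moves T"
proof -
  have "gadget_step T (quad x d f e) zero_label (quad x' d f e')"
    unfolding gadget_step_def
    by (rule exI[of _ x], rule exI[of _ x], rule exI[of _ x])
      (simp add: meets_same[OF assms(1)] meetsI[OF assms(2,3)])
  then show ?thesis unfolding moves_def using gadget_step_refl[OF assms(1)] by blast
qed

lemma relpow_Suc_left: "(x, y) \<in> R \<Longrightarrow> (y, z) \<in> R ^^ n \<Longrightarrow> (x, z) \<in> R ^^ Suc n"
  by (rule relpow_Suc_I2)

text \<open>Slot 0 holds the partial sum. Slot \<open>r\<close> is 1 and the other slots copy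
  \<open>x\<close>, so that squares relating two accumulators can split in slot 0 with all remaining
  slots equal.\<close>

definition accumulator :: "(nat \<Rightarrow> int) \<Rightarrow> nat \<Rightarrow> int \<Rightarrow> nat \<Rightarrow> int" where
  "accumulator x r s = x(0 := s, r := 1)"

text \<open>Binary multiplication: the lowest bit of \<open>x r\<close> decides whether \<open>x 0\<close> is added to the accumulator; then
  \<open>x r\<close> is halved and \<open>x 0\<close> is doubled, both through the duplicate wire.\<close>

lemma multiply_slot:
  assumes T: "T > 0" and r: "r < T" "r \<noteq> 0"
  shows "- (2 ^ b) \<le> x r \<Longrightarrow> x r < 2 ^ b \<Longrightarrow>
    (quad x zero_label (accumulator x r s) e,
     quad zero_label zero_label (accumulator x r (s + x 0 * x r)) e) \<in> moves T ^^ (3 * b + 2)"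
proof (induction b arbitrary: x s)
  case 0
  have clean: "(quad y zero_label f e, quad zero_label zero_label f e) \<in> moves T" if "y r = 0" for y f
    by (rule move_f[OF T splits_zero[OF r(1)] splits_same[OF T]]) (use that in auto)
  \<comment> \<open>Halving with rounding down ends at 0 or -1. This covers negative multipliers; a
    final -1 is removed by undoing one addition of \<open>x 0\<close>.\<close>
  consider "x r = 0" | "x r = -1" using 0 by fastforce
  then show ?case
  proof cases
    case 1
    have "(quad x zero_label (accumulator x r s) e, quad zero_label zero_label (accumulator x r s) e) \<in> moves T ^^ Suc (Suc 0)"
      by (rule relpow_Suc_left[OF moves_refl[OF T] relpow_Suc_left[OF clean[of x] relpow_0_I]]) (rule 1)
    then show ?thesis by (simp add: 1 numeral_2_eq_2 del: relpow.simps)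
  next
    case 2
    have "(quad (x(r := 0)) zero_label (accumulator x r (s - x 0)) e, quad x zero_label (accumulator x r s) e) \<in> moves T"
      by (rule move_f[OF T, where W = "x(r := 1)"]; rule splits_slot[of r] splits_slot[of 0])
        (use r T 2 in \<open>auto simp: accumulator_def\<close>)
    from relpow_Suc_left[OF moves_sym[OF this] relpow_Suc_left[OF clean[of "x(r := 0)"] relpow_0_I]]
    show ?thesis by (simp add: 2 numeral_2_eq_2 del: relpow.simps)
  qed
next
  case (Suc b)
  define g where "g = x r div 2"
  define t where "t = x r mod 2"
  have xr: "x r = 2 * g + t" and t: "t = 0 \<or> t = 1" unfolding g_def t_def by auto
  have g: "- (2 ^ b) \<le> g" "g < 2 ^ b" using Suc.prems xr t by auto
  define s' where "s' = s + t * x 0"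
  define x1 where "x1 = x(r := 2 * g)"
  define x2 where "x2 = x(r := g)"
  define x3 where "x3 = x(r := g, 0 := 2 * x 0)"
  have 1: "(quad x zero_label (accumulator x r s) e, quad x1 zero_label (accumulator x r s') e) \<in> moves T"
  proof (cases "t = 0")
    case True
    then have "x1 = x" "s' = s" using xr by (auto simp: x1_def s'_def)
    then show ?thesis using moves_refl[OF T] by simp
  next
    case False
    then have "t = 1" using t by simp
    \<comment> \<open>The shared tuple is \<open>x\<close> with slot \<open>r\<close> set to 1: in
      slot \<open>r\<close> it takes the bit from \<open>x\<close>, in slot 0 it adds
      \<open>x 0\<close> to the accumulator.\<close>
    have "splits T x x1 (x(r := 1))"
      by (rule splits_slot[of r]) (use r xr \<open>t = 1\<close> in \<open>auto simp: x1_def\<close>)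
    moreover have "splits T (accumulator x r s') (accumulator x r s) (x(r := 1))"
      by (rule splits_slot[of 0]) (use r T \<open>t = 1\<close> in \<open>auto simp: accumulator_def s'_def\<close>)
    ultimately show ?thesis by (rule move_f[OF T])
  qed
  have 2: "(quad x1 zero_label (accumulator x r s') e, quad x2 x2 (accumulator x r s') e) \<in> moves T"
  proof -
    have "splits T x1 x2 x2" by (rule splits_slot[of r]) (use r in \<open>auto simp: x1_def x2_def\<close>)
    then show ?thesis by (rule move_d[OF T _ splits_all[OF T]])
  qed
  have 3: "(quad x2 x2 (accumulator x r s') e, quad x3 zero_label (accumulator x r s') e) \<in> moves T"
  proof -
    have "splits T x3 x2 x2" by (rule splits_slot[of 0]) (use r T in \<open>auto simp: x3_def x2_def\<close>)
    then show ?thesis by (intro moves_sym[OF move_d[OF T _ splits_all[OF T]]])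
  qed
  have acc: "accumulator x3 r = accumulator x r"
    by (rule ext) (auto simp: accumulator_def x3_def fun_upd_twist)
  have "(quad x3 zero_label (accumulator x3 r s') e,
     quad zero_label zero_label (accumulator x3 r (s' + x3 0 * x3 r)) e) \<in> moves T ^^ (3 * b + 2)"
    by (rule Suc.IH) (use g r in \<open>auto simp: x3_def\<close>)
  moreover have "s' + x3 0 * x3 r = s + x 0 * x r"
    using r by (simp add: s'_def x3_def xr algebra_simps)
  ultimately have "(quad x3 zero_label (accumulator x r s') e,
     quad zero_label zero_label (accumulator x r (s + x 0 * x r)) e) \<in> moves T ^^ (3 * b + 2)"
    by (simp add: acc)
  from relpow_Suc_left[OF 1 relpow_Suc_left[OF 2 relpow_Suc_left[OF 3 this]]]
  show ?case by (simp add: numeral_3_eq_3)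
qed

lemma relpow_trans: "(x, y) \<in> R ^^ m \<Longrightarrow> (y, z) \<in> R ^^ n \<Longrightarrow> (x, z) \<in> R ^^ (m + n)"
  by (auto simp: relpow_add)

definition collapse :: "(nat \<Rightarrow> int) \<Rightarrow> nat \<Rightarrow> nat \<Rightarrow> int" where
  "collapse x n q = (if q = 0 then \<Prod>i\<le>n. x i else if q \<le> n then 1 else x q)"

text \<open>For each slot, \<open>3 * b + 2\<close> moves multiply, one creates the empty
  accumulator and one returns the product to wire 0. Slot 0 needs no bound, being only added and
  doubled.\<close>

lemma multiply_slots:
  assumes T: "T > 0" and b: "\<And>r. 0 < r \<Longrightarrow> r < T \<Longrightarrow> - (2 ^ b) \<le> x r \<and> x r < 2 ^ b"
  shows "n < T \<Longrightarrow> (quad x zero_label zero_label e, quad (collapse x n) zero_label zero_label e)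
    \<in> moves T ^^ (n * (3 * b + 4))"
proof (induction n)
  case 0
  have "collapse x 0 = x" by (rule ext) (simp add: collapse_def)
  then show ?case by simp
next
  case (Suc n)
  let ?y = "collapse x n" and ?r = "Suc n"
  let ?z = "accumulator ?y ?r (?y 0 * ?y ?r)"
  have yr: "?y ?r = x ?r" by (simp add: collapse_def)
  have z: "?z = collapse x (Suc n)"
    by (rule ext) (auto simp: accumulator_def collapse_def)
  have 1: "(quad ?y zero_label zero_label e, quad ?y zero_label (accumulator ?y ?r 0) e) \<in> moves T"
    by (rule move_f[OF T splits_same[OF T] splits_zero[OF T]]) (auto simp: accumulator_def)
  have 2: "(quad ?y zero_label (accumulator ?y ?r 0) e, quad zero_label zero_label (accumulator ?y ?r (0 + ?y 0 * ?y ?r)) e)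
    \<in> moves T ^^ (3 * b + 2)"
    by (rule multiply_slot[OF T]) (use b[of ?r] Suc.prems yr in auto)
  have 3: "(quad zero_label zero_label ?z e, quad ?z zero_label zero_label e) \<in> moves T"
    by (rule moves_sym[OF move_f[OF T splits_all[OF T] splits_all[OF T]]])
  have "(quad ?y zero_label zero_label e, quad ?z zero_label zero_label e) \<in> moves T ^^ (Suc ((3 * b + 2) + Suc 0))"
    by (rule relpow_Suc_left[OF 1 relpow_trans]) (use 2 3 in auto)
  then have "(quad ?y zero_label zero_label e, quad (collapse x (Suc n)) zero_label zero_label e) \<in> moves T ^^ (3 * b + 4)"
    by (simp add: z eval_nat_numeral del: relpow.simps)
  from relpow_trans[OF Suc.IH this] show ?case using Suc.prems by (simp add: add.commute)
qed

text \<open>It has the shape of a fully collapsed tuple, so that adding a product is a square which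
  splits in slot 0.\<close>

definition counter :: "int \<Rightarrow> nat \<Rightarrow> int" where
  "counter s r = (if r = 0 then s else 1)"

lemma multiply_accumulate:
  assumes T: "T > 0" and b: "\<And>r. 0 < r \<Longrightarrow> r < T \<Longrightarrow> - (2 ^ b) \<le> x r \<and> x r < 2 ^ b"
  shows "(quad x zero_label zero_label (counter s),
    quad zero_label zero_label zero_label (counter (s + (\<Prod>i<T. x i)))) \<in> moves T ^^ (Suc ((T - 1) * (3 * b + 4)))"
proof -
  let ?z = "collapse x (T - 1)"
  have "?z 0 = (\<Prod>i<T. x i)" using T by (auto simp: collapse_def lessThan_Suc_atMost[symmetric])
  then have "splits T (counter (s + (\<Prod>i<T. x i))) (counter s) ?z"
    by (intro splits_slot[of 0]) (use T in \<open>auto simp: counter_def collapse_def\<close>)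
  from move_e[OF T splits_all[OF T] this]
  have 1: "(quad ?z zero_label zero_label (counter s), quad zero_label zero_label zero_label (counter (s + (\<Prod>i<T. x i)))) \<in> moves T" .
  have 2: "(quad x zero_label zero_label (counter s), quad ?z zero_label zero_label (counter s)) \<in> moves T ^^ ((T - 1) * (3 * b + 4))"
    by (rule multiply_slots[OF T b]) (use T in auto)
  show ?thesis using relpow_Suc_I[OF 2 1] by simp
qed

subsection \<open>Chains of copies\<close>

lemma relpow_sym:
  assumes "\<And>x y. (x, y) \<in> R \<Longrightarrow> (y, x) \<in> R"
  shows "(x, y) \<in> R ^^ n \<Longrightarrow> (y, x) \<in> R ^^ n"
proof (induction n arbitrary: y)
  case (Suc n)
  then obtain z where "(x, z) \<in> R ^^ n" "(z, y) \<in> R" by auto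
  then show ?case using Suc.IH assms relpow_Suc_I2 by metis
qed auto

lemma relpow_mono_refl:
  assumes "\<And>x. (x, x) \<in> R" "(x, y) \<in> R ^^ m" "m \<le> n"
  shows "(x, y) \<in> R ^^ n"
  using assms(3,2)
proof (induction n rule: dec_induct)
  case (step n)
  then show ?case using assms(1) by auto
qed auto

definition passes :: "int \<Rightarrow> nat \<Rightarrow> 'w set \<Rightarrow> system \<Rightarrow> index \<Rightarrow> ('w \<Rightarrow> index) \<Rightarrow> ('w \<Rightarrow> index) \<Rightarrow>
    (nat \<Rightarrow> int) \<Rightarrow> ('w \<Rightarrow> nat \<Rightarrow> int) \<Rightarrow> ('w \<Rightarrow> nat \<Rightarrow> int) \<Rightarrow> bool" where
  "passes p T W X x st en c \<sigma> \<sigma>' \<longleftrightarrow>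
     supports p T X (insert (x, c) ((\<lambda>w. (st w, \<sigma> w)) ` W \<union> (\<lambda>w. (en w, \<sigma>' w)) ` W))"

text \<open>For copies after the first the tuple at \<open>x\<close> has to vanish in a slot, since
  their \<open>x\<close> is no longer the distinguished position.\<close>

definition passable :: "int \<Rightarrow> nat \<Rightarrow> 'w set \<Rightarrow> system \<Rightarrow> index \<Rightarrow> ('w \<Rightarrow> index) \<Rightarrow> ('w \<Rightarrow> index) \<Rightarrow>
    (('w \<Rightarrow> nat \<Rightarrow> int) \<times> ('w \<Rightarrow> nat \<Rightarrow> int)) set" where
  "passable p T W X x st en = {(\<sigma>, \<sigma>'). \<exists>c. (\<exists>r<T. p dvd c r) \<and> passes p T W X x st en c \<sigma> \<sigma>'}"

definition wired :: "'w set \<Rightarrow> system \<Rightarrow> index \<Rightarrow> ('w \<Rightarrow> index) \<Rightarrow> ('w \<Rightarrow> index) \<Rightarrow> bool" where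
  "wired W X x st en \<longleftrightarrow> x \<in> positions X \<and> st ` W \<subseteq> positions X \<and> en ` W \<subseteq> positions X \<and>
     x \<notin> st ` W \<and> x \<notin> en ` W \<and> st ` W \<inter> en ` W = {}"

text \<open>The second copy is joined end to end and hence traversed backwards; this is why steps have to be
  reversible.\<close>

lemma chain_step:
  assumes "wired W X x st en"
  shows "\<exists>Y y st' en'. deriv X x 1 Y y \<and> wired W Y y st' en' \<and>
    (\<forall>c \<sigma> \<mu> \<sigma>'. passes p T W X x st en c \<sigma> \<mu> \<longrightarrow> (\<sigma>', \<mu>) \<in> passable p T W X x st en \<longrightarrow>
      passes p T W Y y st' en' c \<sigma> \<sigma>')"
proof (intro exI conjI allI impI)
  have w: "x \<in> positions X" "st ` W \<subseteq> positions X" "en ` W \<subseteq> positions X"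
    "x \<notin> st ` W" "x \<notin> en ` W" "\<And>v w. v \<in> W \<Longrightarrow> w \<in> W \<Longrightarrow> st v \<noteq> en w"
    using assms unfolding wired_def by auto
  show "deriv X x 1 (double X (en ` W)) (Left x)" by (rule deriv_double) (use w in auto)
  show "wired W (double X (en ` W)) (Left x) (\<lambda>w. Left (st w)) (\<lambda>w. Right (st w))"
  proof -
    have "st w \<in> positions X - en ` W" if "w \<in> W" for w using that w(2) w(6)[OF that] by auto
    then show ?thesis unfolding wired_def using w(1,4,5) by auto
  qed
  fix c \<sigma> \<mu> \<sigma>'
  assume "passes p T W X x st en c \<sigma> \<mu>" "(\<sigma>', \<mu>) \<in> passable p T W X x st en"
  then obtain c' where 1: "supports p T X (insert (x, c) ((\<lambda>w. (st w, \<sigma> w)) ` W \<union> (\<lambda>w. (en w, \<mu> w)) ` W))"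
    and 2: "supports p T X (insert (x, c') ((\<lambda>w. (st w, \<sigma>' w)) ` W \<union> (\<lambda>w. (en w, \<mu> w)) ` W))"
    and c': "\<exists>r<T. p dvd c' r"
    unfolding passes_def passable_def by auto
  let ?A = "insert (x, c) ((\<lambda>w. (st w, \<sigma> w)) ` W \<union> (\<lambda>w. (en w, \<mu> w)) ` W)"
  let ?B = "insert (x, c') ((\<lambda>w. (st w, \<sigma>' w)) ` W \<union> (\<lambda>w. (en w, \<mu> w)) ` W)"
  have A: "{u \<in> ?A. fst u \<notin> en ` W} = insert (x, c) ((\<lambda>w. (st w, \<sigma> w)) ` W)"
    using w by auto
  have B: "{u \<in> ?B. fst u \<notin> en ` W} = insert (x, c') ((\<lambda>w. (st w, \<sigma>' w)) ` W)"
    using w by auto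
  have "supports p T (double X (en ` W)) ((\<lambda>(z, c). (Left z, c)) ` {u \<in> ?A. fst u \<notin> en ` W} \<union>
      (\<lambda>(z, c). (Right z, c)) ` {u \<in> ?B. fst u \<notin> en ` W})"
    by (rule supports_double[OF 1 2]) blast
  then have 3: "supports p T (double X (en ` W)) ((\<lambda>(z, c). (Left z, c)) ` insert (x, c) ((\<lambda>w. (st w, \<sigma> w)) ` W) \<union>
      (\<lambda>(z, c). (Right z, c)) ` insert (x, c') ((\<lambda>w. (st w, \<sigma>' w)) ` W))"
    unfolding A B .
  show "passes p T W (double X (en ` W)) (Left x) (\<lambda>w. Left (st w)) (\<lambda>w. Right (st w)) c \<sigma> \<sigma>'"
    unfolding passes_def
    by (rule supports_mono[OF 3]) (use c' in auto)
qed

text \<open>Each joining squares the relation realised between the two ends. The first copy is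
  traced separately because its tuple at \<open>x\<close> has to survive, which leaves
  \<open>2^n - 1\<close> further steps.\<close>

lemma iterated_chain:
  assumes "wired W X x st en" and R: "\<And>\<sigma> \<sigma>'. (\<sigma>, \<sigma>') \<in> R \<Longrightarrow> (\<sigma>', \<sigma>) \<in> R"
    and RQ: "R \<subseteq> passable p T W X x st en"
  shows "\<exists>Y y st' en'. deriv X x n Y y \<and> wired W Y y st' en' \<and>
    R ^^ (2 ^ n) \<subseteq> passable p T W Y y st' en' \<and>
    (\<forall>c \<sigma> \<mu> \<sigma>'. passes p T W X x st en c \<sigma> \<mu> \<longrightarrow> (\<mu>, \<sigma>') \<in> R ^^ (2 ^ n - 1) \<longrightarrow>
      passes p T W Y y st' en' c \<sigma> \<sigma>')"
proof (induction n)
  case 0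
  have "deriv X x 0 X x" using assms(1) by (intro deriv_refl) (simp add: wired_def)
  then show ?case using assms by (intro exI[of _ X] exI[of _ x] exI[of _ st] exI[of _ en]) auto
next
  case (Suc n)
  obtain Y y s e where Y: "deriv X x n Y y" "wired W Y y s e" "R ^^ (2 ^ n) \<subseteq> passable p T W Y y s e"
    "\<forall>c \<sigma> \<mu> \<sigma>'. passes p T W X x st en c \<sigma> \<mu> \<longrightarrow> (\<mu>, \<sigma>') \<in> R ^^ (2 ^ n - 1) \<longrightarrow> passes p T W Y y s e c \<sigma> \<sigma>'"
    using Suc.IH by metis
  obtain Z z s' e' where Z: "deriv Y y 1 Z z" "wired W Z z s' e'"
    "\<forall>c \<sigma> \<mu> \<sigma>'. passes p T W Y y s e c \<sigma> \<mu> \<longrightarrow> (\<sigma>', \<mu>) \<in> passable p T W Y y s e \<longrightarrow> passes p T W Z z s' e' c \<sigma> \<sigma>'"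
    using chain_step[OF Y(2), of p T] by metis
  have sym: "(b, a) \<in> R ^^ k" if "(a, b) \<in> R ^^ k" for a b k using relpow_sym[OF R that] .
  have "(a, b) \<in> passable p T W Z z s' e'" if "(a, b) \<in> R ^^ (2 ^ Suc n)" for a b
  proof -
    have "(a, b) \<in> R ^^ (2 ^ n) O R ^^ (2 ^ n)" using that by (simp add: relpow_add[symmetric] mult_2)
    then obtain m where m: "(a, m) \<in> R ^^ (2 ^ n)" "(m, b) \<in> R ^^ (2 ^ n)" by blast
    then have "(a, m) \<in> passable p T W Y y s e" "(b, m) \<in> passable p T W Y y s e" using Y(3) sym by blast+
    then show ?thesis using Z(3) unfolding passable_def by blast
  qed
  moreover have "passes p T W Z z s' e' c \<sigma> \<sigma>'"
    if P: "passes p T W X x st en c \<sigma> \<mu>" "(\<mu>, \<sigma>') \<in> R ^^ (2 ^ Suc n - 1)" for c \<sigma> \<mu> \<sigma>'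
  proof -
    have "(2::nat) ^ Suc n - 1 = (2 ^ n - 1) + 2 ^ n" by simp
    then have "(\<mu>, \<sigma>') \<in> R ^^ (2 ^ n - 1) O R ^^ (2 ^ n)" using P(2) by (metis relpow_add)
    then obtain m where m: "(\<mu>, m) \<in> R ^^ (2 ^ n - 1)" "(m, \<sigma>') \<in> R ^^ (2 ^ n)" by blast
    then show ?thesis using Z(3) Y(3,4) P(1) sym by blast
  qed
  moreover have "deriv X x (Suc n) Z z" using deriv_trans[OF Y(1) Z(1)] by simp
  ultimately show ?case using Z(2) by (intro exI[of _ Z] exI[of _ z] exI[of _ s'] exI[of _ e']) auto
qed

lemma supports_raw: "supports p T (fst (raw p)) (insert (snd (raw p), c) {(Num 1, c)})"
  unfolding supports_def by (intro exI[of _ "\<lambda>r _. c r"]) (auto simp: raw_def)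

text \<open>The terms of the relation are loaded one after another: \<open>w1\<close> in the first
  copy, where \<open>j\<close> is the distinguished position, and each member of \<open>ws\<close>
  in a later copy, where its vanishing slot at \<open>j\<close> lets it pass. The counters run from
  0 to the total.\<close>

lemma chain_control:
  assumes T: "T = Suc m" and p: "prime p" and B: "mod_subspace p K B"
    and j: "j \<in> K" "\<Sigma> j = raw p"
    and \<Sigma>: "\<And>q. q \<in> K - {j} \<Longrightarrow> \<Sigma> q = (gadget p m, port m) \<or> low p T (\<Sigma> q)"
    and w1: "\<And>r. r < T \<Longrightarrow> w1 r \<in> B" "\<And>r. r < T \<Longrightarrow> \<not> p dvd w1 r j"
      "\<And>r q. 0 < r \<Longrightarrow> r < T \<Longrightarrow> q \<in> K \<Longrightarrow> - (2 ^ b) \<le> w1 r q \<and> w1 r q < 2 ^ b"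
    and ws: "\<And>w r. w \<in> set ws \<Longrightarrow> r < T \<Longrightarrow> w r \<in> B" "\<And>w. w \<in> set ws \<Longrightarrow> \<exists>r<T. p dvd w r j"
      "\<And>w r q. w \<in> set ws \<Longrightarrow> 0 < r \<Longrightarrow> r < T \<Longrightarrow> q \<in> K \<Longrightarrow> - (2 ^ b) \<le> w r q \<and> w r q < 2 ^ b"
    and sum: "\<And>q. q \<in> K - {j} \<Longrightarrow> p dvd (\<Sum>w\<leftarrow>w1 # ws. \<Prod>r<T. w r q)"
    and n: "Suc (length ws) * (T * (3 * b + 4)) < 2 ^ n"
  shows "\<exists>Y y. deriv (attach K B \<Sigma>) (tag j (Num 1)) (Suc n) Y y \<and> controlled p T Y y"
proof -
  have T0: "T > 0" using T by simp
  \<comment> \<open>Only gadgets have registers; attachments of level \<open>T\<close> annihilate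
    themselves in every copy, whatever is loaded.\<close>
  define G where "G = {q \<in> K - {j}. \<Sigma> q = (gadget p m, port m)}"
  define W where "W = G \<times> {..<4::nat}"
  define st where "st = (\<lambda>(q, i). tag q (wire_start m i))"
  define en where "en = (\<lambda>(q, i). tag q (wire_end m i))"
  let ?X = "attach K B \<Sigma>" and ?x = "tag j (Num 1)"
  have G: "q \<in> K" "q \<noteq> j" "\<Sigma> q = (gadget p m, port m)" if "q \<in> G" for q
    using that by (auto simp: G_def)
  have wired: "wired W ?X ?x st en"
    unfolding wired_def
  proof (intro conjI subsetI)
    show "?x \<in> positions ?X" using j by (simp add: raw_def)
  next
    fix u assume "u \<in> st ` W"
    then obtain q i where "q \<in> G" "u = tag q (wire_start m i)" by (auto simp: W_def st_def)
    then show "u \<in> positions ?X" using G[of q] wire_positions(1,2)[of m i] by simp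
  next
    fix u assume "u \<in> en ` W"
    then obtain q i where "q \<in> G" "u = tag q (wire_end m i)" by (auto simp: W_def en_def)
    then show "u \<in> positions ?X" using G[of q] wire_positions(3,4)[of m i] by simp
  next
    show "?x \<notin> st ` W" "?x \<notin> en ` W" using G(2)[of j] by (auto simp: W_def st_def en_def)
    show "st ` W \<inter> en ` W = {}" using wires_inj(3) by (auto simp: W_def st_def en_def)
  qed
  have pass: "passes p T W ?X ?x st en (\<lambda>r. w r j) (\<lambda>(q, i). \<sigma> q i) (\<lambda>(q, i). \<sigma>' q i)"
    if w: "\<And>r. r < T \<Longrightarrow> w r \<in> B" and g: "\<And>q. q \<in> G \<Longrightarrow> gadget_step T (\<sigma> q) (\<lambda>r. w r q) (\<sigma>' q)" for w \<sigma> \<sigma>'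
  proof -
    define A where "A q = (if q = j then {(Num 1, \<lambda>r. w r j)} else if q \<in> G then
      (\<lambda>i. (wire_start m i, \<sigma> q i)) ` {..<4} \<union> (\<lambda>i. (wire_end m i, \<sigma>' q i)) ` {..<4} else {})" for q
    have "supports p T ?X (\<Union>q\<in>K. (\<lambda>(z, c). (tag q z, c)) ` A q)"
    proof (rule supports_attach[of K p T \<Sigma> w])
      fix q assume q: "q \<in> K"
      consider "q = j" | "q \<in> G" "q \<noteq> j" | "q \<noteq> j" "q \<notin> G" by blast
      then show "supports p T (fst (\<Sigma> q)) (insert (snd (\<Sigma> q), \<lambda>r. w r q) (A q))"
      proof cases
        case 1 then show ?thesis using supports_raw j by (simp add: A_def)
      next
        case 2
        then have "\<Sigma> q = (gadget p m, port m)" by (simp add: G_def)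
        then show ?thesis using supports_gadget[OF T g[OF 2(1)], of p] 2 by (simp add: A_def)
      next
        case 3
        then have "low p T (\<Sigma> q)" using \<Sigma>[of q] q by (auto simp: G_def)
        then show ?thesis using 3 by (simp add: A_def low_def)
      qed
    next
      fix q z c assume "q \<in> K" "(z, c) \<in> A q"
      then show "z \<in> positions (fst (\<Sigma> q)) - {snd (\<Sigma> q)}"
        using j G(3) wire_positions by (cases "q = j") (auto simp: A_def raw_def split: if_splits)
    qed (rule w)
    moreover have "(\<Union>q\<in>K. (\<lambda>(z, c). (tag q z, c)) ` A q) = insert (?x, \<lambda>r. w r j)
      ((\<lambda>v. (st v, (\<lambda>(q, i). \<sigma> q i) v)) ` W \<union> (\<lambda>v. (en v, (\<lambda>(q, i). \<sigma>' q i) v)) ` W)" (is "?L = ?R")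
    proof (intro equalityI subsetI)
      fix u assume "u \<in> ?L"
      then obtain q z c where u: "q \<in> K" "(z, c) \<in> A q" "u = (tag q z, c)" by auto
      then consider "q = j" | "q \<noteq> j" "q \<in> G" by (auto simp: A_def split: if_splits)
      then show "u \<in> ?R"
      proof cases
        case 1 then show ?thesis using u by (simp add: A_def)
      next
        case 2
        then obtain i where "i < 4" "(z, c) = (wire_start m i, \<sigma> q i) \<or> (z, c) = (wire_end m i, \<sigma>' q i)"
          using u(2) by (auto simp: A_def)
        then show ?thesis using 2 u(3) by (auto simp: W_def st_def en_def intro!: image_eqI[of _ _ "(q, i)"])
      qed
    next
      fix u assume "u \<in> ?R"
      then consider "u = (?x, \<lambda>r. w r j)" | q i where "q \<in> G" "i < 4" "u = (tag q (wire_start m i), \<sigma> q i)"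
        | q i where "q \<in> G" "i < 4" "u = (tag q (wire_end m i), \<sigma>' q i)"
        by (auto simp: W_def st_def en_def)
      then show "u \<in> ?L"
      proof cases
        case 1 then show ?thesis using j by (intro UN_I[of j]) (simp_all add: A_def)
      next
        case 2
        then have "(wire_start m i, \<sigma> q i) \<in> A q" using G(2) by (auto simp: A_def)
        then show ?thesis using 2 G(1) by (intro UN_I[of q]) (auto intro!: image_eqI[of _ _ "(wire_start m i, \<sigma> q i)"])
      next
        case 3
        then have "(wire_end m i, \<sigma>' q i) \<in> A q" using G(2) by (auto simp: A_def)
        then show ?thesis using 3 G(1) by (intro UN_I[of q]) (auto intro!: image_eqI[of _ _ "(wire_end m i, \<sigma>' q i)"])
      qed
    qed
    ultimately show ?thesis unfolding passes_def by simp
  qed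
  define Q where "Q = passable p T W ?X ?x st en"
  \<comment> \<open>A single copy gives the relation \<open>Q\<close>, which need not be symmetric.
    One preliminary joining replaces it by \<open>R\<close>; this is the extra joining in
    \<open>Suc n\<close>.\<close>
  define R where "R = Q O Q\<inverse>"
  obtain a0 where "a0 \<in> B" using B unfolding mod_subspace_def by (metis ex_in_conv)
  from mod_subspace_scale[OF B this, of 0] have zero: "(\<lambda>_. 0) \<in> B" by simp
  have Qstep: "((\<lambda>(q, i). \<sigma> q i), (\<lambda>(q, i). \<sigma>' q i)) \<in> Q"
    if "\<And>r. r < T \<Longrightarrow> w r \<in> B" "\<exists>r<T. p dvd w r j" "\<And>q. q \<in> G \<Longrightarrow> gadget_step T (\<sigma> q) (\<lambda>r. w r q) (\<sigma>' q)" for w \<sigma> \<sigma>'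
  proof -
    have "passes p T W ?X ?x st en (\<lambda>r. w r j) (\<lambda>(q, i). \<sigma> q i) (\<lambda>(q, i). \<sigma>' q i)"
      by (rule pass) (use that in auto)
    then show ?thesis using that(2) unfolding Q_def passable_def mem_Collect_eq case_prod_conv by (intro exI[of _ "\<lambda>r. w r j"] conjI)
  qed
  \<comment> \<open>A step that loads nothing: the base labelling is 0 in every slot.\<close>
  have Q0: "((\<lambda>(q, i). \<sigma> q i), (\<lambda>(q, i). \<sigma>' q i)) \<in> Q"
    if "\<And>q. q \<in> G \<Longrightarrow> gadget_step T (\<sigma> q) zero_label (\<sigma>' q)" for \<sigma> \<sigma>'
    by (rule Qstep[of "\<lambda>_ _. 0"]) (use zero T0 that in auto)
  have Qrefl: "(\<sigma>, \<sigma>) \<in> Q" for \<sigma>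
    using Q0[of "curry \<sigma>" "curry \<sigma>", OF gadget_step_refl[OF T0]] by (simp only: case_prod_curry)
  have QR: "(\<sigma>, \<sigma>') \<in> R" if "(\<sigma>, \<sigma>') \<in> Q" for \<sigma> \<sigma>' using that Qrefl unfolding R_def by blast
  have Rrefl: "(\<sigma>, \<sigma>) \<in> R" for \<sigma> using QR Qrefl by blast
  have Rsym: "(\<sigma>', \<sigma>) \<in> R" if "(\<sigma>, \<sigma>') \<in> R" for \<sigma> \<sigma>' using that unfolding R_def by blast
  have Rmoves: "((\<lambda>(q, i). \<sigma> q i), (\<lambda>(q, i). \<sigma>' q i)) \<in> R"
    if "\<And>q. (\<sigma> q, \<sigma>' q) \<in> moves T" for \<sigma> \<sigma>'
  proof -
    have "\<forall>q. \<exists>\<mu>. gadget_step T (\<sigma> q) zero_label \<mu> \<and> gadget_step T (\<sigma>' q) zero_label \<mu>"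
      using that by (auto simp: moves_def)
    then obtain \<mu> where "\<And>q. gadget_step T (\<sigma> q) zero_label (\<mu> q)" "\<And>q. gadget_step T (\<sigma>' q) zero_label (\<mu> q)"
      by metis
    then show ?thesis unfolding R_def using Q0[of \<sigma> \<mu>] Q0[of \<sigma>' \<mu>] by blast
  qed
  \<comment> \<open>The registers at different forms work in parallel, so all of them must take the
    same number of moves.\<close>
  have Rmoves_pow: "((\<lambda>(q, i). \<sigma> q i), (\<lambda>(q, i). \<sigma>' q i)) \<in> R ^^ k"
    if "\<forall>q. (\<sigma> q, \<sigma>' q) \<in> moves T ^^ k" for k \<sigma> \<sigma>'
    using that
  proof (induction k arbitrary: \<sigma>')
    case 0
    then have "\<sigma> = \<sigma>'" by auto
    then show ?case by simp
  next
    case (Suc k)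
    have "\<forall>q. \<exists>\<mu>. (\<sigma> q, \<mu>) \<in> moves T ^^ k \<and> (\<mu>, \<sigma>' q) \<in> moves T" using Suc.prems by auto
    then obtain \<mu> where \<mu>: "\<forall>q. (\<sigma> q, \<mu> q) \<in> moves T ^^ k" "\<And>q. (\<mu> q, \<sigma>' q) \<in> moves T" by metis
    show ?case using Suc.IH[OF \<mu>(1)] Rmoves[OF \<mu>(2)] by auto
  qed
  define idle where "idle s q = (if q \<in> G then quad zero_label zero_label zero_label (counter (s q))
    else quad zero_label zero_label zero_label zero_label)" for s :: "nat \<Rightarrow> int" and q
  define loaded where "loaded w s q = (if q \<in> G then quad (\<lambda>r. w r q) zero_label zero_label (counter (s q))
    else quad zero_label zero_label zero_label zero_label)" for w :: "nat \<Rightarrow> nat \<Rightarrow> int" and s :: "nat \<Rightarrow> int" and q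
  define full where "full \<sigma> = (\<lambda>(q, i). \<sigma> q i)" for \<sigma> :: "nat \<Rightarrow> nat \<Rightarrow> nat \<Rightarrow> int"
  define L where "L = Suc ((T - 1) * (3 * b + 4))"
  have load: "gadget_step T (idle s q) (\<lambda>r. w r q) (loaded w s q)" if "q \<in> G" for q s w
    using that gadget_step_load[OF T0] by (simp add: idle_def loaded_def)
  have run: "(full (loaded w s), full (idle (\<lambda>q. s q + (\<Prod>r<T. w r q)))) \<in> R ^^ L"
    if w: "\<And>r q. 0 < r \<Longrightarrow> r < T \<Longrightarrow> q \<in> K \<Longrightarrow> - (2 ^ b) \<le> w r q \<and> w r q < 2 ^ b" for w s
    unfolding full_def
  proof (rule Rmoves_pow, rule allI)
    fix q
    show "(loaded w s q, idle (\<lambda>q. s q + (\<Prod>r<T. w r q)) q) \<in> moves T ^^ L"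
    proof (cases "q \<in> G")
      case True
      then have "q \<in> K" by (simp add: G_def)
      then show ?thesis unfolding L_def
        using multiply_accumulate[OF T0, of b "\<lambda>r. w r q" "s q"] w[of _ q] True
        by (simp add: idle_def loaded_def del: relpow.simps)
    next
      case False
      then have "loaded w s q = idle (\<lambda>q. s q + (\<Prod>r<T. w r q)) q" by (simp add: idle_def loaded_def)
      then show ?thesis using relpow_mono_refl[OF moves_refl[OF T0] relpow_0_I] by simp
    qed
  qed
  have runs: "(full (idle s), full (idle (\<lambda>q. s q + (\<Sum>w\<leftarrow>vs. \<Prod>r<T. w r q)))) \<in> R ^^ (length vs * Suc L)"
    if "set vs \<subseteq> set ws" for vs s
    using that
  proof (induction vs arbitrary: s)
    case (Cons v vs)
    have v: "v \<in> set ws" using Cons.prems by simp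
    have "(full (idle s), full (loaded v s)) \<in> R"
      unfolding full_def by (rule QR, rule Qstep[of v]) (use ws v load in auto)
    moreover have "(full (loaded v s), full (idle (\<lambda>q. s q + (\<Prod>r<T. v r q)))) \<in> R ^^ L"
      by (rule run) (use ws(3) v in auto)
    ultimately have 1: "(full (idle s), full (idle (\<lambda>q. s q + (\<Prod>r<T. v r q)))) \<in> R ^^ Suc L"
      by (rule relpow_Suc_left)
    have 2: "(full (idle (\<lambda>q. s q + (\<Prod>r<T. v r q))),
      full (idle (\<lambda>q. s q + (\<Prod>r<T. v r q) + (\<Sum>w\<leftarrow>vs. \<Prod>r<T. w r q)))) \<in> R ^^ (length vs * Suc L)"
      using Cons.IH[of "\<lambda>q. s q + (\<Prod>r<T. v r q)"] Cons.prems by simp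
    show ?case using relpow_trans[OF 1 2] by (simp add: add.assoc add.left_commute del: relpow.simps)
  qed simp
  define fin where "fin = idle (\<lambda>q. \<Sum>w\<leftarrow>w1 # ws. \<Prod>r<T. w r q)"
  have "(full (loaded w1 (\<lambda>_. 0)), full fin) \<in> R ^^ (L + length ws * Suc L)"
    using relpow_trans[OF run[where w = w1 and s = "\<lambda>_. 0", OF w1(3)] runs[OF order.refl]]
    by (simp add: fin_def del: relpow.simps)
  moreover have "L + length ws * Suc L \<le> 2 ^ n - 1"
  proof -
    have "Suc L \<le> T * (3 * b + 4)" unfolding L_def T by simp
    then have "Suc (length ws) * Suc L \<le> Suc (length ws) * (T * (3 * b + 4))" by (rule mult_le_mono2)
    then have "Suc (length ws) * Suc L < 2 ^ n" using n by linarith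
    then show ?thesis by simp
  qed
  ultimately have reach: "(full (loaded w1 (\<lambda>_. 0)), full fin) \<in> R ^^ (2 ^ n - 1)"
    using relpow_mono_refl[OF Rrefl] by blast
  have first: "passes p T W ?X ?x st en (\<lambda>r. w1 r j) (full (idle (\<lambda>_. 0))) (full (loaded w1 (\<lambda>_. 0)))"
    unfolding full_def by (rule pass) (use w1 load in auto)
  obtain Y y s e where Y: "deriv ?X ?x 1 Y y" "wired W Y y s e"
    "\<forall>c \<sigma> \<mu> \<sigma>'. passes p T W ?X ?x st en c \<sigma> \<mu> \<longrightarrow> (\<sigma>', \<mu>) \<in> Q \<longrightarrow> passes p T W Y y s e c \<sigma> \<sigma>'"
    using chain_step[OF wired, of p T] unfolding Q_def by metis
  have "R \<subseteq> passable p T W Y y s e"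
  proof (rule subrelI)
    fix \<sigma> \<sigma>' assume "(\<sigma>, \<sigma>') \<in> R"
    then obtain \<mu> where "(\<sigma>, \<mu>) \<in> Q" "(\<sigma>', \<mu>) \<in> Q" unfolding R_def by blast
    then show "(\<sigma>, \<sigma>') \<in> passable p T W Y y s e" using Y(3) unfolding Q_def passable_def by blast
  qed
  then obtain Z z s' e' where Z: "deriv Y y n Z z" "wired W Z z s' e'"
    "\<forall>c \<sigma> \<mu> \<sigma>'. passes p T W Y y s e c \<sigma> \<mu> \<longrightarrow> (\<mu>, \<sigma>') \<in> R ^^ (2 ^ n - 1) \<longrightarrow> passes p T W Z z s' e' c \<sigma> \<sigma>'"
    using iterated_chain[OF Y(2), of R p T n] Rsym by metis
  have "passes p T W Y y s e (\<lambda>r. w1 r j) (full (idle (\<lambda>_. 0))) (full (loaded w1 (\<lambda>_. 0)))"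
    using Y(3) first Qrefl by blast
  then have "passes p T W Z z s' e' (\<lambda>r. w1 r j) (full (idle (\<lambda>_. 0))) (full fin)"
    using Z(3) reach by blast
  then have sup: "supports p T Z (insert (z, \<lambda>r. w1 r j)
    ((\<lambda>w. (s' w, full (idle (\<lambda>_. 0)) w)) ` W \<union> (\<lambda>w. (e' w, full fin w)) ` W))"
    unfolding passes_def .
  \<comment> \<open>Wires at rest carry zero tuples or a counter, and a counter vanishes in slot 0
    when its content is divisible by \<open>p\<close>.\<close>
  have good: "\<exists>r<T. p dvd idle s q i r" if "q \<in> G \<Longrightarrow> p dvd s q" for s q i
    using that T0 by (intro exI[of _ 0]) (auto simp: idle_def quad_def counter_def)
  have g1: "\<exists>r<T. p dvd full (idle (\<lambda>_. 0)) w r" for w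
    using good[of "fst w" "\<lambda>_. 0" "snd w"] by (simp add: full_def split_beta)
  have g2: "\<exists>r<T. p dvd full fin w r" for w
    using good[of "fst w" "\<lambda>q. \<Sum>w\<leftarrow>w1 # ws. \<Prod>r<T. w r q" "snd w"] sum G(1,2)
    by (simp add: full_def fin_def split_beta)
  have "supports p T Z {(z, \<lambda>r. w1 r j)}"
  proof (rule supports_mono[OF sup])
    fix v c assume "(v, c) \<in> insert (z, \<lambda>r. w1 r j)
      ((\<lambda>w. (s' w, full (idle (\<lambda>_. 0)) w)) ` W \<union> (\<lambda>w. (e' w, full fin w)) ` W)"
      "(v, c) \<notin> {(z, \<lambda>r. w1 r j)}"
    then consider w where "c = full (idle (\<lambda>_. 0)) w" | w where "c = full fin w" by fast
    then show "\<exists>r<T. p dvd c r" using g1 g2 by cases simp_all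
  qed simp
  then have "controlled p T Z z" using Z(2) w1(2) unfolding controlled_def wired_def by auto
  moreover have "deriv ?X ?x (Suc n) Z z" using deriv_trans[OF Y(1) Z(1)] by simp
  ultimately show ?thesis by blast
qed

subsection \<open>Relations between tensor powers\<close>

definition combination :: "(int \<times> 'x) list \<Rightarrow> ('x \<Rightarrow> int) \<Rightarrow> int" where
  "combination ts f = (\<Sum>(c, x)\<leftarrow>ts. c * f x)"

lemma combination_simps [simp]:
  "combination [] f = 0" "combination ((c, x) # ts) f = c * f x + combination ts f"
  "combination (ts @ us) f = combination ts f + combination us f"
  by (simp_all add: combination_def)

lemma combination_scale: "combination (map (\<lambda>(c, x). (u * c, x)) ts) f = u * combination ts f"
  by (induction ts) (auto simp: algebra_simps)

lemma combination_diff: "combination ts (\<lambda>x. u * f x - s * g x) = u * combination ts f - s * combination ts g"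
  by (induction ts) (auto simp: algebra_simps)

text \<open>Elimination of one \<open>j\<close> at a time at most doubles the number of terms.\<close>

lemma annihilating_combination:
  assumes "finite J" and p: "prime (p::int)"
    and "\<not> (\<exists>c. \<forall>x\<in>X. [\<delta> x = (\<Sum>q\<in>J. c q * A q x)] (mod p))"
  shows "\<exists>ts. snd ` set ts \<subseteq> X \<and> length ts \<le> 2 ^ card J \<and> (\<forall>q\<in>J. p dvd combination ts (A q)) \<and>
    \<not> p dvd combination ts \<delta>"
  using assms(1,3)
proof (induction J arbitrary: \<delta> rule: finite_induct)
  case empty
  then obtain x where "x \<in> X" "\<not> p dvd \<delta> x" by (auto simp: cong_0_iff)
  then show ?case by (intro exI[of _ "[(1, x)]"]) auto
next
  case (insert j J)
  have ext: "(\<Sum>q\<in>insert j J. (c(j := t)) q * A q x) = t * A j x + (\<Sum>q\<in>J. c q * A q x)" for c t x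
    using insert.hyps by (auto intro: sum.cong)
  have "\<not> (\<exists>c. \<forall>x\<in>X. [\<delta> x = (\<Sum>q\<in>J. c q * A q x)] (mod p))"
  proof
    assume "\<exists>c. \<forall>x\<in>X. [\<delta> x = (\<Sum>q\<in>J. c q * A q x)] (mod p)"
    then obtain c where "\<forall>x\<in>X. [\<delta> x = (\<Sum>q\<in>J. c q * A q x)] (mod p)" ..
    then have "\<forall>x\<in>X. [\<delta> x = (\<Sum>q\<in>insert j J. (c(j := 0)) q * A q x)] (mod p)" by (simp only: ext) simp
    then show False using insert.prems by blast
  qed
  from insert.IH[OF this] obtain ts where ts: "snd ` set ts \<subseteq> X" "length ts \<le> 2 ^ card J"
    "\<forall>q\<in>J. p dvd combination ts (A q)" "\<not> p dvd combination ts \<delta>" by blast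
  show ?case
  proof (cases "p dvd combination ts (A j)")
    case True
    have "length ts \<le> 2 ^ card (insert j J)" using ts(2) insert.hyps by simp
    then show ?thesis using ts True by (intro exI[of _ ts]) auto
  next
    case False
    define u where "u = combination ts (A j)"
    define s where "s = combination ts \<delta>"
    obtain v where v: "[v * u = 1] (mod p)" using ex_inverse_mod[OF p] False unfolding u_def by blast
    \<comment> \<open>When \<open>ts\<close> fails at \<open>j\<close>, \<open>\<delta>\<close> is
      replaced by \<open>u * \<delta> - s * A j\<close>, which \<open>ts\<close> annihilates. As
      \<open>u\<close> is invertible, this function is not a combination over \<open>J\<close>
      either.\<close>
    have "\<not> (\<exists>c. \<forall>x\<in>X. [u * \<delta> x - s * A j x = (\<Sum>q\<in>J. c q * A q x)] (mod p))"
    proof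
      assume "\<exists>c. \<forall>x\<in>X. [u * \<delta> x - s * A j x = (\<Sum>q\<in>J. c q * A q x)] (mod p)"
      then obtain c where c: "\<forall>x\<in>X. [u * \<delta> x - s * A j x = (\<Sum>q\<in>J. c q * A q x)] (mod p)" ..
      have "[\<delta> x = (\<Sum>q\<in>insert j J. ((\<lambda>q. v * c q)(j := v * s)) q * A q x)] (mod p)" if "x \<in> X" for x
      proof -
        have "[v * (u * \<delta> x - s * A j x) + v * s * A j x = v * (\<Sum>q\<in>J. c q * A q x) + v * s * A j x] (mod p)"
          using bspec[OF c that] by (intro cong_add cong_scalar_left) auto
        moreover have "v * (u * \<delta> x - s * A j x) + v * s * A j x = (v * u) * \<delta> x" by (simp add: algebra_simps)
        moreover have "[(v * u) * \<delta> x = 1 * \<delta> x] (mod p)" using v by (rule cong_scalar_right)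
        ultimately have "[\<delta> x = v * (\<Sum>q\<in>J. c q * A q x) + v * s * A j x] (mod p)"
          by (metis cong_sym cong_trans mult_1)
        then show ?thesis by (simp only: ext) (simp add: sum_distrib_left mult.assoc add.commute)
      qed
      then show False using insert.prems by blast
    qed
    from insert.IH[OF this] obtain us where us: "snd ` set us \<subseteq> X" "length us \<le> 2 ^ card J"
      "\<forall>q\<in>J. p dvd combination us (A q)" "\<not> p dvd combination us (\<lambda>x. u * \<delta> x - s * A j x)" by blast
    define vs where "vs = map (\<lambda>(c, x). (u * c, x)) us @ map (\<lambda>(c, x). (- combination us (A j) * c, x)) ts"
    have vs: "combination vs f = u * combination us f - combination us (A j) * combination ts f" for f
      unfolding vs_def combination_simps combination_scale by simp
    have "snd ` set vs \<subseteq> X" using ts(1) us(1) by (force simp: vs_def)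
    moreover have "length vs \<le> 2 ^ card (insert j J)" using ts(2) us(2) insert.hyps by (simp add: vs_def)
    moreover have "p dvd combination vs (A q)" if "q \<in> insert j J" for q
      using that ts(3) us(3) by (auto simp: vs u_def)
    moreover have "combination vs \<delta> = combination us (\<lambda>x. u * \<delta> x - s * A j x)"
      by (simp add: vs combination_diff s_def)
    ultimately show ?thesis using us(4) by (intro exI[of _ vs]) auto
  qed
qed

lemma prod_scale_slot:
  fixes c :: int and T :: nat
  assumes "T > 0"
  shows "(\<Prod>r<T. (if r = 0 then c * f 0 else f r)) = c * (\<Prod>r<T. f r)"
proof -
  obtain m where "T = Suc m" using assms gr0_implies_Suc by blast
  then show ?thesis by (simp add: prod.lessThan_Suc_shift mult.assoc del: prod.lessThan_Suc)
qed

section \<open>Linear forms and independence of their tensor powers\<close>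

locale forms =
  fixes p :: int and K :: "nat set" and d :: nat and a :: "nat \<Rightarrow> nat \<Rightarrow> int"
  assumes p: "prime p" and K: "finite K"
begin

definition form :: "(nat \<Rightarrow> int) \<Rightarrow> nat \<Rightarrow> int" where
  "form v j = (\<Sum>l=1..d. a j l * v l)"

definition base :: "(nat \<Rightarrow> int) set" where
  "base = {b. \<exists>v. \<forall>j\<in>K. [b j = form v j] (mod p)}"

text \<open>Tensor powers are taken as functions on tuples of integer vectors, so that no reduced
  representatives are needed.\<close>

definition independent :: "nat \<Rightarrow> nat \<Rightarrow> bool" where
  "independent T j \<longleftrightarrow> \<not> (\<exists>c. \<forall>w. [(\<Prod>r<T. form (w r) j) = (\<Sum>q\<in>K - {j}. c q * (\<Prod>r<T. form (w r) q))] (mod p))"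

lemma form_add: "form (\<lambda>l. v l + w l) j = form v j + form w j"
  by (simp add: form_def distrib_left sum.distrib)

lemma form_scale: "form (\<lambda>l. c * v l) j = c * form v j"
  by (simp add: form_def sum_distrib_left mult.left_commute)

lemma form_in_base: "form v \<in> base"
  unfolding base_def by (rule CollectI, rule exI[of _ v]) simp

lemma mod_subspace_base: "mod_subspace p K base"
  unfolding mod_subspace_def
proof (intro conjI ballI allI impI)
  show "base \<noteq> {}" using form_in_base by (metis empty_iff)
next
  fix b c assume "b \<in> base" "c \<in> base"
  then obtain v w where "\<forall>j\<in>K. [b j = form v j] (mod p)" "\<forall>j\<in>K. [c j = form w j] (mod p)"
    unfolding base_def by auto
  then have "\<forall>j\<in>K. [b j + c j = form (\<lambda>l. v l + w l) j] (mod p)" by (simp add: form_add cong_add)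
  then show "(\<lambda>j. b j + c j) \<in> base" unfolding base_def by blast
next
  fix b c assume "b \<in> base"
  then obtain v where "\<forall>j\<in>K. [b j = form v j] (mod p)" unfolding base_def by auto
  then have "\<forall>j\<in>K. [c * b j = form (\<lambda>l. c * v l) j] (mod p)" by (simp add: form_scale cong_scalar_left)
  then show "(\<lambda>j. c * b j) \<in> base" unfolding base_def by blast
next
  fix b c assume "b \<in> base" and bc: "\<forall>j\<in>K. [b j = c j] (mod p)"
  then obtain v where v: "\<forall>j\<in>K. [b j = form v j] (mod p)" unfolding base_def by auto
  have "[c j = form v j] (mod p)" if "j \<in> K" for j
    using cong_trans[OF cong_sym[OF bspec[OF bc that]] bspec[OF v that]] .
  then show "c \<in> base" unfolding base_def by blast
qed

lemma independent_nonzero: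
  assumes "independent T j" "T > 0"
  shows "\<exists>l\<in>{1..d}. \<not> p dvd a j l"
proof (rule ccontr)
  assume "\<not> ?thesis"
  then have "p dvd form v j" for v by (auto simp: form_def intro!: dvd_sum)
  then have "p dvd (\<Prod>r<T. form (w r) j)" for w using assms(2)
    by (meson dvd_prodI dvd_trans finite_lessThan lessThan_iff)
  then show False using assms(1) unfolding independent_def by (auto simp: cong_0_iff dest!: spec[of _ "\<lambda>_. 0"])
qed

lemma form_unit: "l \<in> {1..d} \<Longrightarrow> form (\<lambda>m. if m = l then 1 else 0) j = a j l"
  by (simp add: form_def if_distrib sum.delta cong: if_cong)

lemma unit_in_base:
  assumes "independent T j" "T > 0" "j \<in> K"
  shows "\<exists>b\<in>base. b j = 1"
proof -
  obtain l where l: "l \<in> {1..d}" "\<not> p dvd a j l" using independent_nonzero[OF assms(1,2)] by blast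
  obtain u where u: "[u * a j l = 1] (mod p)" using ex_inverse_mod[OF p l(2)] by blast
  let ?b = "\<lambda>q. u * form (\<lambda>m. if m = l then 1 else 0) q"
  have b: "?b \<in> base" by (rule mod_subspace_scale[OF mod_subspace_base form_in_base])
  have "?b(j := 1) \<in> base"
    by (rule mod_subspace_cong[OF mod_subspace_base b]) (use u l in \<open>auto simp: form_unit\<close>)
  then show ?thesis by (intro bexI[of _ "?b(j := 1)"]) auto
qed

text \<open>If the form \<open>j\<close> vanished wherever the form \<open>q\<close> does, it would
  be a multiple \<open>t\<close> of it modulo \<open>p\<close>, and its \<open>T\<close>-th tensor
  power would be \<open>t ^ T\<close> times that of \<open>q\<close>.\<close>

lemma separating:
  assumes "independent T j" "T > 0" "j \<in> K" "q \<in> K" "q \<noteq> j"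
  shows "\<exists>b\<in>base. p dvd b q \<and> \<not> p dvd b j"
proof (rule ccontr)
  assume neg: "\<not> ?thesis"
  have vanish: "p dvd form v j" if "p dvd form v q" for v using neg form_in_base that by blast
  obtain t where t: "\<And>v. [form v j = t * form v q] (mod p)"
  proof (cases "\<exists>u. \<not> p dvd form u q")
    case True
    then obtain u where u: "\<not> p dvd form u q" by blast
    obtain y where y: "[y * form u q = 1] (mod p)" using ex_inverse_mod[OF p u] by blast
    have "[form v j = (y * form u j) * form v q] (mod p)" for v
    proof -
      \<comment> \<open>The projection of \<open>v\<close> along \<open>u\<close> to the kernel of
        the form \<open>q\<close> modulo \<open>p\<close>.\<close>
      let ?v = "\<lambda>l. v l + (- (y * form v q)) * u l"
      have f: "form ?v i = form v i - y * form v q * form u i" for i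
        using form_add[of v "\<lambda>l. (- (y * form v q)) * u l"] form_scale[of "- (y * form v q)" u] by simp
      have "[form v q - y * form v q * form u q = form v q - form v q * 1] (mod p)"
        using cong_scalar_left[OF y, of "form v q"] by (intro cong_diff) (auto simp: ac_simps)
      then have "p dvd form ?v q" unfolding f by (simp add: cong_0_iff)
      then have "p dvd form ?v j" by (rule vanish)
      then show ?thesis unfolding f by (simp add: cong_iff_dvd_diff ac_simps)
    qed
    then show ?thesis using that by blast
  next
    case False
    then show ?thesis using that[of 0] vanish by (auto simp: cong_0_iff)
  qed
  have "[(\<Prod>r<T. form (w r) j) = (\<Sum>i\<in>K - {j}. (if i = q then t ^ T else 0) * (\<Prod>r<T. form (w r) i))] (mod p)" for w
  proof -
    have "[(\<Prod>r<T. form (w r) j) = (\<Prod>r<T. t * form (w r) q)] (mod p)" by (rule cong_prod) (rule t)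
    moreover have "(\<Sum>i\<in>K - {j}. (if i = q then t ^ T else 0) * (\<Prod>r<T. form (w r) i)) =
      (\<Sum>i\<in>K - {j}. if i = q then t ^ T * (\<Prod>r<T. form (w r) q) else 0)" by (rule sum.cong) auto
    ultimately show ?thesis using assms(4,5) K by (simp add: prod.distrib sum.delta)
  qed
  then have "\<exists>c. \<forall>w. [(\<Prod>r<T. form (w r) j) = (\<Sum>q\<in>K - {j}. c q * (\<Prod>r<T. form (w r) q))] (mod p)"
    by (intro exI[of _ "\<lambda>i. if i = q then t ^ T else 0"] allI)
  then show False using assms(1) unfolding independent_def by blast
qed

text \<open>A relation between tensor powers may be tested on tuples from \<open>E\<close>. All members of \<open>E\<close> except the first
  vanish at \<open>j\<close>, and their entries are bounded by \<open>2 L\<^sup>2\<close> whatever \<open>p\<close> is.\<close>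

lemma span_extends:
  fixes m T :: nat
  assumes aj: "\<not> p dvd a j l0" "l0 \<in> {1..d}"
    and E: "E = insert (\<lambda>q. a q l0) ((\<lambda>l q. a j l0 * a q l - a j l * a q l0) ` {1..d})"
    and rel: "\<And>w. (\<And>r. r < T \<Longrightarrow> w r \<in> E) \<Longrightarrow>
      [(\<Prod>r<T. w r j) = (\<Sum>q\<in>Q. c q * (\<Prod>r<T. w r q))] (mod p)"
  shows "m \<le> T \<Longrightarrow> (\<And>r. r < m \<Longrightarrow> w r \<in> range form) \<Longrightarrow> (\<And>r. m \<le> r \<Longrightarrow> r < T \<Longrightarrow> w r \<in> E) \<Longrightarrow>
      [(\<Prod>r<T. w r j) = (\<Sum>q\<in>Q. c q * (\<Prod>r<T. w r q))] (mod p)"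
proof (induction m arbitrary: w)
  case 0
  show ?case by (rule rel) (use 0 in simp)
next
  case (Suc m)
  define P where "P q = (\<Prod>r\<in>{..<T} - {m}. w r q)" for q
  define D where "D y = y j * P j - (\<Sum>q\<in>Q. c q * (y q * P q))" for y
  have prod: "(\<Prod>r<T. (w(m := y)) r q) = y q * P q" for y q
  proof -
    have "(\<Prod>r<T. (w(m := y)) r q) = (w(m := y)) m q * (\<Prod>r\<in>{..<T} - {m}. (w(m := y)) r q)"
      using Suc.prems(1) by (subst prod.remove[of _ m]) auto
    also have "(\<Prod>r\<in>{..<T} - {m}. (w(m := y)) r q) = P q" unfolding P_def by (rule prod.cong) auto
    finally show ?thesis by simp
  qed
  have DE: "p dvd D y" if "y \<in> E" for y
  proof -
    have "[(\<Prod>r<T. (w(m := y)) r j) = (\<Sum>q\<in>Q. c q * (\<Prod>r<T. (w(m := y)) r q))] (mod p)"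
    proof (rule Suc.IH)
      fix r assume "r < m"
      then show "(w(m := y)) r \<in> range form" using Suc.prems(2)[of r] by simp
    next
      fix r assume "m \<le> r" "r < T"
      then show "(w(m := y)) r \<in> E" using Suc.prems(3)[of r] that by (cases "r = m") simp_all
    qed (use Suc.prems(1) in simp)
    then show ?thesis by (simp only: prod D_def cong_iff_dvd_diff)
  qed
  have "w m \<in> range form" by (rule Suc.prems(2)) simp
  then obtain v where v: "w m = form v" by (rule rangeE)
  let ?z = "\<lambda>q. a q l0" and ?e = "\<lambda>l q. a j l0 * a q l - a j l * a q l0"
  \<comment> \<open>Up to the unit \<open>a j l0\<close>, the values of all forms at
    \<open>v\<close> are a combination of members of \<open>E\<close>. By multilinearity one slot at
    a time passes from \<open>E\<close> to arbitrary vectors.\<close>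
  have decomp: "a j l0 * form v q = form v j * ?z q + (\<Sum>l=1..d. v l * ?e l q)" for q
    unfolding form_def sum_distrib_left sum_distrib_right sum.distrib[symmetric]
    by (rule sum.cong) (simp_all add: algebra_simps)
  have Dadd: "D (\<lambda>q. f q + g q) = D f + D g" for f g
    by (simp add: D_def distrib_left distrib_right sum.distrib)
  have Dscale: "D (\<lambda>q. t * f q) = t * D f" for t f
    by (simp add: D_def right_diff_distrib sum_distrib_left mult.assoc mult.left_commute[of t])
  have Dsum: "D (\<lambda>q. \<Sum>l\<in>S. f l q) = (\<Sum>l\<in>S. D (f l))" if "finite S" for S :: "nat set" and f
    using that
  proof (induction S rule: finite_induct)
    case empty show ?case by (simp add: D_def)
  next
    case (insert x S) then show ?case by (simp add: Dadd)
  qed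
  have "a j l0 * D (form v) = D (\<lambda>q. a j l0 * form v q)" by (rule Dscale[symmetric])
  also have "\<dots> = D (\<lambda>q. form v j * ?z q) + D (\<lambda>q. \<Sum>l=1..d. v l * ?e l q)"
    unfolding decomp by (rule Dadd)
  also have "\<dots> = form v j * D ?z + (\<Sum>l=1..d. v l * D (?e l))"
    unfolding Dscale by (subst Dsum) (simp_all only: Dscale finite_atLeastAtMost)
  also have "p dvd \<dots>" by (intro dvd_add dvd_mult dvd_sum DE) (auto simp: E)
  finally have "p dvd D (form v)" using aj(1) p by (simp add: prime_dvd_mult_iff)
  then have "p dvd D (w m)" by (simp add: v)
  moreover have "w(m := w m) = w" by simp
  ultimately show ?case using prod[of "w m"] unfolding D_def cong_iff_dvd_diff by simp
qed

text \<open>The members of \<open>E\<close> other than \<open>e0\<close> are exactly 0 at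
  \<open>j\<close>, so a term without a vanishing slot at \<open>j\<close> consists of
  \<open>e0\<close> in all slots. All such terms are merged into \<open>w1\<close>.\<close>

lemma adapted_terms:
  assumes ind: "independent T j" and T: "T > 0" and j: "j \<in> K"
    and bound: "\<And>q l. q \<in> K \<Longrightarrow> l \<in> {1..d} \<Longrightarrow> \<bar>a q l\<bar> \<le> A" and A: "A \<ge> 1" and b: "2 * A\<^sup>2 < 2 ^ b"
  obtains w1 ws where "\<And>r. r < T \<Longrightarrow> w1 r \<in> base" "\<And>r. r < T \<Longrightarrow> \<not> p dvd w1 r j"
    "\<And>r q. 0 < r \<Longrightarrow> r < T \<Longrightarrow> q \<in> K \<Longrightarrow> - (2 ^ b) \<le> w1 r q \<and> w1 r q < 2 ^ b"
    "\<And>w r. w \<in> set ws \<Longrightarrow> r < T \<Longrightarrow> w r \<in> base" "\<And>w. w \<in> set ws \<Longrightarrow> \<exists>r<T. p dvd w r j"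
    "\<And>w r q. w \<in> set ws \<Longrightarrow> 0 < r \<Longrightarrow> r < T \<Longrightarrow> q \<in> K \<Longrightarrow> - (2 ^ b) \<le> w r q \<and> w r q < 2 ^ b"
    "\<And>q. q \<in> K - {j} \<Longrightarrow> p dvd (\<Sum>w\<leftarrow>w1 # ws. \<Prod>r<T. w r q)"
    "length ws \<le> 2 ^ card K"
proof -
  obtain l0 where l0: "l0 \<in> {1..d}" "\<not> p dvd a j l0" using independent_nonzero[OF ind T] by blast
  define e0 where "e0 = (\<lambda>q. a q l0)"
  define e where "e = (\<lambda>l q. a j l0 * a q l - a j l * a q l0)"
  define E where "E = insert e0 (e ` {1..d})"
  define X where "X = {w. \<forall>r<T. w r \<in> E}"
  have not_span: "\<not> (\<exists>c. \<forall>w\<in>X. [(\<Prod>r<T. w r j) = (\<Sum>q\<in>K - {j}. c q * (\<Prod>r<T. w r q))] (mod p))"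
  proof
    assume "\<exists>c. \<forall>w\<in>X. [(\<Prod>r<T. w r j) = (\<Sum>q\<in>K - {j}. c q * (\<Prod>r<T. w r q))] (mod p)"
    then obtain c where c: "\<forall>w\<in>X. [(\<Prod>r<T. w r j) = (\<Sum>q\<in>K - {j}. c q * (\<Prod>r<T. w r q))] (mod p)" ..
    have "[(\<Prod>r<T. form (w r) j) = (\<Sum>q\<in>K - {j}. c q * (\<Prod>r<T. form (w r) q))] (mod p)" for w
      by (rule span_extends[OF l0(2,1) E_def[unfolded e0_def e_def], where Q = "K - {j}" and c = c and T = T and m = T
          and w = "\<lambda>r. form (w r)"])
        (use c in \<open>auto simp: X_def E_def e0_def e_def\<close>)
    then have "\<exists>c. \<forall>w. [(\<Prod>r<T. form (w r) j) = (\<Sum>q\<in>K - {j}. c q * (\<Prod>r<T. form (w r) q))] (mod p)"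
      by (intro exI[of _ c] allI)
    then show False using ind unfolding independent_def by blast
  qed
  obtain ts where ts: "snd ` set ts \<subseteq> X" "length ts \<le> 2 ^ card (K - {j})"
    "\<forall>q\<in>K - {j}. p dvd combination ts (\<lambda>w. \<Prod>r<T. w r q)" "\<not> p dvd combination ts (\<lambda>w. \<Prod>r<T. w r j)"
    using annihilating_combination[OF _ p not_span] K by auto
  have ebase: "y \<in> base" "y \<noteq> e0 \<Longrightarrow> y j = 0" "\<And>q. q \<in> K \<Longrightarrow> - (2 ^ b) \<le> y q \<and> y q < 2 ^ b" if "y \<in> E" for y
  proof -
    have u: "form (\<lambda>m. if m = l then 1 else 0) = (\<lambda>q. a q l)" if "l \<in> {1..d}" for l
      using form_unit[OF that] by auto
    have ab: "(\<lambda>q. a q l) \<in> base" if "l \<in> {1..d}" for l using form_in_base u[OF that] by metis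
    have A2: "A \<le> A\<^sup>2" using A by (simp add: power2_eq_square)
    from that consider "y = e0" | l where "l \<in> {1..d}" "y = e l" unfolding E_def by blast
    then have "y \<in> base \<and> (y \<noteq> e0 \<longrightarrow> y j = 0) \<and> (\<forall>q\<in>K. \<bar>y q\<bar> < 2 ^ b)"
    proof cases
      case 1
      then show ?thesis using ab[OF l0(1)] bound[OF _ l0(1)] A2 b A by (force simp: e0_def)
    next
      case 2
      have "y = (\<lambda>q. a j l0 * a q l + (- a j l) * a q l0)" using 2 by (auto simp: e_def)
      then have "y \<in> base" using mod_subspace_add[OF mod_subspace_base
          mod_subspace_scale[OF mod_subspace_base ab[OF 2(1)], of "a j l0"]
          mod_subspace_scale[OF mod_subspace_base ab[OF l0(1)], of "- a j l"]] by simp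
      moreover have "\<bar>y q\<bar> < 2 ^ b" if q: "q \<in> K" for q
      proof -
        have "\<bar>a j l0 * a q l\<bar> \<le> A * A" "\<bar>a j l * a q l0\<bar> \<le> A * A"
          unfolding abs_mult using bound[OF j l0(1)] bound[OF q 2(1)] bound[OF j 2(1)] bound[OF q l0(1)] A
          by (intro mult_mono; simp)+
        then have "\<bar>y q\<bar> \<le> 2 * A\<^sup>2" unfolding 2 e_def power2_eq_square by linarith
        then show ?thesis using b by linarith
      qed
      ultimately show ?thesis using 2 by (simp add: e_def)
    qed
    then show "y \<in> base" "y \<noteq> e0 \<Longrightarrow> y j = 0" "\<And>q. q \<in> K \<Longrightarrow> - (2 ^ b) \<le> y q \<and> y q < 2 ^ b"
      by (auto simp: abs_less_iff dest: bspec)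
  qed
  define bad where "bad w \<longleftrightarrow> (\<forall>r<T. \<not> p dvd w r j)" for w :: "nat \<Rightarrow> nat \<Rightarrow> int"
  have bad: "w r = e0" if "w \<in> X" "bad w" "r < T" for w r
  proof (rule ccontr)
    assume "w r \<noteq> e0"
    moreover have "w r \<in> E" using that by (simp add: X_def)
    ultimately have "w r j = 0" using ebase(2) by blast
    then show False using that by (auto simp: bad_def)
  qed
  define C where "C = (\<Sum>(c, w)\<leftarrow>ts. if bad w then c else 0)"
  \<comment> \<open>The coefficient goes into slot 0, for which no bound is demanded.\<close>
  define scaled where "scaled c w r = (if r = 0 then (\<lambda>q. c * w 0 q) else w r)"
    for c :: int and w :: "nat \<Rightarrow> nat \<Rightarrow> int" and r :: nat
  define ws where "ws = map (\<lambda>(c, w). scaled c w) (filter (\<lambda>(c, w). \<not> bad w) ts)"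
  define w1 where "w1 = scaled C (\<lambda>_. e0)"
  have scaled_prod: "(\<Prod>r<T. scaled c w r q) = c * (\<Prod>r<T. w r q)" for c w q
  proof -
    have "(\<Prod>r<T. scaled c w r q) = (\<Prod>r<T. if r = 0 then c * w 0 q else w r q)"
      by (rule prod.cong) (auto simp: scaled_def)
    then show ?thesis using prod_scale_slot[OF T, of c "\<lambda>r. w r q"] by simp
  qed
  have total: "(\<Sum>w\<leftarrow>w1 # ws. \<Prod>r<T. w r q) = combination ts (\<lambda>w. \<Prod>r<T. w r q)" for q
  proof -
    have "(\<Sum>(c, w)\<leftarrow>us. if bad w then c else 0) * (\<Prod>r<T. e0 q) +
        (\<Sum>w\<leftarrow>map (\<lambda>(c, w). scaled c w) (filter (\<lambda>(c, w). \<not> bad w) us). \<Prod>r<T. w r q) =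
        combination us (\<lambda>w. \<Prod>r<T. w r q)" if "snd ` set us \<subseteq> X" for us
      using that
    proof (induction us)
      case (Cons u us)
      obtain c w where u: "u = (c, w)" by fastforce
      have "(\<Prod>r<T. w r q) = (\<Prod>r<T. e0 q)" if "bad w"
        by (rule prod.cong) (use bad[of w] that Cons.prems u in auto)
      then show ?case using Cons by (auto simp: u scaled_prod algebra_simps)
    qed simp
    from this[OF ts(1)] show ?thesis by (simp add: ws_def w1_def C_def scaled_prod)
  qed
  have e0E: "e0 \<in> E" by (simp add: E_def)
  \<comment> \<open>Otherwise every term would vanish at \<open>j\<close>, contrary to the choice of
    \<open>ts\<close>.\<close>
  have C: "\<not> p dvd C"
  proof
    assume "p dvd C"
    have "p dvd (\<Prod>r<T. w r j)" if "w \<in> set ws" for w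
    proof -
      obtain c v where v: "w = scaled c v" "\<not> bad v" using \<open>w \<in> set ws\<close> by (auto simp: ws_def)
      then obtain r where r: "r < T" "p dvd v r j" by (auto simp: bad_def)
      have "v r j dvd (\<Prod>r<T. v r j)" using r(1) by (intro dvd_prodI) auto
      then have "p dvd (\<Prod>r<T. v r j)" using r(2) dvd_trans by blast
      then show ?thesis by (simp add: v scaled_prod)
    qed
    then have "p dvd (\<Sum>w\<leftarrow>ws. \<Prod>r<T. w r j)"
    proof (induction ws)
      case (Cons v vs) then show ?case by (simp add: dvd_add)
    qed simp
    moreover have "p dvd (\<Prod>r<T. w1 r j)" using \<open>p dvd C\<close> by (simp add: w1_def scaled_prod)
    ultimately have "p dvd (\<Prod>r<T. w1 r j) + (\<Sum>w\<leftarrow>ws. \<Prod>r<T. w r j)" by (intro dvd_add)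
    then show False using ts(4) total[of j] by simp
  qed
  have e0j: "\<not> p dvd e0 j" using l0(2) by (simp add: e0_def)
  show ?thesis
  proof (rule that[of w1 ws])
    fix r assume "r < T"
    show "w1 r \<in> base" using ebase(1)[OF e0E] mod_subspace_scale[OF mod_subspace_base, of e0 C]
      by (simp add: w1_def scaled_def)
    show "\<not> p dvd w1 r j" using C e0j p by (auto simp: w1_def scaled_def prime_dvd_mult_iff)
  next
    fix r q assume "0 < (r::nat)" "r < T" "q \<in> K"
    then show "- (2 ^ b) \<le> w1 r q \<and> w1 r q < 2 ^ b" using ebase(3)[OF e0E] by (simp add: w1_def scaled_def)
  next
    fix w r assume "w \<in> set ws" "r < T"
    then obtain c v where v: "w = scaled c v" "v \<in> X" using ts(1) by (force simp: ws_def)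
    have "v 0 \<in> E" "v r \<in> E" using v(2) T \<open>r < T\<close> by (auto simp: X_def)
    then show "w r \<in> base" using ebase(1) mod_subspace_scale[OF mod_subspace_base, of "v 0" c]
      by (auto simp: v scaled_def)
  next
    fix w assume "w \<in> set ws"
    then obtain c v where v: "w = scaled c v" "\<not> bad v" by (auto simp: ws_def)
    then obtain r where "r < T" "p dvd v r j" by (auto simp: bad_def)
    then show "\<exists>r<T. p dvd w r j" by (intro exI[of _ r]) (auto simp: v scaled_def)
  next
    fix w r q assume "w \<in> set ws" "0 < r" "r < T" "q \<in> K"
    then obtain c v where v: "w = scaled c v" "v \<in> X" using ts(1) by (force simp: ws_def)
    have "v r \<in> E" using v(2) \<open>r < T\<close> by (auto simp: X_def)
    then show "- (2 ^ b) \<le> w r q \<and> w r q < 2 ^ b"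
      using ebase(3) \<open>q \<in> K\<close> \<open>0 < r\<close> by (simp add: v scaled_def)
  next
    fix q assume "q \<in> K - {j}"
    then show "p dvd (\<Sum>w\<leftarrow>w1 # ws. \<Prod>r<T. w r q)" using ts(3) by (simp only: total)
  next
    have "length ws \<le> length ts" by (simp add: ws_def)
    also have "\<dots> \<le> 2 ^ card (K - {j})" by (rule ts(2))
    also have "\<dots> \<le> 2 ^ card K" using K by (intro power_increasing card_mono) auto
    finally show "length ws \<le> 2 ^ card K" .
  qed
qed

end

subsection \<open>Lowering the level\<close>

text \<open>\<open>Y\<close> is not known to be linear. Control is therefore pulled back through the
  final specialization to an iterated joining of \<open>X\<close>, which is linear.\<close>

lemma deriv_cube_of_controlled:
  assumes "deriv X x n Y y" "controlled p T Y y" "linear_system p X" "prime p" "T > 0"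
  shows "deriv X x (n + T) (cube p T) (top_corner T)"
  using assms
proof (induction rule: deriv.induct)
  case (specialize X x Y y)
  then show ?case using deriv_cube[OF controlled_specializes] by simp
next
  case (double S X x n Y y)
  have "deriv (double X S) (Left x) (n + T) (cube p T) (top_corner T)"
    by (rule double.IH[OF double.prems(1) linear_system_double[OF double.prems(2)] double.prems(3,4)])
  from deriv.double[OF double.hyps(1,2) this] show ?case by simp
qed

text \<open>\<open>m + 2\<close> joinings for the cube and 3 for turning it into a gadget.\<close>

lemma deriv_gadget_of_controlled:
  assumes "controlled p (Suc (Suc m)) X x" "linear_system p X" "prime p"
  shows "deriv X x (m + 5) (gadget p m) (port m)"
proof -
  have "deriv X x (Suc (Suc m)) (cube p (Suc (Suc m))) (top_corner (Suc (Suc m)))"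
    by (rule deriv_cube[OF assms]) simp
  from deriv_trans[OF this deriv_gadget] show ?thesis by (simp add: numeral_eq_Suc)
qed

context forms
begin

abbreviation sys :: "(nat \<Rightarrow> attachment) \<Rightarrow> system" where
  "sys \<equiv> attach K base"

lemma controlled_sys:
  assumes j: "j \<in> K" "\<Sigma> j = raw p"
    and w: "\<And>r. r < T \<Longrightarrow> w r \<in> base" "\<And>r. r < T \<Longrightarrow> \<not> p dvd w r j"
    and \<Sigma>: "\<And>q. q \<in> K - {j} \<Longrightarrow> low p T (\<Sigma> q) \<or> \<Sigma> q = raw p \<and> (\<exists>r<T. p dvd w r q)"
  shows "controlled p T (sys \<Sigma>) (tag j (Num 1))"
proof -
  define A where "A q = (if q = j then {(Num 1, \<lambda>r. w r j)} else {})" for q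
  have raw: "supports p T (fst (raw p)) (insert (snd (raw p), c) (A q))"
    if "q = j \<and> c = (\<lambda>r. w r j) \<or> q \<noteq> j \<and> (\<exists>r<T. p dvd c r)" for q c
    unfolding supports_def raw_def A_def by (rule exI[of _ "\<lambda>r _. c r"]) (use that in auto)
  have "supports p T (sys \<Sigma>) (\<Union>q\<in>K. (\<lambda>(z, c). (tag q z, c)) ` A q)"
  proof (rule supports_attach[of _ _ _ _ w])
    fix q assume q: "q \<in> K"
    show "supports p T (fst (\<Sigma> q)) (insert (snd (\<Sigma> q), \<lambda>r. w r q) (A q))"
    proof (cases "q = j \<or> \<Sigma> q = raw p \<and> (\<exists>r<T. p dvd w r q)")
      case True
      then have "\<Sigma> q = raw p" using j by blast
      then show ?thesis using raw[of q "\<lambda>r. w r q"] True by auto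
    next
      case False
      then have "q \<noteq> j" "low p T (\<Sigma> q)" using \<Sigma>[of q] q by auto
      then show ?thesis by (simp add: A_def low_def)
    qed
  next
    fix q z c assume "(z, c) \<in> A q"
    then show "z \<in> positions (fst (\<Sigma> q)) - {snd (\<Sigma> q)}" using j(2) by (auto simp: A_def raw_def split: if_splits)
  qed (rule w(1))
  moreover have "(\<Union>q\<in>K. (\<lambda>(z, c). (tag q z, c)) ` A q) = {(tag j (Num 1), \<lambda>r. w r j)}"
    using j(1) by (auto simp: A_def split: if_splits)
  moreover have "tag j (Num 1) \<in> positions (sys \<Sigma>)" using j by (simp add: raw_def)
  ultimately show ?thesis unfolding controlled_def by (intro conjI exI[of _ "\<lambda>r. w r j"]) (simp_all add: w(2))
qed

end

text \<open>\<open>b\<close> bounds the number of bits in a slot, and \<open>2^n\<close> exceeds the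
  length of every chain with up to \<open>card K\<close> slots, so one \<open>n\<close> serves all
  levels.\<close>

locale levels = forms +
  fixes i :: nat and s :: nat and b n :: nat and A :: int
  assumes i: "i \<in> K"
    and ind: "\<And>j T. j \<in> K \<Longrightarrow> T \<ge> s + 2 \<Longrightarrow> independent T j" and ind_i: "independent (s + 1) i"
    and bound: "\<And>q l. q \<in> K \<Longrightarrow> l \<in> {1..d} \<Longrightarrow> \<bar>a q l\<bar> \<le> A" and A: "A \<ge> 1" and b: "2 * A\<^sup>2 < 2 ^ b"
    and n: "(2 ^ card K + 1) * (card K * (3 * b + 4)) < 2 ^ n"
begin

definition admissible :: "(nat \<Rightarrow> attachment) \<Rightarrow> bool" where
  "admissible \<Sigma> \<longleftrightarrow> \<Sigma> i = raw p \<and> (\<forall>q\<in>K. attachable p (\<Sigma> q))"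

abbreviation target :: index where
  "target \<equiv> tag i (Num 1)"

lemma unit: "q \<in> K \<Longrightarrow> \<exists>b\<in>base. b q = 1"
  using unit_in_base[OF ind[of q "s + 2"]] by simp

lemma deriv_replace:
  assumes "deriv Y y c Y' y'" "attachable p (Y, y)" "\<And>q. q \<in> K \<Longrightarrow> attachable p (\<Sigma> q)" "\<Sigma> j = raw p"
    "j \<in> K" "q \<in> K" "q \<noteq> j"
  shows "deriv (sys (\<Sigma>(q := (Y, y)))) (tag j (Num 1)) c (sys (\<Sigma>(q := (Y', y')))) (tag j (Num 1))"
proof -
  obtain e where e: "e \<in> base" "e q = 1" using unit[OF assms(6)] by blast
  show ?thesis
    by (rule deriv_attach[OF assms(1) mod_subspace_base assms(3) assms(2) e assms(6,5)])
      (use assms in \<open>auto simp: raw_def\<close>)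
qed

text \<open>A copy of the whole system is attached at \<open>q\<close>, with \<open>q\<close> as its
  distinguished form, and then transformed in place. The extra 1 is the joining that creates the
  copy.\<close>

lemma deriv_duplicate_raw:
  assumes "\<And>q. q \<in> K \<Longrightarrow> attachable p (\<Sigma> q)" "\<Sigma> j = raw p" "j \<in> K" "q \<in> K" "q \<noteq> j"
    "deriv (sys (\<Sigma>(q := raw p))) (tag q (Num 1)) c Y y"
  shows "deriv (sys \<Sigma>) (tag j (Num 1)) (Suc c) (sys (\<Sigma>(q := (Y, y)))) (tag j (Num 1))"
proof -
  obtain e where e: "e \<in> base" "e q = 1" using unit[OF assms(4)] by blast
  have "attachable p (sys (\<Sigma>(q := raw p)), tag q (Num 1))"
    by (rule attachable_attach[OF mod_subspace_base _ assms(4) _ e]) (use assms(1) attachable_raw in auto)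
  then have "deriv (sys (\<Sigma>(q := (sys (\<Sigma>(q := raw p)), tag q (Num 1))))) (tag j (Num 1)) c
    (sys (\<Sigma>(q := (Y, y)))) (tag j (Num 1))"
    by (rule deriv_replace[OF assms(6)]) (use assms in auto)
  moreover have "deriv (sys \<Sigma>) (tag j (Num 1)) 1
    (sys (\<Sigma>(q := (sys (\<Sigma>(q := raw p)), tag q (Num 1))))) (tag j (Num 1))"
    by (rule deriv_duplicate[OF mod_subspace_base assms(1) assms(4,3)]) (use assms in \<open>auto simp: raw_def\<close>)
  ultimately show ?thesis using deriv_trans by fastforce
qed

lemma target_position: "admissible \<Sigma> \<Longrightarrow> target \<in> positions (sys \<Sigma>)"
  using i by (simp add: admissible_def raw_def)

lemma deriv_gadgets:
  assumes "finite S" "S \<subseteq> K - {i}" "admissible \<Sigma>" "\<And>q. q \<in> S \<Longrightarrow> low p (Suc (Suc m)) (\<Sigma> q)"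
  shows "deriv (sys \<Sigma>) target (card S * (m + 5)) (sys (\<lambda>q. if q \<in> S then (gadget p m, port m) else \<Sigma> q)) target"
  using assms
proof (induction S rule: finite_induct)
  case empty
  then show ?case using target_position by (simp add: deriv_refl)
next
  case (insert q S)
  let ?\<Sigma> = "\<lambda>q. if q \<in> S then (gadget p m, port m) else \<Sigma> q"
  have att: "attachable p (\<Sigma> q)" using insert.prems by (simp add: admissible_def)
  have "controlled p (Suc (Suc m)) (fst (\<Sigma> q)) (snd (\<Sigma> q))"
    using insert.prems att p by (intro controlled_attachment) auto
  then have "deriv (fst (\<Sigma> q)) (snd (\<Sigma> q)) (m + 5) (gadget p m) (port m)"
    using att p by (intro deriv_gadget_of_controlled) (auto simp: attachable_def)
  then have "deriv (sys (?\<Sigma>(q := (fst (\<Sigma> q), snd (\<Sigma> q))))) target (m + 5) (sys (?\<Sigma>(q := (gadget p m, port m)))) target"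
    by (rule deriv_replace) (use att i insert attachable_gadget in \<open>auto simp: admissible_def\<close>)
  moreover have "?\<Sigma>(q := (fst (\<Sigma> q), snd (\<Sigma> q))) = ?\<Sigma>" using insert.hyps by auto
  moreover have "?\<Sigma>(q := (gadget p m, port m)) = (\<lambda>x. if x \<in> insert q S then (gadget p m, port m) else \<Sigma> x)" by auto
  moreover have "deriv (sys \<Sigma>) target (card S * (m + 5)) (sys ?\<Sigma>) target" using insert by auto
  ultimately have "deriv (sys \<Sigma>) target (card S * (m + 5) + (m + 5))
      (sys (\<lambda>x. if x \<in> insert q S then (gadget p m, port m) else \<Sigma> x)) target"
    using deriv_trans by (metis (no_types, lifting))
  then show ?case using insert.hyps by (simp add: add.commute)
qed

lemma controlled_chain:
  assumes "independent T j" "T = Suc m" "T \<le> card K" "j \<in> K" "\<Sigma> j = raw p"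
    "\<And>q. q \<in> K - {j} \<Longrightarrow> \<Sigma> q = (gadget p m, port m) \<or> low p T (\<Sigma> q)"
  shows "\<exists>Y y. deriv (sys \<Sigma>) (tag j (Num 1)) (Suc n) Y y \<and> controlled p T Y y"
proof -
  have T: "T > 0" using assms by simp
  show ?thesis
  proof (rule adapted_terms[OF assms(1) T assms(4) bound A b])
    fix w1 ws
    assume w: "\<And>r. r < T \<Longrightarrow> w1 r \<in> base" "\<And>r. r < T \<Longrightarrow> \<not> p dvd w1 r j"
      "\<And>r q. 0 < r \<Longrightarrow> r < T \<Longrightarrow> q \<in> K \<Longrightarrow> - (2 ^ b) \<le> w1 r q \<and> w1 r q < 2 ^ b"
      "\<And>w r. w \<in> set ws \<Longrightarrow> r < T \<Longrightarrow> w r \<in> base" "\<And>w. w \<in> set ws \<Longrightarrow> \<exists>r<T. p dvd w r j"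
      "\<And>w r q. w \<in> set ws \<Longrightarrow> 0 < r \<Longrightarrow> r < T \<Longrightarrow> q \<in> K \<Longrightarrow> - (2 ^ b) \<le> w r q \<and> w r q < 2 ^ b"
      "\<And>q. q \<in> K - {j} \<Longrightarrow> p dvd (\<Sum>w\<leftarrow>w1 # ws. \<Prod>r<T. w r q)"
      "length ws \<le> 2 ^ card K"
    have "Suc (length ws) * (T * (3 * b + 4)) \<le> (2 ^ card K + 1) * (card K * (3 * b + 4))"
      using w(8) assms(3) by (intro mult_mono) auto
    then have "Suc (length ws) * (T * (3 * b + 4)) < 2 ^ n" using n by linarith
    with w(1-7) assms(5,6) show ?thesis
      by (intro chain_control[OF assms(2) p mod_subspace_base assms(4), where ?w1.0 = w1 and ws = ws and b = b])
  qed
qed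

text \<open>The state while a level is lowered form by form: a gadget still has level
  \<open>m + 2\<close> and offers registers with \<open>m + 1\<close> slots, a replaced attachment
  has both levels.\<close>

definition level :: "nat \<Rightarrow> (nat \<Rightarrow> attachment) \<Rightarrow> bool" where
  "level m \<Sigma> \<longleftrightarrow> admissible \<Sigma> \<and>
     (\<forall>q\<in>K - {i}. low p (Suc (Suc m)) (\<Sigma> q) \<and> (\<Sigma> q = (gadget p m, port m) \<or> low p (Suc m) (\<Sigma> q)))"

text \<open>The copy attached at \<open>j\<close> needs a gadget at \<open>i\<close>, where the
  system has only the raw form. It comes from a further copy nested at \<open>i\<close>, which is
  controlled with \<open>m + 2\<close> slots; the chain at \<open>j\<close> then runs with
  \<open>m + 1\<close>.\<close>

lemma deriv_lower:
  assumes \<Sigma>: "level m \<Sigma>" and m: "Suc m \<ge> s + 2" "Suc m \<le> card K" and j: "j \<in> K" "j \<noteq> i"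
  shows "deriv (sys \<Sigma>) target (2 * m + n + 9) (sys (\<Sigma>(j := (cube p (Suc m), top_corner (Suc m))))) target"
proof -
  let ?T = "Suc m" and ?j = "tag j (Num 1)"
  define \<Sigma>1 where "\<Sigma>1 = \<Sigma>(j := raw p)"
  define \<Sigma>2 where "\<Sigma>2 = \<Sigma>1(i := (gadget p m, port m))"
  have att: "attachable p (\<Sigma> q)" if "q \<in> K" for q using \<Sigma> that by (simp add: level_def admissible_def)
  have \<Sigma>i: "\<Sigma> i = raw p" using \<Sigma> by (simp add: level_def admissible_def)
  have att1: "attachable p (\<Sigma>1 q)" if "q \<in> K" for q using att that attachable_raw by (simp add: \<Sigma>1_def)
  have 1: "\<Sigma>1 i = raw p" "\<Sigma>1 j = raw p" using j \<Sigma>i by (simp_all add: \<Sigma>1_def)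
  \<comment> \<open>In the nested copy \<open>j\<close> is raw; a labelling that vanishes at
    \<open>j\<close> but not at \<open>i\<close>, used in every slot, takes care of it.\<close>
  obtain e where e: "e \<in> base" "p dvd e j" "\<not> p dvd e i"
    using separating[OF ind_i _ i j] by auto
  have "controlled p (Suc ?T) (sys \<Sigma>1) target"
    by (rule controlled_sys[where w = "\<lambda>_. e"])
      (use e \<Sigma> i 1 in \<open>auto simp: level_def \<Sigma>1_def\<close>)
  then have "deriv (sys \<Sigma>1) target (m + 5) (gadget p m) (port m)"
    using p linear_system_attach[OF mod_subspace_base att1] by (intro deriv_gadget_of_controlled)
  then have "deriv (sys (\<Sigma>1(i := raw p))) target (m + 5) (gadget p m) (port m)"
    using 1(1) by (simp add: fun_upd_idem)
  then have d1: "deriv (sys \<Sigma>1) ?j (Suc (m + 5)) (sys \<Sigma>2) ?j"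
    unfolding \<Sigma>2_def using att1 1(2) i j by (intro deriv_duplicate_raw) auto
  have "\<exists>Y y. deriv (sys \<Sigma>2) ?j (Suc n) Y y \<and> controlled p ?T Y y"
    by (rule controlled_chain[OF ind[OF j(1) m(1)] refl m(2) j(1)])
      (use \<Sigma> j in \<open>auto simp: \<Sigma>2_def \<Sigma>1_def level_def\<close>)
  then obtain Y y where Y: "deriv (sys \<Sigma>2) ?j (Suc n) Y y" "controlled p ?T Y y" by blast
  have "deriv (sys \<Sigma>1) ?j (Suc (m + 5) + Suc n + ?T) (cube p ?T) (top_corner ?T)"
    by (rule deriv_cube_of_controlled[OF deriv_trans[OF d1 Y(1)] Y(2) linear_system_attach[OF mod_subspace_base att1] p]) simp_all
  then have "deriv (sys \<Sigma>) target (Suc (Suc (m + 5) + Suc n + ?T)) (sys (\<Sigma>(j := (cube p ?T, top_corner ?T)))) target"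
    unfolding \<Sigma>1_def using att \<Sigma>i i j by (intro deriv_duplicate_raw) auto
  \<comment> \<open>Two copies, \<open>m + 5\<close> for the gadget at \<open>i\<close>,
    \<open>n + 1\<close> for the chain and \<open>m + 1\<close> for the cube.\<close>
  moreover have "Suc (Suc (m + 5) + Suc n + ?T) = 2 * m + n + 9" by simp
  ultimately show ?thesis by metis
qed

lemma deriv_lower_all:
  assumes "finite S" "S \<subseteq> K - {i}" and \<Sigma>: "level m \<Sigma>" and m: "Suc m \<ge> s + 2" "Suc m \<le> card K"
  defines "C \<equiv> (cube p (Suc m), top_corner (Suc m))"
  shows "deriv (sys \<Sigma>) target (card S * (2 * m + n + 9)) (sys (\<lambda>q. if q \<in> S then C else \<Sigma> q)) target \<and>
    level m (\<lambda>q. if q \<in> S then C else \<Sigma> q)"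
  using assms(1,2)
proof (induction S rule: finite_induct)
  case empty
  then show ?case using \<Sigma> deriv_refl[OF target_position[of \<Sigma>]] by (simp add: level_def)
next
  case (insert q S)
  let ?\<Sigma> = "\<lambda>q. if q \<in> S then C else \<Sigma> q"
  have IH: "deriv (sys \<Sigma>) target (card S * (2 * m + n + 9)) (sys ?\<Sigma>) target" "level m ?\<Sigma>"
    using insert by auto
  have eq: "?\<Sigma>(q := C) = (\<lambda>x. if x \<in> insert q S then C else \<Sigma> x)" by auto
  have C: "attachable p C" "low p (Suc m) C" "low p (Suc (Suc m)) C"
    unfolding C_def by (rule attachable_cube low_cube low_mono[OF low_cube _ attachable_cube] le_SucI[OF order_refl])+
  have "deriv (sys ?\<Sigma>) target (2 * m + n + 9) (sys (?\<Sigma>(q := C))) target"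
    unfolding C_def by (rule deriv_lower[OF IH(2)[unfolded C_def] m]) (use insert in auto)
  from deriv_trans[OF IH(1) this]
  have "deriv (sys \<Sigma>) target (card (insert q S) * (2 * m + n + 9)) (sys (?\<Sigma>(q := C))) target"
    using insert.hyps by (simp add: add.commute)
  moreover have "level m (?\<Sigma>(q := C))"
    using IH(2) C insert.prems unfolding level_def admissible_def by auto
  ultimately show ?case unfolding eq by blast
qed

lemma card_rest: "card (K - {i}) \<le> card K"
  using K by (intro card_mono) auto

text \<open>Per form, \<open>m + 5\<close> joinings to install a gadget and
  \<open>2 * m + n + 9\<close> to replace it by a cube of smaller dimension.\<close>

lemma deriv_level:
  assumes \<Sigma>: "admissible \<Sigma>" "\<forall>q\<in>K - {i}. low p (Suc (Suc m)) (\<Sigma> q)"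
    and m: "Suc m \<ge> s + 2" "Suc m \<le> card K"
  shows "\<exists>\<Sigma>'. deriv (sys \<Sigma>) target (card (K - {i}) * (3 * m + n + 14)) (sys \<Sigma>') target \<and>
    admissible \<Sigma>' \<and> (\<forall>q\<in>K - {i}. low p (Suc m) (\<Sigma>' q))"
proof -
  let ?S = "K - {i}"
  let ?\<Sigma> = "\<lambda>q. if q \<in> ?S then (gadget p m, port m) else \<Sigma> q"
  have fin: "finite ?S" using K by simp
  have d1: "deriv (sys \<Sigma>) target (card ?S * (m + 5)) (sys ?\<Sigma>) target"
    using \<Sigma> by (intro deriv_gadgets fin) auto
  have lev: "level m ?\<Sigma>" using \<Sigma> low_gadget attachable_gadget by (auto simp: level_def admissible_def)
  let ?\<Sigma>' = "\<lambda>q. if q \<in> ?S then (cube p (Suc m), top_corner (Suc m)) else ?\<Sigma> q"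
  have d2: "deriv (sys ?\<Sigma>) target (card ?S * (2 * m + n + 9)) (sys ?\<Sigma>') target" "level m ?\<Sigma>'"
    using deriv_lower_all[OF fin subset_refl lev m] by auto
  have "deriv (sys \<Sigma>) target (card ?S * (m + 5) + card ?S * (2 * m + n + 9)) (sys ?\<Sigma>') target"
    using deriv_trans[OF d1 d2(1)] .
  moreover have "card ?S * (m + 5) + card ?S * (2 * m + n + 9) = card ?S * (3 * m + n + 14)"
    by (simp add: algebra_simps)
  moreover have "admissible ?\<Sigma>'" using d2(2) unfolding level_def by blast
  moreover have "\<forall>q\<in>?S. low p (Suc m) (?\<Sigma>' q)" using low_cube[of p "Suc m"] by simp
  ultimately show ?thesis by (intro exI[of _ ?\<Sigma>']) auto
qed

lemma controlled_many_slots: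
  assumes "independent T0 j" "T0 > 0" "j \<in> K" "\<Sigma> j = raw p" "card K \<le> T"
    "\<And>q. q \<in> K - {j} \<Longrightarrow> \<Sigma> q = raw p \<or> low p T (\<Sigma> q)"
  shows "controlled p T (sys \<Sigma>) (tag j (Num 1))"
proof -
  obtain h where h: "bij_betw h K {..<card K}" using ex_bij_betw_finite_nat[OF K] atLeast0LessThan by auto
  have "\<exists>w. w \<in> base \<and> \<not> p dvd w j \<and> (\<forall>q\<in>K - {j}. h q = r \<longrightarrow> p dvd w q)" for r
  proof (cases "\<exists>q\<in>K - {j}. h q = r")
    case True
    then obtain q where q: "q \<in> K" "q \<noteq> j" "h q = r" by blast
    obtain w where "w \<in> base" "p dvd w q" "\<not> p dvd w j" using separating[OF assms(1-3) q(1,2)] by blast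
    moreover have "q' = q" if "q' \<in> K" "h q' = r" for q'
      using h q that unfolding bij_betw_def inj_on_def by metis
    ultimately show ?thesis by blast
  next
    case False
    obtain w where "w \<in> base" "w j = 1" using unit[OF assms(3)] by blast
    moreover have "\<not> p dvd 1" using p by (auto dest: prime_gt_1_int)
    ultimately show ?thesis using False by (intro exI[of _ w]) auto
  qed
  then obtain w where w: "\<forall>r. w r \<in> base \<and> \<not> p dvd w r j \<and> (\<forall>q\<in>K - {j}. h q = r \<longrightarrow> p dvd w r q)" by metis
  show ?thesis
  proof (rule controlled_sys[of j \<Sigma> T w])
    fix q assume q: "q \<in> K - {j}"
    have "h q \<in> {..<card K}" using bij_betwE[OF h] q by blast
    then have "h q < T" using assms(5) by simp
    moreover have "p dvd w (h q) q" using w q by blast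
    ultimately show "low p T (\<Sigma> q) \<or> \<Sigma> q = raw p \<and> (\<exists>r<T. p dvd w r q)" using assms(6)[OF q] by blast
  qed (use w assms in auto)
qed

lemma deriv_cubes:
  assumes "finite S" "S \<subseteq> K - {i}"
  defines "C \<equiv> (cube p (card K), top_corner (card K))"
  shows "deriv (sys (\<lambda>_. raw p)) target (card S * Suc (card K)) (sys (\<lambda>q. if q \<in> S then C else raw p)) target"
  using assms(1,2)
proof (induction S rule: finite_induct)
  case empty
  then show ?case using target_position[of "\<lambda>_. raw p"] attachable_raw by (simp add: deriv_refl admissible_def)
next
  case (insert q S)
  let ?\<Sigma> = "\<lambda>q. if q \<in> S then C else raw p"
  have K0: "card K > 0" using K i card_gt_0_iff by blast
  have att: "attachable p (?\<Sigma> x)" for x using attachable_raw attachable_cube by (simp add: C_def)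
  have eq: "?\<Sigma>(q := raw p) = ?\<Sigma>" "?\<Sigma>(q := C) = (\<lambda>x. if x \<in> insert q S then C else raw p)"
    using insert.hyps by auto
  have "controlled p (card K) (sys ?\<Sigma>) (tag q (Num 1))"
    by (rule controlled_many_slots[OF ind[of q "s + 2"]])
      (use insert.prems insert.hyps low_cube[of p "card K"] in \<open>auto simp: C_def\<close>)
  then have "deriv (sys (?\<Sigma>(q := raw p))) (tag q (Num 1)) (card K) (cube p (card K)) (top_corner (card K))"
    unfolding eq using p K0 by (intro deriv_cube linear_system_attach[OF mod_subspace_base att])
  moreover have "?\<Sigma> i = raw p" "q \<in> K" "q \<noteq> i" using insert.prems by auto
  ultimately have d: "deriv (sys ?\<Sigma>) target (Suc (card K)) (sys (?\<Sigma>(q := C))) target"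
    unfolding C_def by (intro deriv_duplicate_raw[OF att[unfolded C_def] _ i])
  have "deriv (sys (\<lambda>_. raw p)) target (card S * Suc (card K)) (sys ?\<Sigma>) target"
    using insert.prems by (intro insert.IH) auto
  from deriv_trans[OF this d] have "deriv (sys (\<lambda>_. raw p)) target (card S * Suc (card K) + Suc (card K))
      (sys (\<lambda>x. if x \<in> insert q S then C else raw p)) target" unfolding eq .
  moreover have "card S * Suc (card K) + Suc (card K) = card (insert q S) * Suc (card K)"
    using insert.hyps by simp
  ultimately show ?case by simp
qed

lemma descend:
  assumes "T \<le> card K" "s + 2 \<le> T"
  shows "\<exists>N \<Sigma>. N \<le> card K * Suc (card K) + (card K - T) * (card K * (3 * card K + n + 14)) \<and>
    deriv (sys (\<lambda>_. raw p)) target N (sys \<Sigma>) target \<and>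
    admissible \<Sigma> \<and> (\<forall>q\<in>K - {i}. low p T (\<Sigma> q))"
  using assms
proof (induction T rule: inc_induct)
  case base
  let ?\<Sigma> = "\<lambda>q. if q \<in> K - {i} then (cube p (card K), top_corner (card K)) else raw p"
  have "deriv (sys (\<lambda>_. raw p)) target (card (K - {i}) * Suc (card K)) (sys ?\<Sigma>) target"
    using K by (intro deriv_cubes) auto
  moreover have "admissible ?\<Sigma>" using attachable_cube attachable_raw by (simp add: admissible_def)
  moreover have "\<forall>q\<in>K - {i}. low p (card K) (?\<Sigma> q)" using low_cube by simp
  moreover have "card (K - {i}) * Suc (card K) \<le> card K * Suc (card K)" using card_rest by (intro mult_right_mono) auto
  ultimately show ?case
    by (intro exI[of _ "card (K - {i}) * Suc (card K)"] exI[of _ ?\<Sigma>]) simp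
next
  case (step T)
  let ?E = "card K * (3 * card K + n + 14)"
  from step obtain N \<Sigma> where N: "N \<le> card K * Suc (card K) + (card K - Suc T) * ?E"
    "deriv (sys (\<lambda>_. raw p)) target N (sys \<Sigma>) target" "admissible \<Sigma>" "\<forall>q\<in>K - {i}. low p (Suc T) (\<Sigma> q)"
    by auto
  obtain m where m: "T = Suc m" using step.prems by (cases T) auto
  obtain \<Sigma>' where \<Sigma>': "deriv (sys \<Sigma>) target (card (K - {i}) * (3 * m + n + 14)) (sys \<Sigma>') target"
    "admissible \<Sigma>'" "\<forall>q\<in>K - {i}. low p (Suc m) (\<Sigma>' q)"
    using deriv_level[OF N(3), of m] N(4) m step by auto
  have "card (K - {i}) * (3 * m + n + 14) \<le> ?E" using card_rest m step.hyps by (intro mult_mono) auto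
  moreover have "(card K - T) * ?E = (card K - Suc T) * ?E + ?E" using step.hyps
    by (metis Suc_diff_Suc add.commute mult_Suc)
  ultimately have "N + card (K - {i}) * (3 * m + n + 14) \<le> card K * Suc (card K) + (card K - T) * ?E"
    using N(1) by linarith
  then show ?case using deriv_trans[OF N(2) \<Sigma>'(1)] \<Sigma>'(2,3) m
    by (intro exI[of _ "N + card (K - {i}) * (3 * m + n + 14)"] exI[of _ \<Sigma>']) simp
qed

text \<open>Few forms are to cost nothing, because for a single form the logarithm of
  \<open>k\<close> in the final bound is 0. The factor 5 covers the initial cubes, the descent, the
  last gadgets and the last chain.\<close>

lemma deriv_controlled:
  "\<exists>N Y y. N \<le> (if card K \<le> s + 1 then 0 else 5 * ((card K)\<^sup>2 * (3 * card K + n + 14))) \<and>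
    deriv (sys (\<lambda>_. raw p)) target N Y y \<and> controlled p (s + 1) Y y"
proof (cases "card K \<le> s + 1")
  case True
  have "controlled p (s + 1) (sys (\<lambda>_. raw p)) target"
    by (rule controlled_many_slots[OF ind_i]) (use True i in auto)
  moreover have "deriv (sys (\<lambda>_. raw p)) target 0 (sys (\<lambda>_. raw p)) target"
    by (rule deriv_refl[OF target_position]) (simp add: attachable_raw admissible_def)
  ultimately show ?thesis using True by (intro exI[of _ 0] exI) auto
next
  case False
  let ?E = "card K * (3 * card K + n + 14)" and ?S = "K - {i}"
  obtain N \<Sigma> where N: "N \<le> card K * Suc (card K) + (card K - (s + 2)) * ?E"
    "deriv (sys (\<lambda>_. raw p)) target N (sys \<Sigma>) target" "admissible \<Sigma>" "\<forall>q\<in>?S. low p (s + 2) (\<Sigma> q)"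
    using descend[of "s + 2"] False by auto
  let ?\<Sigma> = "\<lambda>q. if q \<in> ?S then (gadget p s, port s) else \<Sigma> q"
  have d: "deriv (sys \<Sigma>) target (card ?S * (s + 5)) (sys ?\<Sigma>) target"
    using N K by (intro deriv_gadgets) auto
  have "\<exists>Y y. deriv (sys ?\<Sigma>) target (Suc n) Y y \<and> controlled p (s + 1) Y y"
    by (rule controlled_chain[OF ind_i]) (use False i N(3) in \<open>auto simp: admissible_def\<close>)
  then obtain Y y where Y: "deriv (sys ?\<Sigma>) target (Suc n) Y y" "controlled p (s + 1) Y y" by blast
  have K1: "1 \<le> card K" using False by simp
  have sq: "(card K)\<^sup>2 * (3 * card K + n + 14) = card K * ?E" by (simp add: power2_eq_square)
  have E: "?E \<le> card K * ?E" using K1 by (cases "card K") auto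
  have "card K * Suc (card K) \<le> ?E" by (intro mult_left_mono) auto
  moreover have "(card K - (s + 2)) * ?E \<le> card K * ?E" by (intro mult_right_mono) auto
  moreover have "card ?S * (s + 5) \<le> ?E" using card_rest False by (intro mult_mono) auto
  moreover have "Suc n \<le> ?E" using mult_le_mono[OF K1, of "Suc n" "3 * card K + n + 14"] by simp
  ultimately have "N + (card ?S * (s + 5) + Suc n) \<le> 5 * ((card K)\<^sup>2 * (3 * card K + n + 14))"
    using N(1) E unfolding sq by linarith
  then show ?thesis using deriv_trans[OF N(2) deriv_trans[OF d Y(1)]] Y(2) False
    by (intro exI[of _ "N + (card ?S * (s + 5) + Suc n)"] exI[of _ Y] exI[of _ y]) simp
qed

end

subsection \<open>From systems to linear data\<close>

locale prime_field =
  fixes p :: nat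
  assumes prime_p: "prime p"
begin

lemma p_pos: "int p > 0"
  using prime_p prime_gt_0_nat by simp

lemma residues_prime: "residues_prime p"
  using prime_p by (simp add: residues_prime_def)

lemma field_Fp: "field (Fp p)"
  by (rule residues_prime.is_field[OF residues_prime])

lemma ring_Fp: "ring (Fp p)" and cring_Fp: "cring (Fp p)"
  using field_Fp by (simp_all add: field_def domain_def cring_def)

lemma Fp_simps [simp]:
  "carrier (Fp p) = {0..int p - 1}" "x \<otimes>\<^bsub>Fp p\<^esub> y = (x * y) mod int p" "x \<oplus>\<^bsub>Fp p\<^esub> y = (x + y) mod int p"
  "\<one>\<^bsub>Fp p\<^esub> = 1" "\<zero>\<^bsub>Fp p\<^esub> = 0"
  by (simp_all add: residue_ring_def)

lemma coord_simps [simp]: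
  "carrier (coord_space p n) = {1..n} \<rightarrow>\<^sub>E {0..int p - 1}"
  "v \<oplus>\<^bsub>coord_space p n\<^esub> w = (\<lambda>l\<in>{1..n}. (v l + w l) mod int p)"
  "c \<odot>\<^bsub>coord_space p n\<^esub> v = (\<lambda>l\<in>{1..n}. (c * v l) mod int p)"
  "\<zero>\<^bsub>coord_space p n\<^esub> = (\<lambda>l\<in>{1..n}. 0)"
  by (simp_all add: coord_space_def ring.func_space_def[OF ring_Fp])

lemma mod_carrier [simp]: "x mod int p \<in> {0..int p - 1}"
  using p_pos by simp

lemma finite_coord: "finite (carrier (coord_space p n))"
  by (simp add: finite_PiE)

lemma vectorspace_coord: "vectorspace (Fp p) (coord_space p n)"
  using cring.func_space_is_module[OF cring_Fp, of "{1..n}"] field_Fp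
  by (simp add: coord_space_def vectorspace_def)

lemma fd_space_finite:
  assumes V: "vectorspace (Fp p) V" and fin: "finite (carrier V)"
  shows "fd_space p V"
proof -
  interpret V: vectorspace "Fp p" V by (rule V)
  have "V.span (carrier V) = carrier V"
    using V.span_is_subset2[of "carrier V"] V.in_own_span[of "carrier V"] by auto
  then show ?thesis using V fin unfolding fd_space_def V.fin_dim_def by blast
qed

lemma linear_mapI:
  assumes "vectorspace (Fp p) V" "vectorspace (Fp p) W"
    "\<And>v. v \<in> carrier V \<Longrightarrow> f v \<in> carrier W"
    "\<And>v w. v \<in> carrier V \<Longrightarrow> w \<in> carrier V \<Longrightarrow> f (v \<oplus>\<^bsub>V\<^esub> w) = f v \<oplus>\<^bsub>W\<^esub> f w"
    "\<And>c v. c \<in> {0..int p - 1} \<Longrightarrow> v \<in> carrier V \<Longrightarrow> f (c \<odot>\<^bsub>V\<^esub> v) = c \<odot>\<^bsub>W\<^esub> f v"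
  shows "linear_map (Fp p) V W f"
proof -
  have "f \<in> module_hom (Fp p) V W" using assms by (simp add: module_hom_def Pi_iff)
  then show ?thesis using assms(1,2)
    by (simp add: linear_map_def mod_hom_def mod_hom_axioms_def vectorspace_def)
qed

lemma linear_mapD:
  assumes "linear_map (Fp p) V W f"
  shows "\<And>v. v \<in> carrier V \<Longrightarrow> f v \<in> carrier W"
    "\<And>v w. v \<in> carrier V \<Longrightarrow> w \<in> carrier V \<Longrightarrow> f (v \<oplus>\<^bsub>V\<^esub> w) = f v \<oplus>\<^bsub>W\<^esub> f w"
    "\<And>c v. c \<in> {0..int p - 1} \<Longrightarrow> v \<in> carrier V \<Longrightarrow> f (c \<odot>\<^bsub>V\<^esub> v) = c \<odot>\<^bsub>W\<^esub> f v"
  using assms by (auto simp: linear_map_def mod_hom_def mod_hom_axioms_def module_hom_def Pi_iff)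

lemma scalar_add: "scalar (x mod int p) \<oplus>\<^bsub>coord_space p 1\<^esub> scalar (y mod int p) = scalar ((x + y) mod int p)"
  by (auto simp: scalar_def mod_add_eq)

lemma scalar_smult: "c \<odot>\<^bsub>coord_space p 1\<^esub> scalar (y mod int p) = scalar ((c * y) mod int p)"
  by (auto simp: scalar_def mod_mult_right_eq)

lemma scalar_carrier: "scalar (x mod int p) \<in> carrier (coord_space p 1)"
  using p_pos by (simp add: scalar_def)

text \<open>All targets are literally \<open>coord_space p 1\<close>, since respecting an index
  demands equal spaces. Finiteness of the source passes to joined spaces and implies finite
  dimension.\<close>

definition scalar_datum :: "datum \<Rightarrow> bool" where
  "scalar_datum \<Delta> \<longleftrightarrow> finite (idx \<Delta>) \<and> vectorspace (Fp p) (src \<Delta>) \<and> finite (carrier (src \<Delta>)) \<and>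
     (\<forall>z\<in>idx \<Delta>. tgt \<Delta> z = coord_space p 1 \<and> linear_map (Fp p) (src \<Delta>) (coord_space p 1) (dmap \<Delta> z))"

lemma linear_datum_scalar: "scalar_datum \<Delta> \<Longrightarrow> linear_datum p \<Delta>"
  by (simp add: scalar_datum_def linear_datum_def fd_space_finite vectorspace_coord finite_coord del: coord_simps)

text \<open>Integer labels stand for residues, so closure under congruence is built in.\<close>

definition value_system :: "datum \<Rightarrow> system" where
  "value_system \<Delta> = \<lparr> positions = idx \<Delta>,
     labels = {l. \<exists>v\<in>carrier (src \<Delta>). \<forall>z\<in>idx \<Delta>. dmap \<Delta> z v = scalar (l z mod int p)} \<rparr>"

lemma left_pair [simp]: "left (pair v w) = v" and right_pair [simp]: "right (pair v w) = w"
  by (simp_all add: left_def right_def pair_def comp_def)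

lemma pair_eq_iff [simp]: "pair v w = pair v' w' \<longleftrightarrow> v = v' \<and> w = w'"
  by (metis left_pair right_pair)

lemma vectorspace_joined:
  assumes \<Delta>: "scalar_datum \<Delta>" and S: "S \<subseteq> idx \<Delta>"
  shows "vectorspace (Fp p) (joined_space \<Delta> S)"
proof -
  interpret V: vectorspace "Fp p" "src \<Delta>" using \<Delta> by (simp add: scalar_datum_def)
  let ?V = "src \<Delta>" and ?J = "joined_space \<Delta> S"
  have lin: "linear_map (Fp p) ?V (coord_space p 1) (dmap \<Delta> z)" if "z \<in> S" for z
    using \<Delta> S that by (auto simp: scalar_datum_def)
  have carr: "v \<in> carrier ?J \<longleftrightarrow> (\<exists>x\<in>carrier ?V. \<exists>y\<in>carrier ?V. v = pair x y \<and> (\<forall>z\<in>S. dmap \<Delta> z x = dmap \<Delta> z y))" for v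
    by (auto simp: joined_space_def)
  have add: "pair x y \<oplus>\<^bsub>?J\<^esub> pair x' y' = pair (x \<oplus>\<^bsub>?V\<^esub> x') (y \<oplus>\<^bsub>?V\<^esub> y')" for x y x' y'
    by (simp add: joined_space_def)
  have smult: "c \<odot>\<^bsub>?J\<^esub> pair x y = pair (c \<odot>\<^bsub>?V\<^esub> x) (c \<odot>\<^bsub>?V\<^esub> y)" for c x y
    by (simp add: joined_space_def)
  have zero: "\<zero>\<^bsub>?J\<^esub> = pair \<zero>\<^bsub>?V\<^esub> \<zero>\<^bsub>?V\<^esub>" by (simp add: joined_space_def)
  have "module (Fp p) ?J"
  proof (rule module_criteria[OF cring_Fp])
    show "\<zero>\<^bsub>?J\<^esub> \<in> carrier ?J" unfolding carr zero by blast
    show "\<forall>v w. v \<in> carrier ?J \<and> w \<in> carrier ?J \<longrightarrow> v \<oplus>\<^bsub>?J\<^esub> w \<in> carrier ?J"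
      unfolding carr by (auto simp: add linear_mapD(2)[OF lin] simp del: coord_simps)
    show "\<forall>c v. c \<in> carrier (Fp p) \<and> v \<in> carrier ?J \<longrightarrow> c \<odot>\<^bsub>?J\<^esub> v \<in> carrier ?J"
      unfolding carr by (auto simp: smult linear_mapD(3)[OF lin] simp del: coord_simps)
    show "\<forall>v\<in>carrier ?J. \<exists>w\<in>carrier ?J. v \<oplus>\<^bsub>?J\<^esub> w = \<zero>\<^bsub>?J\<^esub>"
    proof
      fix v assume "v \<in> carrier ?J"
      then obtain x y where v: "x \<in> carrier ?V" "y \<in> carrier ?V" "v = pair x y" "\<forall>z\<in>S. dmap \<Delta> z x = dmap \<Delta> z y"
        unfolding carr by blast
      have "dmap \<Delta> z (\<ominus>\<^bsub>?V\<^esub> x) = dmap \<Delta> z (\<ominus>\<^bsub>?V\<^esub> y)" if "z \<in> S" for z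
      proof -
        interpret D: linear_map "Fp p" ?V "coord_space p 1" "dmap \<Delta> z" by (rule lin[OF that])
        show ?thesis using v that by (simp add: D.T_neg del: coord_simps)
      qed
      then show "\<exists>w\<in>carrier ?J. v \<oplus>\<^bsub>?J\<^esub> w = \<zero>\<^bsub>?J\<^esub>"
        using v by (intro bexI[of _ "pair (\<ominus>\<^bsub>?V\<^esub> x) (\<ominus>\<^bsub>?V\<^esub> y)"]) (auto simp: carr add zero V.r_neg)
    qed
    show "\<forall>v w. v \<in> carrier ?J \<and> w \<in> carrier ?J \<longrightarrow> v \<oplus>\<^bsub>?J\<^esub> w = w \<oplus>\<^bsub>?J\<^esub> v"
      unfolding carr by (auto simp: add V.a_comm)
    show "\<forall>u v w. u \<in> carrier ?J \<and> v \<in> carrier ?J \<and> w \<in> carrier ?J \<longrightarrow>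
        u \<oplus>\<^bsub>?J\<^esub> v \<oplus>\<^bsub>?J\<^esub> w = u \<oplus>\<^bsub>?J\<^esub> (v \<oplus>\<^bsub>?J\<^esub> w)"
      unfolding carr by (auto simp: add V.a_assoc)
    show "\<forall>v\<in>carrier ?J. v \<oplus>\<^bsub>?J\<^esub> \<zero>\<^bsub>?J\<^esub> = v" by (auto simp: carr add zero)
    show "\<forall>a b v. a \<in> carrier (Fp p) \<and> b \<in> carrier (Fp p) \<and> v \<in> carrier ?J \<longrightarrow>
        (a \<otimes>\<^bsub>Fp p\<^esub> b) \<odot>\<^bsub>?J\<^esub> v = a \<odot>\<^bsub>?J\<^esub> (b \<odot>\<^bsub>?J\<^esub> v)"
      unfolding carr by (auto simp: smult V.smult_assoc1 simp del: Fp_simps)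
    show "\<forall>v\<in>carrier ?J. \<one>\<^bsub>Fp p\<^esub> \<odot>\<^bsub>?J\<^esub> v = v" by (auto simp: carr smult simp del: Fp_simps)
    show "\<forall>a b v. a \<in> carrier (Fp p) \<and> b \<in> carrier (Fp p) \<and> v \<in> carrier ?J \<longrightarrow>
        (a \<oplus>\<^bsub>Fp p\<^esub> b) \<odot>\<^bsub>?J\<^esub> v = a \<odot>\<^bsub>?J\<^esub> v \<oplus>\<^bsub>?J\<^esub> b \<odot>\<^bsub>?J\<^esub> v"
      unfolding carr by (auto simp: smult add V.smult_l_distr simp del: Fp_simps)
    show "\<forall>a v w. a \<in> carrier (Fp p) \<and> v \<in> carrier ?J \<and> w \<in> carrier ?J \<longrightarrow>
        a \<odot>\<^bsub>?J\<^esub> (v \<oplus>\<^bsub>?J\<^esub> w) = a \<odot>\<^bsub>?J\<^esub> v \<oplus>\<^bsub>?J\<^esub> a \<odot>\<^bsub>?J\<^esub> w"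
      unfolding carr by (auto simp: smult add V.smult_r_distr simp del: Fp_simps)
  qed
  then show ?thesis using field_Fp by (simp add: vectorspace_def)
qed

lemma scalar_datum_self_join:
  assumes \<Delta>: "scalar_datum \<Delta>" and S: "S \<subseteq> idx \<Delta>"
  shows "scalar_datum (self_join \<Delta> S)"
proof -
  let ?J = "joined_space \<Delta> S"
  have "carrier ?J \<subseteq> (\<lambda>(v, w). pair v w) ` (carrier (src \<Delta>) \<times> carrier (src \<Delta>))"
    by (auto simp: joined_space_def)
  then have fin: "finite (carrier ?J)" using \<Delta> finite_subset by (fastforce simp: scalar_datum_def)
  have lin: "linear_map (Fp p) (src \<Delta>) (coord_space p 1) (dmap \<Delta> z)" if "z \<in> idx \<Delta>" for z
    using \<Delta> that by (simp add: scalar_datum_def)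
  have parts: "left v \<in> carrier (src \<Delta>)" "right v \<in> carrier (src \<Delta>)" if "v \<in> carrier ?J" for v
    using that by (auto simp: joined_space_def)
  have L: "linear_map (Fp p) ?J (coord_space p 1) (\<lambda>v. dmap \<Delta> z (left v))"
    and R: "linear_map (Fp p) ?J (coord_space p 1) (\<lambda>v. dmap \<Delta> z (right v))" if z: "z \<in> idx \<Delta>" for z
  proof -
    note D = linear_mapD[OF lin[OF z]]
    have J: "left (v \<oplus>\<^bsub>?J\<^esub> w) = left v \<oplus>\<^bsub>src \<Delta>\<^esub> left w" "right (v \<oplus>\<^bsub>?J\<^esub> w) = right v \<oplus>\<^bsub>src \<Delta>\<^esub> right w"
      "left (c \<odot>\<^bsub>?J\<^esub> v) = c \<odot>\<^bsub>src \<Delta>\<^esub> left v" "right (c \<odot>\<^bsub>?J\<^esub> v) = c \<odot>\<^bsub>src \<Delta>\<^esub> right v" for v w c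
      by (simp_all add: joined_space_def)
    show "linear_map (Fp p) ?J (coord_space p 1) (\<lambda>v. dmap \<Delta> z (left v))"
      by (rule linear_mapI[OF vectorspace_joined[OF \<Delta> S] vectorspace_coord])
        (simp_all only: J D parts)
    show "linear_map (Fp p) ?J (coord_space p 1) (\<lambda>v. dmap \<Delta> z (right v))"
      by (rule linear_mapI[OF vectorspace_joined[OF \<Delta> S] vectorspace_coord])
        (simp_all only: J D parts)
  qed
  show ?thesis
    unfolding scalar_datum_def self_join_def
    using \<Delta> fin L R vectorspace_joined[OF \<Delta> S] by (auto simp: scalar_datum_def simp del: coord_simps)
qed

text \<open>Only one inclusion of label sets is needed: two labellings agreeing on \<open>S\<close>
  come from two vectors that form an element of the joined space.\<close>

lemma specializes_self_join:
  assumes \<Delta>: "scalar_datum \<Delta>" and S: "S \<subseteq> idx \<Delta>" and x: "x \<in> idx \<Delta> - S"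
  shows "specializes (value_system (self_join \<Delta> S)) (Left x) (double (value_system \<Delta>) S) (Left x)"
proof (rule specializesI[where f = id and c = "\<lambda>_. 1"])
  show "Left x \<in> positions (value_system (self_join \<Delta> S))"
    "Left x \<in> positions (double (value_system \<Delta>) S)"
    using x by (auto simp: value_system_def self_join_def)
next
  fix l assume "l \<in> labels (double (value_system \<Delta>) S)"
  then obtain g h where gh: "g \<in> labels (value_system \<Delta>)" "h \<in> labels (value_system \<Delta>)" "\<forall>x\<in>S. g x = h x"
    "\<forall>x\<in>idx \<Delta> - S. l (Left x) = g x \<and> l (Right x) = h x"
    by (auto simp: double_def value_system_def)
  then obtain v w where v: "v \<in> carrier (src \<Delta>)" "\<forall>z\<in>idx \<Delta>. dmap \<Delta> z v = scalar (g z mod int p)"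
    and w: "w \<in> carrier (src \<Delta>)" "\<forall>z\<in>idx \<Delta>. dmap \<Delta> z w = scalar (h z mod int p)"
    by (auto simp: value_system_def)
  have "pair v w \<in> carrier (joined_space \<Delta> S)"
    using v w gh(3) S by (auto simp: joined_space_def)
  then show "(\<lambda>z. 1 * l (id z)) \<in> labels (value_system (self_join \<Delta> S))"
    using v w gh(4) unfolding value_system_def self_join_def
    by (auto intro!: bexI[of _ "pair v w"])
qed (auto simp: value_system_def self_join_def)

text \<open>The linear map whose columns are \<open>v 1, ..., v n\<close>, defined by recursion
  because the space \<open>V\<close> is an abstract structure.\<close>

primrec partial_comb :: "space \<Rightarrow> (nat \<Rightarrow> vector) \<Rightarrow> nat \<Rightarrow> vector \<Rightarrow> vector" where
  "partial_comb V v 0 y = \<zero>\<^bsub>V\<^esub>"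
| "partial_comb V v (Suc n) y = partial_comb V v n y \<oplus>\<^bsub>V\<^esub> y (Suc n) \<odot>\<^bsub>V\<^esub> v (Suc n)"

lemma partial_comb:
  assumes V: "vectorspace (Fp p) V" and v: "\<And>l. l \<in> {1..n} \<Longrightarrow> v l \<in> carrier V" and "m \<le> n"
  shows "y \<in> carrier (coord_space p n) \<Longrightarrow> partial_comb V v m y \<in> carrier V"
    and "y \<in> carrier (coord_space p n) \<Longrightarrow> z \<in> carrier (coord_space p n) \<Longrightarrow>
      partial_comb V v m (y \<oplus>\<^bsub>coord_space p n\<^esub> z) = partial_comb V v m y \<oplus>\<^bsub>V\<^esub> partial_comb V v m z"
    and "y \<in> carrier (coord_space p n) \<Longrightarrow> c \<in> {0..int p - 1} \<Longrightarrow>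
      partial_comb V v m (c \<odot>\<^bsub>coord_space p n\<^esub> y) = c \<odot>\<^bsub>V\<^esub> partial_comb V v m y"
    and "y \<in> carrier (coord_space p n) \<Longrightarrow> linear_map (Fp p) V (coord_space p 1) f \<Longrightarrow>
      (\<And>l. l \<in> {1..n} \<Longrightarrow> f (v l) = scalar (g l mod int p)) \<Longrightarrow>
      f (partial_comb V v m y) = scalar ((\<Sum>l=1..m. y l * g l) mod int p)"
proof -
  interpret V: vectorspace "Fp p" V by (rule V)
  have yl: "y l \<in> carrier (Fp p)" if "y \<in> carrier (coord_space p n)" "l \<in> {1..n}" for y l
    using that by auto
  have closed: "partial_comb V v m y \<in> carrier V" if "m \<le> n" "y \<in> carrier (coord_space p n)" for m y
    using that(1)
  proof (induction m)
    case (Suc m)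
    then have "y (Suc m) \<in> carrier (Fp p)" "v (Suc m) \<in> carrier V" using yl[OF that(2)] v by auto
    then show ?case using Suc by (simp del: Fp_simps)
  qed simp
  show "partial_comb V v m y \<in> carrier V" if "y \<in> carrier (coord_space p n)"
    using closed \<open>m \<le> n\<close> that by blast
  show "partial_comb V v m (y \<oplus>\<^bsub>coord_space p n\<^esub> z) = partial_comb V v m y \<oplus>\<^bsub>V\<^esub> partial_comb V v m z"
    if y: "y \<in> carrier (coord_space p n)" and z: "z \<in> carrier (coord_space p n)"
    using \<open>m \<le> n\<close>
  proof (induction m)
    case (Suc m)
    have l: "Suc m \<in> {1..n}" using Suc.prems by simp
    have "(y \<oplus>\<^bsub>coord_space p n\<^esub> z) (Suc m) = y (Suc m) \<oplus>\<^bsub>Fp p\<^esub> z (Suc m)" using l by simp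
    then show ?case using Suc closed[of m y] closed[of m z] yl[OF y l] yl[OF z l] v[OF l] y z
      by (simp add: V.smult_l_distr V.a_ac del: Fp_simps coord_simps)
  qed simp
  show "partial_comb V v m (c \<odot>\<^bsub>coord_space p n\<^esub> y) = c \<odot>\<^bsub>V\<^esub> partial_comb V v m y"
    if y: "y \<in> carrier (coord_space p n)" and "c \<in> {0..int p - 1}"
    using \<open>m \<le> n\<close>
  proof (induction m)
    case 0
    have "c \<in> carrier (Fp p)" using that by simp
    then show ?case by (simp del: Fp_simps coord_simps)
  next
    case (Suc m)
    have c: "c \<in> carrier (Fp p)" using that by simp
    have l: "Suc m \<in> {1..n}" using Suc.prems by simp
    have "(c \<odot>\<^bsub>coord_space p n\<^esub> y) (Suc m) = c \<otimes>\<^bsub>Fp p\<^esub> y (Suc m)" using l by simp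
    then show ?case using Suc closed[of m y] yl[OF y l] v[OF l] y c
      by (simp add: V.smult_r_distr V.smult_assoc1 del: Fp_simps coord_simps)
  qed
  show "f (partial_comb V v m y) = scalar ((\<Sum>l=1..m. y l * g l) mod int p)"
    if y: "y \<in> carrier (coord_space p n)" and f: "linear_map (Fp p) V (coord_space p 1) f"
      and g: "\<And>l. l \<in> {1..n} \<Longrightarrow> f (v l) = scalar (g l mod int p)"
    using \<open>m \<le> n\<close>
  proof (induction m)
    case 0
    interpret f: linear_map "Fp p" V "coord_space p 1" f by (rule f)
    have "f \<zero>\<^bsub>V\<^esub> = \<zero>\<^bsub>coord_space p 1\<^esub>" by (rule f.f0_is_0)
    then show ?case by (simp add: scalar_def)
  next
    case (Suc m)
    have l: "Suc m \<in> {1..n}" using Suc.prems by simp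
    have "f (partial_comb V v (Suc m) y) = f (partial_comb V v m y) \<oplus>\<^bsub>coord_space p 1\<^esub> y (Suc m) \<odot>\<^bsub>coord_space p 1\<^esub> f (v (Suc m))"
      using linear_mapD(2,3)[OF f] closed[of m y] yl[OF y l] v[OF l] y Suc.prems V.smult_closed
      by (simp del: coord_simps)
    also have "\<dots> = scalar ((\<Sum>l=1..Suc m. y l * g l) mod int p)"
      using Suc by (simp only: g[OF l] scalar_smult scalar_add Suc_leD) (simp add: scalar_def)
    finally show ?case .
  qed
qed

lemma linear_map_partial_comb:
  assumes V: "vectorspace (Fp p) V" and v: "\<And>l. l \<in> {1..n} \<Longrightarrow> v l \<in> carrier V"
  shows "linear_map (Fp p) (coord_space p n) V (partial_comb V v n)"
  by (rule linear_mapI[OF vectorspace_coord V])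
    (rule partial_comb(1-3)[OF V v order_refl]; assumption)+

lemma linear_map_functional:
  "linear_map (Fp p) (coord_space p n) (coord_space p 1) (\<lambda>y. scalar ((\<Sum>l=1..n. y l * g l) mod int p))"
proof (rule linear_mapI[OF vectorspace_coord vectorspace_coord])
  fix v w assume "v \<in> carrier (coord_space p n)" "w \<in> carrier (coord_space p n)"
  have "[(\<Sum>l=1..n. (v \<oplus>\<^bsub>coord_space p n\<^esub> w) l * g l) = (\<Sum>l=1..n. (v l + w l) * g l)] (mod int p)"
    by (rule cong_sum) (simp add: cong_def mod_mult_left_eq)
  then show "scalar ((\<Sum>l=1..n. (v \<oplus>\<^bsub>coord_space p n\<^esub> w) l * g l) mod int p) =
      scalar ((\<Sum>l=1..n. v l * g l) mod int p) \<oplus>\<^bsub>coord_space p 1\<^esub> scalar ((\<Sum>l=1..n. w l * g l) mod int p)"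
    unfolding scalar_add cong_def by (simp add: distrib_right sum.distrib)
next
  fix c v
  have "[(\<Sum>l=1..n. (c \<odot>\<^bsub>coord_space p n\<^esub> v) l * g l) = (\<Sum>l=1..n. (c * v l) * g l)] (mod int p)"
    by (rule cong_sum) (simp add: cong_def mod_mult_left_eq)
  then show "scalar ((\<Sum>l=1..n. (c \<odot>\<^bsub>coord_space p n\<^esub> v) l * g l) mod int p) =
      c \<odot>\<^bsub>coord_space p 1\<^esub> scalar ((\<Sum>l=1..n. v l * g l) mod int p)"
    unfolding scalar_smult cong_def by (simp add: sum_distrib_left mult.assoc)
qed (rule scalar_carrier)

abbreviation skip :: "nat \<Rightarrow> nat \<Rightarrow> nat" where
  "skip r l \<equiv> if l < r then l else l + 1"

lemma sum_skip:
  fixes g :: "nat \<Rightarrow> int"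
  assumes "r \<in> {1..Suc s}"
  shows "(\<Sum>l=1..Suc s. g l) = g r + (\<Sum>l=1..s. g (skip r l))"
proof -
  have "(\<Sum>l\<in>{1..Suc s} - {r}. g l) = (\<Sum>l=1..s. g (skip r l))"
    by (rule sum.reindex_bij_witness[of _ "skip r" "\<lambda>l. if l < r then l else l - 1"]) (use assms in auto)
  then show ?thesis using assms by (subst sum.remove[of _ r]) auto
qed

lemma linear_datum_gc: "linear_datum p (gc p s)"
proof -
  have tri: "linear_map (Fp p) (coord_space p (s + 1)) (coord_space p 1) (\<lambda>v. scalar ((\<Sum>l=1..s+1. v l) mod int p))"
    using linear_map_functional[of "s + 1" "\<lambda>_. 1"] by simp
  have num: "linear_map (Fp p) (coord_space p (s + 1)) (coord_space p s) (\<lambda>v. \<lambda>l\<in>{1..s}. if l < r then v l else v (l + 1))"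
    for r
    by (rule linear_mapI[OF vectorspace_coord vectorspace_coord]) (auto simp: PiE_iff fun_eq_iff)
  show ?thesis
    unfolding linear_datum_def gc_def
    using tri num fd_space_finite[OF vectorspace_coord finite_coord] by (auto simp del: coord_simps)
qed

text \<open>The \<open>s + 1\<close> labellings become the columns of \<open>\<theta>\<close>. At
  \<open>x\<close> all of them are 1, which gives the sum of coordinates; at any other index one
  column vanishes, so the map factors through omitting that coordinate.\<close>

lemma derives_gc_of_controlled:
  assumes \<Delta>: "scalar_datum \<Delta>" and c: "controlled (int p) (s + 1) (value_system \<Delta>) x"
  shows "\<exists>\<gamma>. derives p \<Delta> 0 \<gamma> (gc p s) \<and> \<gamma> Triangle = Some (x, 0)"
proof -
  let ?V = "src \<Delta>"
  interpret V: vectorspace "Fp p" ?V using \<Delta> by (simp add: scalar_datum_def)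
  have V: "vectorspace (Fp p) ?V" using \<Delta> by (simp add: scalar_datum_def)
  have lin: "linear_map (Fp p) ?V (coord_space p 1) (dmap \<Delta> z)" if "z \<in> idx \<Delta>" for z
    using \<Delta> that by (simp add: scalar_datum_def)
  from c obtain k l where x: "x \<in> idx \<Delta>" and l: "\<forall>r<s+1. l r \<in> labels (value_system \<Delta>)"
    "\<forall>r<s+1. l r x = k r" "\<forall>r<s+1. \<not> int p dvd k r" "\<forall>z\<in>idx \<Delta> - {x}. \<exists>r<s+1. int p dvd l r z"
    unfolding controlled_def supports_def by (auto simp: value_system_def)
  have "\<forall>r. \<exists>u. r < s + 1 \<longrightarrow> [u * l r x = 1] (mod int p)"
    using ex_inverse_mod[of "int p"] prime_p l(2,3) by auto
  then obtain u where u: "\<forall>r<s+1. [u r * l r x = 1] (mod int p)" by metis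
  have "\<forall>r. \<exists>v. r < s + 1 \<longrightarrow> v \<in> carrier ?V \<and> (\<forall>z\<in>idx \<Delta>. dmap \<Delta> z v = scalar (l r z mod int p))"
    using l(1) unfolding value_system_def by (simp add: Bex_def)
  then obtain v0 where v0: "\<forall>r<s+1. v0 r \<in> carrier ?V \<and> (\<forall>z\<in>idx \<Delta>. dmap \<Delta> z (v0 r) = scalar (l r z mod int p))"
    by metis
  \<comment> \<open>Slots are numbered from 0, the coordinates of \<open>gc\<close> from 1.\<close>
  define v where "v r = (u (r - 1) mod int p) \<odot>\<^bsub>?V\<^esub> v0 (r - 1)" for r
  define g where "g z r = u (r - 1) mod int p * l (r - 1) z" for z r
  have v: "v r \<in> carrier ?V" "z \<in> idx \<Delta> \<Longrightarrow> dmap \<Delta> z (v r) = scalar (g z r mod int p)" if "r \<in> {1..s+1}" for r z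
  proof -
    have r: "v0 (r - 1) \<in> carrier ?V" "\<forall>z\<in>idx \<Delta>. dmap \<Delta> z (v0 (r - 1)) = scalar (l (r - 1) z mod int p)"
      using v0 that by auto
    have m: "u (r - 1) mod int p \<in> carrier (Fp p)" unfolding Fp_simps by (rule mod_carrier)
    show "v r \<in> carrier ?V" unfolding v_def using V.smult_closed[OF m r(1)] .
    show "dmap \<Delta> z (v r) = scalar (g z r mod int p)" if "z \<in> idx \<Delta>"
      unfolding v_def g_def linear_mapD(3)[OF lin[OF that] mod_carrier r(1)] using r(2) that scalar_smult by simp
  qed
  define \<theta> where "\<theta> = partial_comb ?V v (s + 1)"
  have \<theta>: "linear_map (Fp p) (coord_space p (s + 1)) ?V \<theta>"
    unfolding \<theta>_def by (rule linear_map_partial_comb[OF V v(1)])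
  have val: "dmap \<Delta> z (\<theta> y) = scalar ((\<Sum>l=1..s+1. y l * g z l) mod int p)"
    if "z \<in> idx \<Delta>" "y \<in> carrier (coord_space p (s + 1))" for z y
    unfolding \<theta>_def by (rule partial_comb(4)[OF V v(1) order_refl that(2) lin[OF that(1)] v(2)[OF _ that(1)]])
  have "\<forall>z\<in>idx \<Delta> - {x}. \<exists>r. r \<in> {1..Suc s} \<and> int p dvd g z r"
  proof
    fix z assume "z \<in> idx \<Delta> - {x}"
    then obtain r where "r < s + 1" "int p dvd l r z" using l(4) by blast
    then show "\<exists>r. r \<in> {1..Suc s} \<and> int p dvd g z r" by (intro exI[of _ "Suc r"]) (simp add: g_def)
  qed
  then obtain R where R: "\<forall>z\<in>idx \<Delta> - {x}. R z \<in> {1..Suc s} \<and> int p dvd g z (R z)" by metis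
  define \<alpha> where "\<alpha> z = (if z = x then Some Triangle else Some (Num (R z)))" for z
  define \<sigma> where "\<sigma> z w = (if z = x then w else scalar ((\<Sum>l=1..s. w l * g z (skip (R z) l)) mod int p))" for z w
  have gx: "[g x r = 1] (mod int p)" if "r \<in> {1..s+1}" for r
  proof -
    have "[g x r = u (r - 1) * l (r - 1) x] (mod int p)" by (simp add: g_def cong_def mod_mult_left_eq)
    moreover have "r - 1 < s + 1" using that by auto
    ultimately show ?thesis using u cong_trans by blast
  qed
  have "morphism p (gc p s) \<Delta> \<alpha> \<theta> \<sigma>"
    unfolding morphism_def
  proof (intro conjI ballI)
    show "\<alpha> ` idx \<Delta> \<subseteq> insert None (Some ` idx (gc p s))" using R by (auto simp: \<alpha>_def gc_def)
    show "linear_map (Fp p) (src (gc p s)) (src \<Delta>) \<theta>" using \<theta> by (simp add: gc_def del: coord_simps)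
  next
    fix z assume z: "z \<in> idx \<Delta>"
    have tgt: "tgt \<Delta> z = coord_space p 1" using \<Delta> z by (simp add: scalar_datum_def del: coord_simps)
    show "linear_map (Fp p) (tgt_opt p (gc p s) (\<alpha> z)) (tgt \<Delta> z) (\<sigma> z)"
    proof (cases "z = x")
      case True
      then have "\<sigma> z = (\<lambda>w. w)" by (auto simp: \<sigma>_def)
      moreover have "linear_map (Fp p) (coord_space p 1) (coord_space p 1) (\<lambda>w. w)"
        by (rule linear_mapI[OF vectorspace_coord vectorspace_coord]; (assumption | rule refl))
      ultimately show ?thesis using True tgt by (simp add: \<alpha>_def gc_def del: coord_simps)
    next
      case False
      then have "\<sigma> z = (\<lambda>w. scalar ((\<Sum>l=1..s. w l * g z (skip (R z) l)) mod int p))" by (auto simp: \<sigma>_def)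
      then show ?thesis using False tgt linear_map_functional[of s "\<lambda>l. g z (skip (R z) l)"]
        by (simp add: \<alpha>_def gc_def del: coord_simps)
    qed
    fix y assume "y \<in> carrier (src (gc p s))"
    then have y: "y \<in> carrier (coord_space p (s + 1))" by (simp add: gc_def del: coord_simps)
    show "\<sigma> z (dmap_opt p (gc p s) (\<alpha> z) y) = dmap \<Delta> z (\<theta> y)"
    proof (cases "z = x")
      case True
      have "[(\<Sum>l=1..s+1. y l * g x l) = (\<Sum>l=1..s+1. y l * 1)] (mod int p)"
        by (intro cong_sum cong_scalar_left gx)
      then show ?thesis unfolding val[OF z y] using True by (simp add: \<alpha>_def \<sigma>_def gc_def cong_def)
    next
      case False
      then have Rz: "R z \<in> {1..Suc s}" "int p dvd g z (R z)" using R z by auto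
      have "[(\<Sum>l=1..Suc s. y l * g z l) = (\<Sum>l=1..s. y (skip (R z) l) * g z (skip (R z) l))] (mod int p)"
        unfolding sum_skip[OF Rz(1)] using Rz(2) by (simp add: cong_iff_dvd_diff)
      moreover have "\<sigma> z (dmap_opt p (gc p s) (\<alpha> z) y) =
          scalar ((\<Sum>l=1..s. y (skip (R z) l) * g z (skip (R z) l)) mod int p)"
        using False unfolding \<alpha>_def \<sigma>_def gc_def
        by (simp cong: sum.cong) (rule arg_cong[where f = "\<lambda>t. scalar (t mod int p)"], rule sum.cong, auto)
      ultimately show ?thesis unfolding val[OF z y] by (simp add: cong_def)
    qed
  qed
  \<comment> \<open>The map is forced by the morphism; \<open>THE\<close> is legitimate because a
    respected index shares its image with no other index.\<close>
  moreover define \<gamma> where "\<gamma> t = (if \<exists>z. respects_index (gc p s) \<Delta> \<alpha> \<sigma> z \<and> \<alpha> z = Some t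
      then Some (THE z. respects_index (gc p s) \<Delta> \<alpha> \<sigma> z \<and> \<alpha> z = Some t, 0::bit) else None)" for t
  moreover have unique: "z = z'" if "respects_index (gc p s) \<Delta> \<alpha> \<sigma> z \<and> \<alpha> z = Some t"
    "respects_index (gc p s) \<Delta> \<alpha> \<sigma> z' \<and> \<alpha> z' = Some t" for z z' t
    using that unfolding respects_index_def by (metis option.inject)
  have \<gamma>: "\<gamma> t = Some (z, e) \<longleftrightarrow> respects_index (gc p s) \<Delta> \<alpha> \<sigma> z \<and> \<alpha> z = Some t \<and> e = 0" for t z e
  proof (cases "\<exists>z. respects_index (gc p s) \<Delta> \<alpha> \<sigma> z \<and> \<alpha> z = Some t")
    case True
    then obtain z0 where z0: "respects_index (gc p s) \<Delta> \<alpha> \<sigma> z0 \<and> \<alpha> z0 = Some t" by blast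
    then have "(THE z. respects_index (gc p s) \<Delta> \<alpha> \<sigma> z \<and> \<alpha> z = Some t) = z0"
      by (rule the_equality) (use unique z0 in blast)
    then show ?thesis using True z0 unique unfolding \<gamma>_def by auto
  next
    case False
    then show ?thesis unfolding \<gamma>_def by auto
  qed
  moreover have "respects_index (gc p s) \<Delta> \<alpha> \<sigma> x"
    using x \<Delta> unfolding respects_index_def scalar_datum_def
    by (simp add: \<alpha>_def \<sigma>_def gc_def del: coord_simps)
  then have "\<gamma> Triangle = Some (x, 0)" unfolding \<gamma> by (simp add: \<alpha>_def)
  ultimately show ?thesis
    using derives.morphism[OF linear_datum_scalar[OF \<Delta>] linear_datum_gc] by blast
qed

text \<open>Joinings of systems become self-joinings of data, each contributing the bit 0 on the
  left copy; the final specialization is absorbed by pulling back control.\<close>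

lemma derives_gc_of_deriv:
  assumes "deriv (value_system \<Delta>) x n Y y" "controlled (int p) (s + 1) Y y" "scalar_datum \<Delta>"
  shows "\<exists>\<gamma> e. derives p \<Delta> n \<gamma> (gc p s) \<and> \<gamma> Triangle = Some (x, e)"
  using assms
proof (induction n arbitrary: \<Delta> x)
  case 0
  from 0(1) have "specializes (value_system \<Delta>) x Y y" by cases auto
  then have "controlled (int p) (s + 1) (value_system \<Delta>) x" using 0(2) by (rule controlled_specializes) simp
  then show ?case using derives_gc_of_controlled[OF 0(3)] by blast
next
  case (Suc n)
  from Suc.prems(1) obtain S where S: "S \<subseteq> idx \<Delta>" "x \<in> idx \<Delta> - S"
    "deriv (double (value_system \<Delta>) S) (Left x) n Y y"
    by cases (auto simp: value_system_def)
  have "deriv (value_system (self_join \<Delta> S)) (Left x) n Y y"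
    by (rule deriv_specialize_left[OF S(3) specializes_self_join[OF Suc.prems(3) S(1,2)]])
  from Suc.IH[OF this Suc.prems(2) scalar_datum_self_join[OF Suc.prems(3) S(1)]]
  obtain \<gamma> e where \<gamma>: "derives p (self_join \<Delta> S) n \<gamma> (gc p s)" "\<gamma> Triangle = Some (Left x, e)" by blast
  have "derives p \<Delta> (1 + n) (comp_map (join_map \<Delta> S) \<gamma>) (gc p s)"
    by (rule derives.compose[OF derives.self_join[OF linear_datum_scalar[OF Suc.prems(3)] S(1)] \<gamma>(1)])
  moreover have "comp_map (join_map \<Delta> S) \<gamma> Triangle = Some (x, 0 + e)"
    using \<gamma>(2) S(2) by (simp add: comp_map_def join_map_def)
  ultimately show ?case by auto
qed

end

subsection \<open>The quantitative theorem\<close>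

context prime_field
begin

text \<open>A relation on integer tuples restricts to tuples of reduced vectors, and there it
  exhibits the tensor power as an element of the span.\<close>

lemma not_dependent_imp_independent:
  assumes \<phi>: "\<forall>j\<in>{1..k}. \<forall>x\<in>carrier (coord_space p d). \<phi> j x = (\<Sum>l=1..d. a j l * x l) mod int p"
    and j: "j \<in> {1..k}" and "\<not> tensor_dependent p d k \<phi> j T"
  shows "forms.independent (int p) {1..k} d a T j"
proof (rule ccontr)
  interpret F: forms "int p" "{1..k}" d a by standard (use prime_p in auto)
  let ?X = "tuples p d T" and ?K = "{1..k} - {j}" and ?t = "\<lambda>q. tensor_power p d T (\<phi> q)"
  define M where "M = LinearCombinations.ring.func_space (Fp p) ?X"
  interpret M: module "Fp p" M unfolding M_def by (rule cring.func_space_is_module[OF cring_Fp])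
  have M: "carrier M = ?X \<rightarrow>\<^sub>E {0..int p - 1}" "f \<oplus>\<^bsub>M\<^esub> g = (\<lambda>xs\<in>?X. (f xs + g xs) mod int p)"
    "c \<odot>\<^bsub>M\<^esub> f = (\<lambda>xs\<in>?X. (c * f xs) mod int p)" "\<zero>\<^bsub>M\<^esub> = (\<lambda>xs\<in>?X. 0)" for f g c
    by (simp_all add: M_def ring.func_space_def[OF ring_Fp])
  assume "\<not> F.independent T j"
  then obtain c where c: "\<forall>w. [(\<Prod>r<T. F.form (w r) j) = (\<Sum>q\<in>?K. c q * (\<Prod>r<T. F.form (w r) q))] (mod int p)"
    unfolding F.independent_def by blast
  have prod: "[prod_list (map (\<phi> q) xs) = (\<Prod>r<T. F.form (xs ! r) q)] (mod int p)"
    if "xs \<in> ?X" "q \<in> {1..k}" for xs q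
  proof -
    have len: "length xs = T" using that(1) by (simp add: tuples_def)
    have "prod_list (map (\<phi> q) xs) = (\<Prod>r<T. \<phi> q (xs ! r))"
      by (simp add: prod.list_conv_set_nth len atLeast0LessThan)
    moreover have "[\<phi> q (xs ! r) = F.form (xs ! r) q] (mod int p)" if "r < T" for r
    proof -
      have "xs ! r \<in> carrier (coord_space p d)" using \<open>xs \<in> ?X\<close> len that nth_mem[of r xs] unfolding tuples_def by blast
      then show ?thesis using \<phi> \<open>q \<in> {1..k}\<close> by (simp add: F.form_def cong_def del: coord_simps)
    qed
    ultimately show ?thesis using cong_prod[of "{..<T}" "\<lambda>r. \<phi> q (xs ! r)"] by simp
  qed
  have U: "?t ` ?K \<subseteq> carrier M" unfolding M(1) tensor_power_def using mod_carrier by auto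
  interpret S: submodule "Fp p" "M.span (?t ` ?K)" M by (rule M.span_is_submodule[OF U])
  define h where "h J = (\<lambda>xs\<in>?X. (\<Sum>q\<in>J. c q * prod_list (map (\<phi> q) xs)) mod int p)" for J
  have "h J \<in> M.span (?t ` ?K)" if "finite J" "J \<subseteq> ?K" for J
    using that
  proof (induction J rule: finite_induct)
    case empty
    have "h {} = \<zero>\<^bsub>M\<^esub>" unfolding M h_def by simp
    then show ?case using S.zero_closed by simp
  next
    case (insert q J)
    have "?t q \<in> M.span (?t ` ?K)" using M.in_own_span[OF U] insert.prems by blast
    moreover have "c q mod int p \<in> carrier (Fp p)" unfolding Fp_simps by (rule mod_carrier)
    ultimately have "h J \<oplus>\<^bsub>M\<^esub> (c q mod int p) \<odot>\<^bsub>M\<^esub> ?t q \<in> M.span (?t ` ?K)"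
      using insert by (intro S.m_closed S.smult_closed) auto
    moreover have "h J \<oplus>\<^bsub>M\<^esub> (c q mod int p) \<odot>\<^bsub>M\<^esub> ?t q = h (insert q J)"
      unfolding M h_def tensor_power_def using insert.hyps
      by (auto simp: fun_eq_iff mod_add_eq mod_mult_eq add.commute)
    ultimately show ?case by simp
  qed
  then have "h ?K \<in> M.span (?t ` ?K)" by simp
  moreover have "h ?K = ?t j"
  proof -
    have "[prod_list (map (\<phi> j) xs) = (\<Sum>q\<in>?K. c q * prod_list (map (\<phi> q) xs))] (mod int p)" if "xs \<in> ?X" for xs
    proof -
      have "[(\<Sum>q\<in>?K. c q * prod_list (map (\<phi> q) xs)) = (\<Sum>q\<in>?K. c q * (\<Prod>r<T. F.form (xs ! r) q))] (mod int p)"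
        by (intro cong_sum cong_scalar_left prod[OF that]) auto
      from cong_trans[OF cong_trans[OF prod[OF that j] spec[OF c]] cong_sym[OF this]] show ?thesis .
    qed
    then show ?thesis unfolding h_def tensor_power_def by (auto simp: fun_eq_iff cong_def)
  qed
  ultimately show False using assms(3) unfolding tensor_dependent_def M_def by simp
qed

text \<open>A finite value means that the dependent exponents have a largest element, which would
  bound \<open>T\<close>.\<close>

lemma complexity_at_le:
  assumes "complexity_at p d k \<phi> j \<le> enat s" "T > s"
  shows "\<not> tensor_dependent p d k \<phi> j T"
proof
  assume T: "tensor_dependent p d k \<phi> j T"
  let ?D = "tensor_dependent p d k \<phi> j"
  obtain t where t: "?D t" "\<forall>u. ?D u \<longrightarrow> u \<le> t" "enat (GREATEST t. ?D t) \<le> enat s"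
    using assms(1) unfolding complexity_at_def by (auto split: if_splits)
  then have "(GREATEST t. ?D t) = t" by (intro Greatest_equality) auto
  then show False using t T assms(2) by fastforce
qed

lemma scalar_datum_forms:
  assumes "linear_datum p (form_system p d k \<phi>)"
  shows "scalar_datum (form_system p d k \<phi>)"
  using assms vectorspace_coord[of d] finite_coord[of d]
  by (simp add: scalar_datum_def linear_datum_def form_system_def del: coord_simps)

text \<open>With \<open>raw\<close> at every form the positions show just the values of the forms; a
  vector in the datum is found by reducing the coordinates of \<open>v\<close>.\<close>

lemma specializes_forms:
  assumes \<phi>: "\<forall>j\<in>{1..k}. \<forall>x\<in>carrier (coord_space p d). \<phi> j x = (\<Sum>l=1..d. a j l * x l) mod int p"
    and i: "i \<in> {1..k}"
  shows "specializes (value_system (form_system p d k \<phi>)) (Num i)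
    (attach {1..k} (forms.base (int p) {1..k} d a) (\<lambda>_. raw (int p))) (tag i (Num 1))"
proof -
  interpret F: forms "int p" "{1..k}" d a by standard (use prime_p in auto)
  show ?thesis
  proof (rule specializesI[where f = "\<lambda>z. case z of Num j \<Rightarrow> tag j (Num 1)" and c = "\<lambda>_. 1"])
    show "Num i \<in> positions (value_system (form_system p d k \<phi>))" using i
      by (simp add: value_system_def form_system_def)
    show "tag i (Num 1) \<in> positions (F.sys (\<lambda>_. raw (int p)))" using i by (simp add: raw_def)
  next
    fix z assume "z \<in> positions (value_system (form_system p d k \<phi>))" "z \<noteq> Num i"
    then show "(1::int) = 0 \<or> (case z of Num j \<Rightarrow> tag j (Num 1)) \<in> positions (F.sys (\<lambda>_. raw (int p))) \<and>
        (case z of Num j \<Rightarrow> tag j (Num 1)) \<noteq> tag i (Num 1)"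
      by (auto simp: value_system_def form_system_def raw_def)
  next
    fix l assume "l \<in> labels (F.sys (\<lambda>_. raw (int p)))"
    then obtain e b where e: "e \<in> F.base" and "lift {1..k} (\<lambda>_. raw (int p)) e b l"
      unfolding labels_attach_iff by blast
    note b = liftD[OF this(2)]
    obtain v where v: "\<forall>j\<in>{1..k}. [e j = F.form v j] (mod int p)" using e unfolding F.base_def by blast
    have l: "[l (tag j (Num 1)) = F.form v j] (mod int p)" if j: "j \<in> {1..k}" for j
    proof -
      have "[b j (Num 0) = b j (Num 1)] (mod int p)" "b j (Num 0) = e j" "l (tag j (Num 1)) = b j (Num 1)"
        using b[of j] j by (simp_all add: raw_def)
      then show ?thesis using v j by (metis cong_sym cong_trans)
    qed
    define w where "w = (\<lambda>m\<in>{1..d}. v m mod int p)"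
    have w: "w \<in> carrier (coord_space p d)" unfolding w_def coord_simps by (intro restrict_PiE_iff[THEN iffD2] ballI mod_carrier)
    have "\<phi> j w = l (tag j (Num 1)) mod int p" if j: "j \<in> {1..k}" for j
    proof -
      have "[(\<Sum>m=1..d. a j m * w m) = (\<Sum>m=1..d. a j m * v m)] (mod int p)"
        by (intro cong_sum cong_scalar_left) (simp add: w_def cong_def)
      then have "[l (tag j (Num 1)) = (\<Sum>m=1..d. a j m * w m)] (mod int p)"
        using l[OF j] unfolding F.form_def by (metis cong_sym cong_trans)
      then show ?thesis using \<phi> j w by (simp add: cong_def del: coord_simps)
    qed
    then show "(\<lambda>z. 1 * l (case z of Num j \<Rightarrow> tag j (Num 1))) \<in> labels (value_system (form_system p d k \<phi>))"
      using w unfolding value_system_def form_system_def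
      by (auto intro!: bexI[of _ w] simp del: coord_simps)
  qed simp_all
qed

end

section \<open>Numerical estimates of the cost\<close>

lemma ln_bounds: "1 / 2 \<le> ln (2::real)" "ln (2::real) \<le> 1" "1 \<le> ln (10::real)"
proof -
  have "exp (1 / 2) \<le> (2::real)" using exp_bound[of "1 / 2 :: real"] by (simp add: power2_eq_square)
  then show "1 / 2 \<le> ln (2::real)" by (subst ln_ge_iff) auto
  show "ln (2::real) \<le> 1" using ln_le_minus_one[of "2::real"] by simp
  have "exp 1 \<le> (10::real)" using exp_le by linarith
  then show "1 \<le> ln (10::real)" by (subst ln_ge_iff) auto
qed

lemma ln_ln_nonneg:
  assumes "L \<ge> (1::real)"
  shows "1 \<le> ln (10 * L)" "0 \<le> ln (ln (10 * L))"
proof -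
  have "ln 10 \<le> ln (10 * L)" using assms by (subst ln_le_cancel_iff) auto
  then show "1 \<le> ln (10 * L)" using ln_bounds(3) by linarith
  then show "0 \<le> ln (ln (10 * L))" by (rule ln_ge_zero)
qed

text \<open>The factor 2 bounds \<open>1 / ln 2\<close>.\<close>

lemma ex_bits:
  fixes m :: nat
  assumes "m \<ge> 1"
  shows "\<exists>n. m < 2 ^ n \<and> real n \<le> 1 + 2 * ln (real m)"
proof -
  obtain n where n: "2 ^ n \<le> m" "m < 2 ^ (n + 1)" using ex_power_ivl1[of 2 m] assms by auto
  have "real (2 ^ n) \<le> real m" using n(1) by (rule of_nat_mono)
  then have "2 ^ n \<le> real m" by simp
  then have "ln (2 ^ n) \<le> ln (real m)" using assms by (subst ln_le_cancel_iff) auto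
  then have "real n * ln 2 \<le> ln (real m)" by (simp add: ln_realpow)
  moreover have "real n * (1 / 2) \<le> real n * ln 2" using ln_bounds(1) by (intro mult_left_mono) auto
  ultimately have "real (n + 1) \<le> 1 + 2 * ln (real m)" by simp
  then show ?thesis using n(2) by blast
qed

text \<open>The length of a chain is of order \<open>2^k * k * b\<close> with \<open>b\<close> of
  order \<open>ln (10 * L)\<close>; its logarithm brings in the iterated one. The 28 collects 1,
  then 2 from \<open>2^k + 1\<close>, and twice the bound 12 for \<open>ln 13\<close>, rounded
  up.\<close>

lemma ex_parameters:
  fixes L :: real and k :: nat
  assumes L: "L \<ge> 1" and k: "k \<ge> 1"
  shows "\<exists>b n. 2 * \<lfloor>L\<rfloor>\<^sup>2 < 2 ^ b \<and> (2 ^ k + 1) * (k * (3 * b + 4)) < 2 ^ n \<and>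
    real n \<le> 28 + 2 * real k + 2 * ln (real k) + 2 * ln (ln (10 * L))"
proof -
  define A where "A = nat \<lfloor>L\<rfloor>"
  have "\<lfloor>L\<rfloor> \<ge> 1" using L by (simp add: le_floor_iff)
  then have AL: "int A = \<lfloor>L\<rfloor>" "A \<ge> 1" unfolding A_def by linarith+
  have "real A = of_int \<lfloor>L\<rfloor>" using AL(1) by (metis of_int_of_nat_eq)
  then have A: "real A \<le> L" by simp
  obtain b where b: "2 * A\<^sup>2 < 2 ^ b" "real b \<le> 1 + 2 * ln (real (2 * A\<^sup>2))"
    using ex_bits[of "2 * A\<^sup>2"] AL(2) by (auto simp: Suc_le_eq)
  have "int (2 * A\<^sup>2) < int (2 ^ b)" using b(1) by (simp only: of_nat_less_iff)
  then have bA: "2 * \<lfloor>L\<rfloor>\<^sup>2 < 2 ^ b" using AL(1) by simp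
  have lnL: "ln L \<ge> 0" using L by simp
  have "ln (real (2 * A\<^sup>2)) = ln 2 + 2 * ln (real A)" using AL(2) by (simp add: ln_mult ln_realpow)
  moreover have "ln (real A) \<le> ln L" using A AL(2) L by (subst ln_le_cancel_iff) auto
  ultimately have bL: "real b \<le> 3 + 4 * ln L" using b(2) ln_bounds(2) by linarith
  have "ln (10 * L) = ln 10 + ln L" using L by (simp add: ln_mult)
  then have "real (3 * b + 4) \<le> 13 * ln (10 * L)" using bL ln_bounds(3) lnL by simp
  then have "ln (real (3 * b + 4)) \<le> ln (13 * ln (10 * L))"
    using ln_ln_nonneg(1)[OF L] by (subst ln_le_cancel_iff) auto
  also have "\<dots> = ln 13 + ln (ln (10 * L))" using ln_ln_nonneg(1)[OF L] by (subst ln_mult) auto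
  also have "\<dots> \<le> 12 + ln (ln (10 * L))" using ln_le_minus_one[of "13::real"] by simp
  finally have c: "ln (real (3 * b + 4)) \<le> 12 + ln (ln (10 * L))" .
  have "(2::real) ^ k + 1 \<le> 2 ^ Suc k" by simp
  then have "ln ((2::real) ^ k + 1) \<le> ln (2 ^ Suc k)" by (subst ln_le_cancel_iff) (auto intro: add_pos_pos)
  also have "\<dots> = real (Suc k) * ln 2" by (rule ln_realpow)
  also have "\<dots> \<le> real (Suc k) * 1" using ln_bounds(2) by (intro mult_left_mono) auto
  finally have e: "ln ((2::real) ^ k + 1) \<le> real k + 1" by simp
  have "1 \<le> (2 ^ k + 1) * (k * (3 * b + 4))" using k by (simp add: Suc_le_eq)
  from ex_bits[OF this] obtain n where n: "(2 ^ k + 1) * (k * (3 * b + 4)) < 2 ^ n"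
    "real n \<le> 1 + 2 * ln (real ((2 ^ k + 1) * (k * (3 * b + 4))))" by blast
  have "real ((2 ^ k + 1) * (k * (3 * b + 4))) = (2 ^ k + 1) * (real k * real (3 * b + 4))"
    by (simp add: algebra_simps)
  also have "ln \<dots> = ln (2 ^ k + 1) + ln (real k * real (3 * b + 4))"
    using k by (intro ln_mult_pos add_pos_pos) auto
  also have "ln (real k * real (3 * b + 4)) = ln (real k) + ln (real (3 * b + 4))"
    using k by (intro ln_mult_pos) auto
  finally have "real n \<le> 28 + 2 * real k + 2 * ln (real k) + 2 * ln (ln (10 * L))"
    using n(2) c e by linarith
  then show ?thesis using bA n(1) by blast
qed

text \<open>For \<open>k \<ge> 2\<close> the logarithm of \<open>k\<close> is at least 1/2, so
  constants and multiples of \<open>k\<close> are absorbed by \<open>k * ln k\<close>. The 300 is 5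
  times 60.\<close>

lemma total_bound:
  fixes L :: real and k n :: nat
  assumes L: "L \<ge> 1" and k: "k \<ge> 2"
    and n: "real n \<le> 28 + 2 * real k + 2 * ln (real k) + 2 * ln (ln (10 * L))"
  shows "real (5 * (k\<^sup>2 * (3 * k + n + 14))) \<le> 300 * real k ^ 3 * (ln (real k) + ln (ln (10 * L)))"
proof -
  define l where "l = ln (real k)"
  define m where "m = ln (ln (10 * L))"
  have k2: "2 \<le> real k" using k by simp
  have "ln 2 \<le> l" unfolding l_def using k2 by (subst ln_le_cancel_iff) auto
  then have l: "1 / 2 \<le> l" using ln_bounds(1) by linarith
  have m: "0 \<le> m" unfolding m_def by (rule ln_ln_nonneg(2)[OF L])
  have "real k * (1 / 2) \<le> real k * l" by (rule mult_left_mono[OF l]) simp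
  moreover have "2 * l \<le> real k * l" by (rule mult_right_mono[OF k2]) (use l in linarith)
  moreover have "2 * m \<le> real k * m" by (rule mult_right_mono[OF k2 m])
  moreover have "real (3 * k + n + 14) = 3 * real k + real n + 14" by simp
  ultimately have "real (3 * k + n + 14) \<le> 60 * (real k * l) + 60 * (real k * m)"
    using n[folded l_def m_def] m k2 by linarith
  then have "(real k)\<^sup>2 * real (3 * k + n + 14) \<le> (real k)\<^sup>2 * (60 * (real k * l) + 60 * (real k * m))"
    by (rule mult_left_mono) simp
  moreover have "5 * ((real k)\<^sup>2 * (60 * (real k * l) + 60 * (real k * m))) = 300 * real k ^ 3 * (l + m)"
    by (simp add: power2_eq_square power3_eq_cube distrib_left)
  moreover have "real (5 * (k\<^sup>2 * (3 * k + n + 14))) = 5 * ((real k)\<^sup>2 * real (3 * k + n + 14))"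
    by (simp only: of_nat_mult of_nat_power of_nat_numeral)
  ultimately show ?thesis unfolding l_def m_def by linarith
qed

theorem theorem3p7:
  shows "\<exists>C::real. C > 0 \<and>
    (\<forall>(p::nat) (d::nat) (k::nat) (\<phi>::nat \<Rightarrow> vector \<Rightarrow> int) (i::nat) (s::nat)
      (a::nat \<Rightarrow> nat \<Rightarrow> int) (L::real).
      prime p \<longrightarrow>
      linear_datum p (form_system p d k \<phi>) \<longrightarrow>
      i \<in> {1..k} \<longrightarrow>
      complexity_at p d k \<phi> i = enat s \<longrightarrow>
      complexity p d k \<phi> \<le> enat (s + 1) \<longrightarrow>
      (\<forall>j\<in>{1..k}. \<forall>x\<in>carrier (coord_space p d).
         \<phi> j x = (\<Sum>l=1..d. a j l * x l) mod int p) \<longrightarrow>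
      (\<forall>j\<in>{1..k}. \<forall>l\<in>{1..d}. \<bar>real_of_int (a j l)\<bar> \<le> L) \<longrightarrow>
      (\<exists>(M::nat) \<gamma>.
         derives p (form_system p d k \<phi>) M \<gamma> (gc p s) \<and>
         (\<gamma> Triangle = Some (Num i, 0) \<or> \<gamma> Triangle = Some (Num i, 1)) \<and>
         real M \<le> C * real k ^ 3 * (ln (real k) + ln (ln (10 * L)))))"
proof (rule exI[of _ 300], intro conjI allI impI)
  fix p d k :: nat and \<phi> i s and a :: "nat \<Rightarrow> nat \<Rightarrow> int" and L :: real
  assume prime: "prime p" and lin: "linear_datum p (form_system p d k \<phi>)" and i: "i \<in> {1..k}"
    and s: "complexity_at p d k \<phi> i = enat s" "complexity p d k \<phi> \<le> enat (s + 1)"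
    and \<phi>: "\<forall>j\<in>{1..k}. \<forall>x\<in>carrier (coord_space p d). \<phi> j x = (\<Sum>l=1..d. a j l * x l) mod int p"
    and bound: "\<forall>j\<in>{1..k}. \<forall>l\<in>{1..d}. \<bar>real_of_int (a j l)\<bar> \<le> L"
  interpret prime_field p by standard (rule prime)
  interpret F: forms "int p" "{1..k}" d a by standard (use prime in auto)
  have "complexity_at p d k \<phi> j \<le> enat (s + 1)" if "j \<in> {1..k}" for j
    using order_trans[OF Max_ge s(2)[unfolded complexity_def]] that by simp
  then have ind: "F.independent T j" if "j \<in> {1..k}" "T \<ge> s + 2" for j T
    using that by (intro not_dependent_imp_independent[OF \<phi> that(1)] complexity_at_le[where s = "s + 1"]) auto
  have ind_i: "F.independent (s + 1) i"
    using s(1) by (intro not_dependent_imp_independent[OF \<phi> i] complexity_at_le[where s = s]) auto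
  \<comment> \<open>A coefficient not divisible by \<open>p\<close> is a nonzero integer, so
    \<open>L\<close> is at least 1 and the iterated logarithm is nonnegative.\<close>
  obtain l where l: "l \<in> {1..d}" "\<not> int p dvd a i l" using F.independent_nonzero[OF ind_i] by auto
  then have "\<bar>a i l\<bar> \<ge> 1" by (cases "a i l = 0") auto
  then have "1 \<le> \<bar>real_of_int (a i l)\<bar>" by linarith
  also have "\<dots> \<le> L" using bound i l(1) by blast
  finally have L: "L \<ge> 1" .
  obtain b n where n: "2 * \<lfloor>L\<rfloor>\<^sup>2 < 2 ^ b" "(2 ^ k + 1) * (k * (3 * b + 4)) < 2 ^ n"
    "real n \<le> 28 + 2 * real k + 2 * ln (real k) + 2 * ln (ln (10 * L))"
    using ex_parameters[OF L order_trans[of 1 i k]] i unfolding atLeastAtMost_iff by blast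
  interpret X: levels "int p" "{1..k}" d a i s b n "\<lfloor>L\<rfloor>"
  proof
    show "\<bar>a q l\<bar> \<le> \<lfloor>L\<rfloor>" if "q \<in> {1..k}" "l \<in> {1..d}" for q l
      using bound that by (simp add: le_floor_iff)
    show "F.independent T j" if "j \<in> {1..k}" "T \<ge> s + 2" for j T using that by (rule ind)
    show "F.independent (s + 1) i" by (rule ind_i)
    show "1 \<le> \<lfloor>L\<rfloor>" using L by simp
    show "2 * \<lfloor>L\<rfloor>\<^sup>2 < 2 ^ b" by (rule n(1))
    show "(2 ^ card {1..k} + 1) * (card {1..k} * (3 * b + 4)) < 2 ^ n" using n(2) by simp
  qed (rule i)
  have card: "card {1..k} = k" by simp
  obtain N Y y where N: "N \<le> (if k \<le> s + 1 then 0 else 5 * (k\<^sup>2 * (3 * k + n + 14)))"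
    "deriv (F.sys (\<lambda>_. raw (int p))) X.target N Y y" "controlled (int p) (s + 1) Y y"
    using X.deriv_controlled unfolding card by blast
  have "deriv (value_system (form_system p d k \<phi>)) (Num i) N Y y"
    by (rule deriv_specialize_left[OF N(2) specializes_forms[OF \<phi> i]])
  from derives_gc_of_deriv[OF this N(3) scalar_datum_forms[OF lin]]
  obtain \<gamma> e where \<gamma>: "derives p (form_system p d k \<phi>) N \<gamma> (gc p s)" "\<gamma> Triangle = Some (Num i, e)" by blast
  have "e = 0 \<or> e = 1" by (cases e) auto
  moreover have "real N \<le> 300 * real k ^ 3 * (ln (real k) + ln (ln (10 * L)))"
  proof (cases "k \<le> s + 1")
    case True
    have "ln (ln (10 * L)) \<ge> 0" by (rule ln_ln_nonneg(2)[OF L])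
    then show ?thesis using True N(1) i by simp
  next
    case False
    then have "real N \<le> real (5 * (k\<^sup>2 * (3 * k + n + 14)))" using N(1) by (simp only: of_nat_le_iff if_False)
    also have "\<dots> \<le> 300 * real k ^ 3 * (ln (real k) + ln (ln (10 * L)))"
      using False by (intro total_bound[OF L _ n(3)]) simp
    finally show ?thesis .
  qed
  ultimately have "derives p (form_system p d k \<phi>) N \<gamma> (gc p s) \<and>
      (\<gamma> Triangle = Some (Num i, 0) \<or> \<gamma> Triangle = Some (Num i, 1)) \<and>
      real N \<le> 300 * real k ^ 3 * (ln (real k) + ln (ln (10 * L)))"
    using \<gamma> by metis
  then show "\<exists>M \<gamma>. derives p (form_system p d k \<phi>) M \<gamma> (gc p s) \<and>
      (\<gamma> Triangle = Some (Num i, 0) \<or> \<gamma> Triangle = Some (Num i, 1)) \<and>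
      real M \<le> 300 * real k ^ 3 * (ln (real k) + ln (ln (10 * L)))"
    by (intro exI)
qed simp

end
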